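(* Let $(M^n,\mu,\tau,v,g,p)$, $n\ge3$, be an Aristotelian fluid with speed (squared) $s_v=g(v,v)$, vorticity $\xi$ and vorticity two-form $\omega_\xi=\xi\,\lrcorner\,\mu=\mathrm{d}v^\flat$. Let $\alpha_v=\pounds_v\tau-\mathrm{d}\log s_v$, so that $\mathrm{d}v^\flat=v^\flat\wedge\alpha_v$. Then the Godbillon-Vey class $\mathtt{GV}(\tau)=\mathtt{GV}(v^\flat)=[\alpha_v\wedge\mathrm{d}\alpha_v]\in H^3(M^n;\mathbb{R})$ can be expressed as $$\alpha_v\wedge\mathrm{d}\alpha_v=-\frac{1}{s_v^2}\,\mathrm{d}\big((\pounds_vs_v)\,\omega_\xi\big)+\frac{1}{s_v^2}\,(\iota_v\,\omega_\xi)\wedge\Big(\frac{\partial\xi}{\partial t}\,\lrcorner\,\mu\Big).$$ If the fluid speed $s_v$ is constant along the fluid lines, i.e. $\pounds_vs_v=0$, then $$\alpha_v\wedge\mathrm{d}\alpha_v=\frac{1}{s_v^2}\,(\iota_v\,\omega_\xi)\wedge\Big(\frac{\partial\xi}{\partial t}\,\lrcorner\,\mu\Big),$$ and hence the Godbillon-Vey class is an obstruction to a steady fluid flow (that is, $\frac{\partial\xi}{\partial t}=0$ is possible only if the Godbillon-Vey class of the fluid is trivial).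
   Context: An ideal incompressible fluid on an oriented $n$-manifold $M^n$ consists of a (time-independent) Riemannian metric $g$ with a Riemannian connection $\nabla$, a volume form $\mu$, a one-parameter (time $t$) family of vector fields $v$ (fluid velocity), and a time-dependent function $p$ (pressure), such that $\frac{\partial v}{\partial t}+\nabla_vv=-(\mathrm{d}p)^\sharp$ and $\mathrm{div}_\mu(v)=0$, i.e. $\pounds_v\mu=0$ (with $v$ parallel to $\partial M^n$ if the boundary is non-empty). The vorticity is the multivector field $\xi\in\Gamma(\wedge^{n-2}TM^n)$ defined by $\xi\,\lrcorner\,\mu=\mathrm{d}v^\flat$ with $v^\flat=\iota_vg$. Fluid lines are the integral curves of $v$; a flow is steady if $\frac{\partial v}{\partial t}=0$. An Aristotelian fluid $(M^n,\mu,\tau,v,g,p)$ is an ideal incompressible fluid together with one-parameter families of a nowhere-vanishing one-form $\tau$ (clock form) with $\iota_v\tau=1$, a corank one positive-semidefinite symmetric tensor $h\in\Gamma(\odot^2T^*M^n)$ with $\iota_vh=0$, and a corank one positive-semidefinite symmetric tensor $\gamma\in\Gamma(\odot^2TM^n)$ with $\iota_\tau\gamma=0$, such that $\ker(\tau)$ and $\mathrm{Span}(v)$ are $g$-orthogonal, $h$ restricts to $g$ on $\ker\tau$, $\gamma$ restricts to $g^{-1}$ on $\mathrm{Ann}(v)$, and $\tau\wedge\mathrm{d}\tau=0$. In particular $v$ is nowhere-vanishing and $v^\flat=s_v\,\tau$, so $\tau$ and $v^\flat$ define the same codimension one foliation. For a nowhere-vanishing one-form $\sigma$ with $\sigma\wedge\mathrm{d}\sigma=0$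 and any one-form $\beta$ with $\mathrm{d}\sigma=\sigma\wedge\beta$, the Godbillon-Vey class is $\mathtt{GV}(\sigma)=[\beta\wedge\mathrm{d}\beta]\in H^3(M^n;\mathbb{R})$; it depends only on the foliation defined by $\ker\sigma$.
   Formalization: The displayed formulas are false as printed; what is proved is α_v∧dα_v = −d((L_v s_v)ω_ξ/s_v²) − (1/s_v²)(ι_vω_ξ)∧(∂ξ/∂t⌟μ), i.e. 1/s_v² is moved inside d and the sign of the last term is reversed, also in the case L_v s_v=0. *)

theory Defs
  imports "HOL-Analysis.Analysis"
begin

section \<open>Smooth maps on relatively open subsets of a half-space\<close>

text \<open>
  Derivatives are taken within the domain, so that boundary points are included.
  They are unique there whenever the domain is open, is relatively open in a closed half-space,
  or is a product of an open interval with such a set; these are the only domains used below.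
\<close>

fun Ck_on :: "nat \<Rightarrow> 'a::real_normed_vector set \<Rightarrow> ('a \<Rightarrow> 'b::real_normed_vector) \<Rightarrow> bool" where
  "Ck_on 0 S f \<longleftrightarrow> continuous_on S f"
| "Ck_on (Suc k) S f \<longleftrightarrow> (\<forall>x\<in>S. f differentiable (at x within S)) \<and>
     (\<forall>h. Ck_on k S (\<lambda>x. frechet_derivative f (at x within S) h))"

definition smooth_on :: "'a::real_normed_vector set \<Rightarrow> ('a \<Rightarrow> 'b::real_normed_vector) \<Rightarrow> bool" where
  "smooth_on S f \<longleftrightarrow> (\<forall>k. Ck_on k S f)"


section \<open>Oriented manifolds with (possibly empty) boundary\<close>

text \<open>
  The manifold is the whole type \<open>'p\<close>; the Hausdorff property and second countability enter as type
  class constraints on \<open>'p\<close>. A chart is its domain together with the coordinate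
  map; its image is open in \<open>real ^ 'n\<close> or relatively open in the half-space. The
  boundary consists of the points whose coordinates are not interior to the chart image.
\<close>

type_synonym ('p, 'n) chart = "'p set \<times> ('p \<Rightarrow> real ^ 'n)"

definition bdry_axis :: "'n::finite" where
  "bdry_axis = (SOME i. True)"

definition half_space :: "(real ^ 'n::finite) set" where
  "half_space = {x. 0 \<le> x $ bdry_axis}"

definition img :: "('p, 'n::finite) chart \<Rightarrow> (real ^ 'n) set" where
  "img c = snd c ` fst c"

definition is_chart :: "('p::topological_space, 'n::finite) chart \<Rightarrow> bool" where
  "is_chart c \<longleftrightarrow> open (fst c) \<and>
     (open (img c) \<or> openin (top_of_set half_space) (img c)) \<and>
     (\<exists>\<psi>. homeomorphism (fst c) (img c) (snd c) \<psi>)"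

definition overlap :: "('p, 'n::finite) chart \<Rightarrow> ('p, 'n) chart \<Rightarrow> (real ^ 'n) set" where
  "overlap c c' = snd c ` (fst c \<inter> fst c')"

definition trans_map :: "('p, 'n::finite) chart \<Rightarrow> ('p, 'n) chart \<Rightarrow> real ^ 'n \<Rightarrow> real ^ 'n" where
  "trans_map c c' x = snd c' (inv_into (fst c) (snd c) x)"

definition jac :: "('p, 'n::finite) chart \<Rightarrow> ('p, 'n) chart \<Rightarrow> real ^ 'n \<Rightarrow> real ^ 'n \<Rightarrow> real ^ 'n" where
  "jac c c' x = frechet_derivative (trans_map c c') (at x within overlap c c')"

definition oriented_atlas :: "('p::topological_space, 'n::finite) chart set \<Rightarrow> bool" where
  "oriented_atlas A \<longleftrightarrow> (\<forall>c\<in>A. is_chart c) \<and> \<Union>(fst ` A) = UNIV \<and>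
     (\<forall>c\<in>A. \<forall>c'\<in>A. smooth_on (overlap c c') (trans_map c c') \<and>
        (\<forall>x\<in>overlap c c'. 0 < det (matrix (jac c c' x))))"


section \<open>Tensor fields\<close>

text \<open>
  A tensor field is the family of its local representatives: for every chart \<open>c\<close> a function
  on \<open>img c\<close>, subject to the transformation law of its type (values off \<open>img c\<close> and for charts
  outside the atlas are irrelevant). Tangent vectors are represented by their components;
  covectors by their components \<open>\<theta>\<close>, paired with vectors by \<open>\<theta> \<bullet> X\<close>, so that they transform by
  the adjoint of the Jacobian.

  The values of \<open>k\<close>-forms are functions of a sequence of vectors depending only on its first
  \<open>k\<close> entries; the values of \<open>k\<close>-vectors are, dually, such functions of a sequence of covectors.
\<close>

type_synonym ('p, 'n, 'b) field = "('p, 'n) chart \<Rightarrow> real ^ 'n \<Rightarrow> 'b"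
type_synonym ('p, 'n) scalar = "('p, 'n, real) field"
type_synonym ('p, 'n) vfield = "('p, 'n, real ^ 'n) field"
type_synonym ('p, 'n) form = "('p, 'n, (nat \<Rightarrow> real ^ 'n) \<Rightarrow> real) field"
type_synonym ('p, 'n) multivec = "('p, 'n, (nat \<Rightarrow> real ^ 'n) \<Rightarrow> real) field"
type_synonym ('p, 'n) bilin = "('p, 'n, real ^ 'n \<Rightarrow> real ^ 'n \<Rightarrow> real) field"

definition field_eq :: "('p, 'n::finite) chart set \<Rightarrow> ('p, 'n, 'b) field \<Rightarrow> ('p, 'n, 'b) field \<Rightarrow> bool" where
  "field_eq A F G \<longleftrightarrow> (\<forall>c\<in>A. \<forall>x\<in>img c. F c x = G c x)"

definition smooth_field ::
    "('p, 'n::finite) chart set \<Rightarrow> ('p, 'n, 'b::real_normed_vector) field \<Rightarrow> bool" where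
  "smooth_field A F \<longleftrightarrow> (\<forall>c\<in>A. smooth_on (img c) (F c))"

definition smooth_family ::
    "('p, 'n::finite) chart set \<Rightarrow> real set \<Rightarrow> (real \<Rightarrow> ('p, 'n, 'b::real_normed_vector) field) \<Rightarrow> bool" where
  "smooth_family A I F \<longleftrightarrow> (\<forall>c\<in>A. smooth_on (I \<times> img c) (\<lambda>(t, x). F t c x))"

definition alt_map :: "nat \<Rightarrow> ((nat \<Rightarrow> real ^ 'n::finite) \<Rightarrow> real) \<Rightarrow> bool" where
  "alt_map k \<phi> \<longleftrightarrow>
     (\<forall>X Y. (\<forall>i<k. X i = Y i) \<longrightarrow> \<phi> X = \<phi> Y) \<and>
     (\<forall>X. \<forall>i<k. linear (\<lambda>z. \<phi> (X(i := z)))) \<and>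
     (\<forall>X. \<forall>i<k. \<forall>j<k. i \<noteq> j \<and> X i = X j \<longrightarrow> \<phi> X = 0)"

definition scalar_field :: "('p, 'n::finite) chart set \<Rightarrow> ('p, 'n) scalar \<Rightarrow> bool" where
  "scalar_field A f \<longleftrightarrow> smooth_field A f \<and>
     (\<forall>c\<in>A. \<forall>c'\<in>A. \<forall>x\<in>overlap c c'. f c' (trans_map c c' x) = f c x)"

definition vector_field :: "('p, 'n::finite) chart set \<Rightarrow> ('p, 'n) vfield \<Rightarrow> bool" where
  "vector_field A V \<longleftrightarrow> smooth_field A V \<and>
     (\<forall>c\<in>A. \<forall>c'\<in>A. \<forall>x\<in>overlap c c'. V c' (trans_map c c' x) = jac c c' x (V c x))"

definition form_field :: "('p, 'n::finite) chart set \<Rightarrow> nat \<Rightarrow> ('p, 'n) form \<Rightarrow> bool" where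
  "form_field A k \<omega> \<longleftrightarrow>
     (\<forall>c\<in>A. \<forall>x\<in>img c. alt_map k (\<omega> c x)) \<and>
     (\<forall>X. smooth_field A (\<lambda>c x. \<omega> c x X)) \<and>
     (\<forall>c\<in>A. \<forall>c'\<in>A. \<forall>x\<in>overlap c c'. \<forall>X.
        \<omega> c' (trans_map c c' x) (\<lambda>i. jac c c' x (X i)) = \<omega> c x X)"

definition multivector_field :: "('p, 'n::finite) chart set \<Rightarrow> nat \<Rightarrow> ('p, 'n) multivec \<Rightarrow> bool" where
  "multivector_field A k \<xi> \<longleftrightarrow>
     (\<forall>c\<in>A. \<forall>x\<in>img c. alt_map k (\<xi> c x)) \<and>
     (\<forall>\<Theta>. smooth_field A (\<lambda>c x. \<xi> c x \<Theta>)) \<and>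
     (\<forall>c\<in>A. \<forall>c'\<in>A. \<forall>x\<in>overlap c c'. \<forall>\<Theta>.
        \<xi> c' (trans_map c c' x) \<Theta> = \<xi> c x (\<lambda>i. adjoint (jac c c' x) (\<Theta> i)))"

definition sym_bilin :: "(real ^ 'n::finite \<Rightarrow> real ^ 'n \<Rightarrow> real) \<Rightarrow> bool" where
  "sym_bilin B \<longleftrightarrow> bilinear B \<and> (\<forall>X Y. B X Y = B Y X)"

text \<open>Sections of the symmetric squares of the cotangent and of the tangent bundle.\<close>

definition sym_cov_field :: "('p, 'n::finite) chart set \<Rightarrow> ('p, 'n) bilin \<Rightarrow> bool" where
  "sym_cov_field A B \<longleftrightarrow>
     (\<forall>c\<in>A. \<forall>x\<in>img c. sym_bilin (B c x)) \<and>
     (\<forall>X Y. smooth_field A (\<lambda>c x. B c x X Y)) \<and>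
     (\<forall>c\<in>A. \<forall>c'\<in>A. \<forall>x\<in>overlap c c'. \<forall>X Y.
        B c' (trans_map c c' x) (jac c c' x X) (jac c c' x Y) = B c x X Y)"

definition sym_contra_field :: "('p, 'n::finite) chart set \<Rightarrow> ('p, 'n) bilin \<Rightarrow> bool" where
  "sym_contra_field A B \<longleftrightarrow>
     (\<forall>c\<in>A. \<forall>x\<in>img c. sym_bilin (B c x)) \<and>
     (\<forall>\<theta> \<eta>. smooth_field A (\<lambda>c x. B c x \<theta> \<eta>)) \<and>
     (\<forall>c\<in>A. \<forall>c'\<in>A. \<forall>x\<in>overlap c c'. \<forall>\<theta> \<eta>.
        B c' (trans_map c c' x) \<theta> \<eta> = B c x (adjoint (jac c c' x) \<theta>) (adjoint (jac c c' x) \<eta>))"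

definition corank_one_psd :: "(real ^ 'n::finite \<Rightarrow> real ^ 'n \<Rightarrow> real) \<Rightarrow> bool" where
  "corank_one_psd B \<longleftrightarrow> (\<forall>X. 0 \<le> B X X) \<and> dim {X. \<forall>Y. B X Y = 0} = 1"


section \<open>Exterior calculus\<close>

definition chart_deriv ::
    "('p, 'n::finite) chart \<Rightarrow> (real ^ 'n \<Rightarrow> 'b::real_normed_vector) \<Rightarrow> real ^ 'n \<Rightarrow> real ^ 'n \<Rightarrow> 'b" where
  "chart_deriv c f x = frechet_derivative f (at x within img c)"

definition zero_form :: "('p, 'n::finite) scalar \<Rightarrow> ('p, 'n) form" where
  "zero_form f = (\<lambda>c x X. f c x)"

definition scale_form :: "('p, 'n::finite) scalar \<Rightarrow> ('p, 'n) form \<Rightarrow> ('p, 'n) form" where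
  "scale_form f \<omega> = (\<lambda>c x X. f c x * \<omega> c x X)"

definition omit :: "nat \<Rightarrow> (nat \<Rightarrow> 'a) \<Rightarrow> nat \<Rightarrow> 'a" where
  "omit i X = (\<lambda>j. if j < i then X j else X (Suc j))"

definition ext_d :: "nat \<Rightarrow> ('p, 'n::finite) form \<Rightarrow> ('p, 'n) form" where
  "ext_d k \<omega> = (\<lambda>c x X. \<Sum>i\<le>k. (-1) ^ i * chart_deriv c (\<lambda>y. \<omega> c y (omit i X)) x (X i))"

text \<open>Normalised so that \<open>(\<sigma> \<and> \<beta>)(X, Y) = \<sigma>(X) \<beta>(Y) - \<sigma>(Y) \<beta>(X)\<close> for one-forms.\<close>

definition wedge :: "nat \<Rightarrow> nat \<Rightarrow> ('p, 'n::finite) form \<Rightarrow> ('p, 'n) form \<Rightarrow> ('p, 'n) form" where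
  "wedge k l \<omega> \<eta> = (\<lambda>c x X.
     (\<Sum>\<pi> | \<pi> permutes {..<k + l}.
        of_int (sign \<pi>) * \<omega> c x (\<lambda>i. X (\<pi> i)) * \<eta> c x (\<lambda>i. X (\<pi> (k + i)))) / (fact k * fact l))"

definition int_prod :: "('p, 'n::finite) vfield \<Rightarrow> ('p, 'n) form \<Rightarrow> ('p, 'n) form" where
  "int_prod V \<omega> = (\<lambda>c x X. \<omega> c x (case_nat (V c x) X))"

definition lie_scalar :: "('p, 'n::finite) vfield \<Rightarrow> ('p, 'n) scalar \<Rightarrow> ('p, 'n) scalar" where
  "lie_scalar V f = (\<lambda>c x. chart_deriv c (f c) x (V c x))"

definition lie_form :: "nat \<Rightarrow> ('p, 'n::finite) vfield \<Rightarrow> ('p, 'n) form \<Rightarrow> ('p, 'n) form" where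
  "lie_form k V \<omega> = (\<lambda>c x X. chart_deriv c (\<lambda>y. \<omega> c y X) x (V c x) +
     (\<Sum>i<k. \<omega> c x (X(i := chart_deriv c (V c) x (X i)))))"

text \<open>
  The contraction of a \<open>k\<close>-vector with a form, in components: \<open>1/k!\<close> times the sum over all
  \<open>k\<close>-tuples of indices of \<open>\<xi>\<close>'s components times \<open>\<mu>\<close> with the corresponding basis vectors
  in its first \<open>k\<close> slots, i.e. \<open>X\<^sub>1 \<and> \<dots> \<and> X\<^sub>k \<lrcorner> \<mu> = \<mu>(X\<^sub>1, \<dots>, X\<^sub>k, -)\<close>.
\<close>

definition contract :: "nat \<Rightarrow> ('p, 'n::finite) multivec \<Rightarrow> ('p, 'n) form \<Rightarrow> ('p, 'n) form" where
  "contract k \<xi> \<mu> = (\<lambda>c x Y.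
     (\<Sum>a\<in>{..<k} \<rightarrow>\<^sub>E (UNIV :: 'n set).
        \<xi> c x (\<lambda>j. axis (a j) 1) * \<mu> c x (\<lambda>j. if j < k then axis (a j) 1 else Y (j - k))) / fact k)"

definition time_deriv_multivec :: "(real \<Rightarrow> ('p, 'n::finite) multivec) \<Rightarrow> real \<Rightarrow> ('p, 'n) multivec" where
  "time_deriv_multivec \<xi> t = (\<lambda>c x \<Theta>. vector_derivative (\<lambda>r. \<xi> r c x \<Theta>) (at t))"

definition covec :: "('p, 'n::finite) form \<Rightarrow> ('p, 'n, real ^ 'n) field" where
  "covec \<sigma> = (\<lambda>c x. \<chi> i. \<sigma> c x (\<lambda>_. axis i 1))"


section \<open>De Rham cohomology and the Godbillon-Vey class\<close>

definition closed_form :: "('p, 'n::finite) chart set \<Rightarrow> nat \<Rightarrow> ('p, 'n) form \<Rightarrow> bool" where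
  "closed_form A k \<omega> \<longleftrightarrow> form_field A k \<omega> \<and> field_eq A (ext_d k \<omega>) (\<lambda>c x X. 0)"

definition exact_form :: "('p, 'n::finite) chart set \<Rightarrow> nat \<Rightarrow> ('p, 'n) form \<Rightarrow> bool" where
  "exact_form A k \<omega> \<longleftrightarrow> (case k of
       0 \<Rightarrow> field_eq A \<omega> (\<lambda>c x X. 0)
     | Suc m \<Rightarrow> \<exists>\<theta>. form_field A m \<theta> \<and> field_eq A \<omega> (ext_d m \<theta>))"

definition deRham_class :: "('p, 'n::finite) chart set \<Rightarrow> nat \<Rightarrow> ('p, 'n) form \<Rightarrow> ('p, 'n) form set" where
  "deRham_class A k \<omega> = {\<eta>. closed_form A k \<eta> \<and> exact_form A k (\<lambda>c x X. \<eta> c x X - \<omega> c x X)}"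

definition deRham_cohomology :: "('p, 'n::finite) chart set \<Rightarrow> nat \<Rightarrow> ('p, 'n) form set set" where
  "deRham_cohomology A k = deRham_class A k ` {\<omega>. closed_form A k \<omega>}"

definition GV :: "('p, 'n::finite) chart set \<Rightarrow> ('p, 'n) form \<Rightarrow> ('p, 'n) form set" where
  "GV A \<sigma> = (THE C. \<exists>\<beta>. form_field A 1 \<beta> \<and> field_eq A (ext_d 1 \<sigma>) (wedge 1 1 \<sigma> \<beta>) \<and>
     C = deRham_class A 3 (wedge 1 2 \<beta> (ext_d 1 \<beta>)))"


section \<open>Riemannian metrics\<close>

definition riemannian_metric :: "('p, 'n::finite) chart set \<Rightarrow> ('p, 'n) bilin \<Rightarrow> bool" where
  "riemannian_metric A g \<longleftrightarrow> sym_cov_field A g \<and>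
     (\<forall>c\<in>A. \<forall>x\<in>img c. \<forall>X. X \<noteq> 0 \<longrightarrow> 0 < g c x X X)"

text \<open>
  \<open>\<Gamma>\<close> are the connection coefficients, \<open>\<nabla>\<^sub>V W = DW(V) + \<Gamma>(V, W)\<close>. Being torsion-free and
  metric determines them in every chart, so no transformation law has to be required.
\<close>

definition levi_civita ::
    "('p, 'n::finite) chart set \<Rightarrow> ('p, 'n) bilin \<Rightarrow>
     ('p, 'n, real ^ 'n \<Rightarrow> real ^ 'n \<Rightarrow> real ^ 'n) field \<Rightarrow> bool" where
  "levi_civita A g \<Gamma> \<longleftrightarrow> (\<forall>c\<in>A. \<forall>x\<in>img c.
     bilinear (\<Gamma> c x) \<and> (\<forall>X Y. \<Gamma> c x X Y = \<Gamma> c x Y X) \<and>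
     (\<forall>X Y Z. chart_deriv c (\<lambda>y. g c y X Y) x Z = g c x (\<Gamma> c x Z X) Y + g c x X (\<Gamma> c x Z Y)))"

definition cov_deriv ::
    "('p, 'n::finite, real ^ 'n \<Rightarrow> real ^ 'n \<Rightarrow> real ^ 'n) field \<Rightarrow>
     ('p, 'n) vfield \<Rightarrow> ('p, 'n) vfield \<Rightarrow> ('p, 'n) vfield" where
  "cov_deriv \<Gamma> V W = (\<lambda>c x. chart_deriv c (W c) x (V c x) + \<Gamma> c x (V c x) (W c x))"

definition flat :: "('p, 'n::finite) bilin \<Rightarrow> ('p, 'n) vfield \<Rightarrow> ('p, 'n) form" where
  "flat g V = (\<lambda>c x X. g c x (V c x) (X 0))"

definition sharp :: "('p, 'n::finite) bilin \<Rightarrow> ('p, 'n, real ^ 'n) field \<Rightarrow> ('p, 'n) vfield" where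
  "sharp g \<theta> = (\<lambda>c x. THE W. \<forall>Y. g c x W Y = \<theta> c x \<bullet> Y)"

definition inverse_metric :: "('p, 'n::finite) bilin \<Rightarrow> ('p, 'n) bilin" where
  "inverse_metric g = (\<lambda>c x \<theta> \<eta>. \<theta> \<bullet> sharp g (\<lambda>_ _. \<eta>) c x)"


section \<open>Ideal and Aristotelian fluids\<close>

definition volume_form :: "('p, 'n::finite) chart set \<Rightarrow> ('p, 'n) form \<Rightarrow> bool" where
  "volume_form A \<mu> \<longleftrightarrow> form_field A CARD('n) \<mu> \<and> (\<forall>c\<in>A. \<forall>x\<in>img c. \<exists>X. \<mu> c x X \<noteq> 0)"

definition parallel_to_boundary :: "('p, 'n::finite) chart set \<Rightarrow> ('p, 'n) vfield \<Rightarrow> bool" where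
  "parallel_to_boundary A V \<longleftrightarrow>
     (\<forall>c\<in>A. \<forall>x\<in>img c - interior (img c). V c x $ bdry_axis = 0)"

text \<open>\<open>I\<close> is the interval of time on which the fluid is considered.\<close>

definition ideal_fluid ::
    "('p::topological_space, 'n::finite) chart set \<Rightarrow> real set \<Rightarrow> ('p, 'n) bilin \<Rightarrow>
     ('p, 'n, real ^ 'n \<Rightarrow> real ^ 'n \<Rightarrow> real ^ 'n) field \<Rightarrow> ('p, 'n) form \<Rightarrow>
     (real \<Rightarrow> ('p, 'n) vfield) \<Rightarrow> (real \<Rightarrow> ('p, 'n) scalar) \<Rightarrow> bool" where
  "ideal_fluid A I g \<Gamma> \<mu> v p \<longleftrightarrow>
     oriented_atlas A \<and> open I \<and> is_interval I \<and>
     riemannian_metric A g \<and> levi_civita A g \<Gamma> \<and> volume_form A \<mu> \<and>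
     smooth_family A I v \<and> (\<forall>t\<in>I. vector_field A (v t)) \<and>
     smooth_family A I p \<and> (\<forall>t\<in>I. scalar_field A (p t)) \<and>
     (\<forall>t\<in>I. parallel_to_boundary A (v t)) \<and>
     (\<forall>t\<in>I. field_eq A
        (\<lambda>c x. vector_derivative (\<lambda>r. v r c x) (at t) + cov_deriv \<Gamma> (v t) (v t) c x)
        (\<lambda>c x. - sharp g (covec (ext_d 0 (zero_form (p t)))) c x)) \<and>
     (\<forall>t\<in>I. field_eq A (lie_form CARD('n) (v t) \<mu>) (\<lambda>c x X. 0))"

definition aristotelian_fluid ::
    "('p::topological_space, 'n::finite) chart set \<Rightarrow> real set \<Rightarrow> ('p, 'n) bilin \<Rightarrow>
     ('p, 'n, real ^ 'n \<Rightarrow> real ^ 'n \<Rightarrow> real ^ 'n) field \<Rightarrow> ('p, 'n) form \<Rightarrow>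
     (real \<Rightarrow> ('p, 'n) vfield) \<Rightarrow> (real \<Rightarrow> ('p, 'n) scalar) \<Rightarrow>
     (real \<Rightarrow> ('p, 'n) form) \<Rightarrow> (real \<Rightarrow> ('p, 'n) bilin) \<Rightarrow> (real \<Rightarrow> ('p, 'n) bilin) \<Rightarrow> bool" where
  "aristotelian_fluid A I g \<Gamma> \<mu> v p \<tau> h \<gamma> \<longleftrightarrow>
     ideal_fluid A I g \<Gamma> \<mu> v p \<and>
     (\<forall>X. smooth_family A I (\<lambda>t c x. \<tau> t c x X)) \<and> (\<forall>t\<in>I. form_field A 1 (\<tau> t)) \<and>
     (\<forall>X Y. smooth_family A I (\<lambda>t c x. h t c x X Y)) \<and> (\<forall>t\<in>I. sym_cov_field A (h t)) \<and>
     (\<forall>\<theta> \<eta>. smooth_family A I (\<lambda>t c x. \<gamma> t c x \<theta> \<eta>)) \<and> (\<forall>t\<in>I. sym_contra_field A (\<gamma> t)) \<and>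
     (\<forall>t\<in>I. \<forall>c\<in>A. \<forall>x\<in>img c.
        (\<exists>X. \<tau> t c x X \<noteq> 0) \<and> (\<forall>X. int_prod (v t) (\<tau> t) c x X = 1) \<and>
        corank_one_psd (h t c x) \<and> (\<forall>Y. h t c x (v t c x) Y = 0) \<and>
        corank_one_psd (\<gamma> t c x) \<and> (\<forall>\<eta>. \<gamma> t c x (covec (\<tau> t) c x) \<eta> = 0) \<and>
        (\<forall>X. \<tau> t c x (\<lambda>_. X) = 0 \<longrightarrow> (\<forall>W\<in>span {v t c x}. g c x X W = 0)) \<and>
        (\<forall>X Y. \<tau> t c x (\<lambda>_. X) = 0 \<and> \<tau> t c x (\<lambda>_. Y) = 0 \<longrightarrow> h t c x X Y = g c x X Y) \<and>
        (\<forall>\<theta> \<eta>. \<theta> \<bullet> v t c x = 0 \<and> \<eta> \<bullet> v t c x = 0 \<longrightarrow> \<gamma> t c x \<theta> \<eta> = inverse_metric g c x \<theta> \<eta>)) \<and>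
     (\<forall>t\<in>I. field_eq A (wedge 1 2 (\<tau> t) (ext_d 1 (\<tau> t))) (\<lambda>c x X. 0))"

text \<open>\<open>\<xi>\<close> is the vorticity of \<open>v\<close>; since \<open>\<mu>\<close> is nowhere vanishing, it is determined by \<open>v\<close>, \<open>g\<close>, \<open>\<mu>\<close>.\<close>

definition is_vorticity ::
    "('p, 'n::finite) chart set \<Rightarrow> real set \<Rightarrow> ('p, 'n) bilin \<Rightarrow> ('p, 'n) form \<Rightarrow>
     (real \<Rightarrow> ('p, 'n) vfield) \<Rightarrow> (real \<Rightarrow> ('p, 'n) multivec) \<Rightarrow> bool" where
  "is_vorticity A I g \<mu> v \<xi> \<longleftrightarrow>
     (\<forall>\<Theta>. smooth_family A I (\<lambda>t c x. \<xi> t c x \<Theta>)) \<and>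
     (\<forall>t\<in>I. multivector_field A (CARD('n) - 2) (\<xi> t) \<and>
        field_eq A (contract (CARD('n) - 2) (\<xi> t) \<mu>) (ext_d 1 (flat g (v t))))"

definition speed_sq :: "('p, 'n::finite) bilin \<Rightarrow> ('p, 'n) vfield \<Rightarrow> ('p, 'n) scalar" where
  "speed_sq g V = (\<lambda>c x. g c x (V c x) (V c x))"

definition alpha_form :: "('p, 'n::finite) bilin \<Rightarrow> ('p, 'n) vfield \<Rightarrow> ('p, 'n) form \<Rightarrow> ('p, 'n) form" where
  "alpha_form g V \<tau> = (\<lambda>c x X.
     lie_form 1 V \<tau> c x X - ext_d 0 (zero_form (\<lambda>c x. ln (speed_sq g V c x))) c x X)"

end

(*
  Let u = v^flat, s = s_v and omega = du. Orthogonality gives u = s tau, and contracting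
  tau /\ d tau = 0 with v gives d tau = tau /\ L_v tau, hence omega = u /\ alpha.
  Euler's equation says d_t u = - iota_v omega - d(p + s/2), so d_t omega = - d eta for
  eta = iota_v omega = s alpha + (L_v s / s) u, and expanding eta /\ d eta with u /\ d alpha = 0 gives
  the formula for alpha /\ d alpha.
  The class is well defined: if d sigma = sigma /\ beta = sigma /\ beta', then beta' = beta + f sigma with
  f = (beta' - beta)(v) / sigma(v), and beta' /\ d beta' - beta /\ d beta = d(f d sigma).
  Passing from tau to u changes beta by d(ln s), and so beta /\ d beta by the exact form d(ln s d beta).
*)
theory Submission
  imports Defs
begin

section \<open>Calculus on cornered domains\<close>

text \<open>The foliation argument is pointwise algebra; regularity is what shapes the development.
  Derivatives are taken within chart images that may contain boundary points, so their uniqueness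
  and the symmetry of second derivatives are proved on such sets first. Symmetry is behind d d = 0,
  the tensoriality of d, and the exchange of time and space derivatives in the vorticity equation.
  Fields are controlled only on chart images; hence the recurring congruence lemmas and
  \<open>field_eq\<close> instead of equality. No form of degree above three is needed except the
  differential of a three-form. Wedges and differentials are therefore evaluated on arguments once
  and for all, and the identities end as polynomial identities between values of one- and two-forms.
  The velocity is transverse to the foliation, since \<tau>(v) = 1 and v^flat(v) = s > 0. Dividing
  by these values yields global scalars without a partition of unity. Transversality also gives
  closedness of \<beta> \<and> d\<beta>: from \<sigma> \<and> d\<beta> = 0 it follows that d\<beta>
  is a multiple of \<sigma>, so d\<beta> \<and> d\<beta> = 0.\<close>

text \<open>Every point is the lower corner of a box inside the domain. This holds for open sets and for
  relatively open subsets of the half-space, is inherited by products, and suffices both for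
  uniqueness of derivatives within the domain and for Schwarz's theorem up to the boundary.\<close>

definition cornered :: "'a::euclidean_space set \<Rightarrow> bool" where
  "cornered S \<longleftrightarrow> (\<forall>x\<in>S. \<exists>e>0. cbox x (x + e *\<^sub>R One) \<subseteq> S)"

abbreviation fd ::
    "'a::real_normed_vector set \<Rightarrow> ('a \<Rightarrow> 'b::real_normed_vector) \<Rightarrow> 'a \<Rightarrow> 'a \<Rightarrow> 'b" where
  "fd S f x \<equiv> frechet_derivative f (at x within S)"

lemma cbox_corner_mono:
  fixes x :: "'a::euclidean_space"
  assumes "d \<le> e" shows "cbox x (x + d *\<^sub>R One) \<subseteq> cbox x (x + e *\<^sub>R One)"
proof
  fix y assume "y \<in> cbox x (x + d *\<^sub>R One)"
  then show "y \<in> cbox x (x + e *\<^sub>R One)"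
    using assms by (fastforce simp: mem_box inner_add_left)
qed

lemma open_contains_corner:
  fixes x :: "'a::euclidean_space"
  assumes "open U" "x \<in> U"
  obtains e where "e > 0" "cbox x (x + e *\<^sub>R One) \<subseteq> U"
proof -
  obtain r where r: "r > 0" "ball x r \<subseteq> U" using assms open_contains_ball by blast
  \<comment> \<open>By the l1 bound on the norm, a point of the box is at distance at most DIM * e =
    r/2 from x.\<close>
  define e where "e = r / (2 * DIM('a))"
  have e: "e > 0" using r by (simp add: e_def)
  have "y \<in> ball x r" if y: "y \<in> cbox x (x + e *\<^sub>R One)" for y
  proof -
    have "norm (y - x) \<le> (\<Sum>b\<in>Basis. \<bar>(y - x) \<bullet> b\<bar>)" by (rule norm_le_l1)
    also have "\<dots> \<le> (\<Sum>b\<in>(Basis::'a set). e)"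
    proof (rule sum_mono)
      fix b :: 'a assume b: "b \<in> Basis"
      then show "\<bar>(y - x) \<bullet> b\<bar> \<le> e"
        using y by (fastforce simp: mem_box inner_add_left inner_diff_left)
    qed
    also have "\<dots> < r" using r by (simp add: e_def)
    finally show ?thesis by (simp add: dist_norm norm_minus_commute)
  qed
  with r e that show ?thesis by blast
qed

lemma cornered_Int_open:
  assumes "cornered S" "open U" shows "cornered (S \<inter> U)"
  unfolding cornered_def
proof
  fix x assume x: "x \<in> S \<inter> U"
  obtain d where d: "d > 0" "cbox x (x + d *\<^sub>R One) \<subseteq> S"
    using assms(1) x by (auto simp: cornered_def)
  obtain e where e: "e > 0" "cbox x (x + e *\<^sub>R One) \<subseteq> U"
    using open_contains_corner assms(2) x by (metis IntD2)
  show "\<exists>e>0. cbox x (x + e *\<^sub>R One) \<subseteq> S \<inter> U"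
    using d e cbox_corner_mono[of "min d e" d x] cbox_corner_mono[of "min d e" e x]
    by (intro exI[of _ "min d e"]) auto
qed

lemma cornered_openin: "cornered S \<Longrightarrow> openin (top_of_set S) T \<Longrightarrow> cornered T"
  by (auto simp: openin_open cornered_Int_open)

lemma cornered_UNIV: "cornered UNIV"
  by (auto simp: cornered_def intro: exI[of _ 1])

lemma cornered_open: "open U \<Longrightarrow> cornered U"
  using cornered_Int_open[OF cornered_UNIV] by force

text \<open>This is why boxes are attached at their lower corner: nonnegative displacements never
  decrease the coordinate that bounds the half-space.\<close>

lemma cornered_half_space: "cornered (half_space :: (real ^ 'n::finite) set)"
  unfolding cornered_def half_space_def
proof
  fix x :: "real ^ 'n" assume x: "x \<in> {x. 0 \<le> x $ bdry_axis}"
  have "0 \<le> y $ bdry_axis" if "y \<in> cbox x (x + 1 *\<^sub>R One)" for y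
  proof -
    have "x $ bdry_axis \<le> y $ bdry_axis"
      using that by (simp add: mem_box_cart)
    with x show ?thesis by simp
  qed
  then show "\<exists>e>0. cbox x (x + e *\<^sub>R One) \<subseteq> {x. 0 \<le> x $ bdry_axis}"
    by (intro exI[of _ 1]) auto
qed

lemma cornered_Times:
  assumes "cornered S" "cornered T" shows "cornered (S \<times> T)"
  unfolding cornered_def
proof safe
  fix a b assume x: "a \<in> S" "b \<in> T"
  obtain d where d: "d > 0" "cbox a (a + d *\<^sub>R One) \<subseteq> S"
    using assms(1) x by (auto simp: cornered_def)
  obtain e where e: "e > 0" "cbox b (b + e *\<^sub>R One) \<subseteq> T"
    using assms x by (auto simp: cornered_def)
  have One: "(One :: 'a \<times> 'b) = (One, One)"
    by (simp add: sum_Basis_prod_eq prod_eq_iff fst_sum snd_sum)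
  let ?m = "min d e"
  have "cbox (a, b) ((a, b) + ?m *\<^sub>R One) = cbox a (a + ?m *\<^sub>R One) \<times> cbox b (b + ?m *\<^sub>R One)"
    unfolding One by (simp add: cbox_Pair_eq)
  also have "\<dots> \<subseteq> S \<times> T"
    using d e cbox_corner_mono[of ?m d a] cbox_corner_mono[of ?m e b] by auto
  finally show "\<exists>e>0. cbox (a, b) ((a, b) + e *\<^sub>R One) \<subseteq> S \<times> T"
    using d e by (intro exI[of _ ?m]) auto
qed

lemma cornered_square:
  fixes x :: "'a::euclidean_space"
  assumes "cornered S" "x \<in> S"
  obtains e where "e > 0"
    "\<And>b b' r s. b \<in> Basis \<Longrightarrow> b' \<in> Basis \<Longrightarrow> 0 \<le> r \<Longrightarrow> r \<le> e \<Longrightarrow> 0 \<le> s \<Longrightarrow> s \<le> e \<Longrightarrow>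
      x + r *\<^sub>R b + s *\<^sub>R b' \<in> S"
proof -
  obtain d where d: "d > 0" "cbox x (x + d *\<^sub>R One) \<subseteq> S"
    using assms by (auto simp: cornered_def)
  show ?thesis
  \<comment> \<open>Half the side of the box, because for b = b' the two displacements add up in one
    coordinate.\<close>
  proof (rule that[of "d/2"])
    show "x + r *\<^sub>R b + s *\<^sub>R b' \<in> S"
      if "b \<in> Basis" "b' \<in> Basis" "0 \<le> r" "r \<le> d/2" "0 \<le> s" "s \<le> d/2" for b b' r s
    proof -
      have "x + r *\<^sub>R b + s *\<^sub>R b' \<in> cbox x (x + d *\<^sub>R One)"
        using that d by (auto simp: mem_box inner_add_left inner_Basis)
      then show ?thesis using d by blast
    qed
  qed (use d in auto)
qed

text \<open>A derivative within a set is determined once arbitrarily short steps along every basis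
  vector stay in the set; steps of one sign suffice, and a corner supplies the positive
  ones.\<close>

lemma cornered_frechet_unique:
  fixes f :: "'a::euclidean_space \<Rightarrow> 'b::real_normed_vector"
  assumes "cornered S" "x \<in> S"
    and "(f has_derivative D) (at x within S)" "(f has_derivative D') (at x within S)"
  shows "D = D'"
proof (rule frechet_derivative_unique_within[OF assms(3,4)])
  fix i :: 'a and e :: real assume i: "i \<in> Basis" and e: "e > 0"
  obtain d where d: "d > 0"
    "\<And>b b' r s. b \<in> Basis \<Longrightarrow> b' \<in> Basis \<Longrightarrow> 0 \<le> r \<Longrightarrow> r \<le> d \<Longrightarrow> 0 \<le> s \<Longrightarrow> s \<le> d \<Longrightarrow>
      x + r *\<^sub>R b + s *\<^sub>R b' \<in> S"
    using cornered_square assms(1,2) by metis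
  show "\<exists>d. 0 < \<bar>d\<bar> \<and> \<bar>d\<bar> < e \<and> x + d *\<^sub>R i \<in> S"
    using d(2)[of i i "min d (e/2)" 0] i e d(1) by (intro exI[of _ "min d (e/2)"]) auto
qed

lemma fd_eqI:
  fixes f :: "'a::euclidean_space \<Rightarrow> 'b::real_normed_vector"
  assumes "cornered S" "x \<in> S" "(f has_derivative D) (at x within S)"
  shows "fd S f x = D"
  using assms cornered_frechet_unique[OF assms(1,2)] frechet_derivative_works
  by (metis differentiableI)

text \<open>\<open>frechet_derivative\<close> chooses among all derivatives. Functions that agree on
  S have the same derivatives there, so the choices coincide even where a derivative is missing or
  ambiguous.\<close>

lemma fd_cong:
  fixes f :: "'a::real_normed_vector \<Rightarrow> 'b::real_normed_vector"
  assumes "x \<in> S" "\<And>y. y \<in> S \<Longrightarrow> f y = g y"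
  shows "fd S f x = fd S g x"
proof -
  have "(f has_derivative D) (at x within S) \<longleftrightarrow> (g has_derivative D) (at x within S)" for D
    using assms by (metis has_derivative_transform)
  then show ?thesis by (simp add: frechet_derivative_def)
qed

section \<open>Smooth functions\<close>

lemma differentiable_cong:
  assumes "x \<in> S" "\<And>y. y \<in> S \<Longrightarrow> f y = g y"
  shows "f differentiable (at x within S) \<longleftrightarrow> g differentiable (at x within S)"
  using assms unfolding differentiable_def by (metis has_derivative_transform)

lemma Ck_on_cong:
  assumes "\<And>y. y \<in> S \<Longrightarrow> f y = g y"
  shows "Ck_on k S f \<longleftrightarrow> Ck_on k S g"
  using assms
proof (induction k arbitrary: f g)
  case 0
  then show ?case by (simp cong: continuous_on_cong)
next
  case (Suc k)
  have "Ck_on k S (\<lambda>x. fd S f x h) \<longleftrightarrow> Ck_on k S (\<lambda>x. fd S g x h)" for h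
    by (intro Suc.IH fun_cong[OF fd_cong[OF _ Suc.prems]])
  moreover have "f differentiable (at x within S) \<longleftrightarrow> g differentiable (at x within S)" if "x \<in> S" for x
    by (rule differentiable_cong[OF that Suc.prems])
  ultimately show ?case by simp
qed

lemma smooth_on_cong: "(\<And>y. y \<in> S \<Longrightarrow> f y = g y) \<Longrightarrow> smooth_on S f \<longleftrightarrow> smooth_on S g"
  unfolding smooth_on_def using Ck_on_cong by metis

lemma Ck_on_Suc_D: "Ck_on (Suc k) S f \<Longrightarrow> Ck_on k S f"
proof (induction k arbitrary: f)
  case 0
  then show ?case by (simp add: differentiable_imp_continuous_on differentiable_on_def)
qed auto

lemma Ck_on_has_derivative:
  "Ck_on (Suc k) S f \<Longrightarrow> x \<in> S \<Longrightarrow> (f has_derivative fd S f x) (at x within S)"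
  by (simp add: frechet_derivative_works[symmetric])

lemma smooth_on_has_derivative:
  "smooth_on S f \<Longrightarrow> x \<in> S \<Longrightarrow> (f has_derivative fd S f x) (at x within S)"
  by (meson Ck_on_has_derivative smooth_on_def)

lemma smooth_on_fd: "smooth_on S f \<Longrightarrow> smooth_on S (\<lambda>x. fd S f x h)"
  unfolding smooth_on_def by (metis Ck_on.simps(2))

lemma smooth_on_continuous_on: "smooth_on S f \<Longrightarrow> continuous_on S f"
  unfolding smooth_on_def by (metis Ck_on.simps(1))

lemma fd_const:
  fixes S :: "'a::euclidean_space set"
  shows "cornered S \<Longrightarrow> x \<in> S \<Longrightarrow> fd S (\<lambda>x. c) x h = 0"
  using fd_eqI[of S x "\<lambda>x. c" "\<lambda>h. 0"] by simp

lemma Ck_on_const: "cornered S \<Longrightarrow> Ck_on k S (\<lambda>x. c)"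
proof (induction k arbitrary: c)
  case (Suc k)
  have "Ck_on k S (\<lambda>x. fd S (\<lambda>x. c) x h)" for h
    using Suc.IH[OF Suc.prems, of 0] fd_const[OF Suc.prems]
    by (subst Ck_on_cong[where g = "\<lambda>_. 0"]) auto
  then show ?case by simp
qed simp

lemma smooth_on_const: "cornered S \<Longrightarrow> smooth_on S (\<lambda>x. c)"
  by (simp add: smooth_on_def Ck_on_const)

section \<open>Closure properties of smooth functions on a cornered set\<close>

context
  fixes S :: "'a::euclidean_space set"
  assumes S: "cornered S"
begin

text \<open>The workhorse of the closure rules: uniqueness identifies any explicit derivative D with
  the chosen one, so only the regularity of D remains for the induction.\<close>

lemma Ck_on_SucI:
  assumes "\<And>x. x \<in> S \<Longrightarrow> (f has_derivative D x) (at x within S)"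
    and "\<And>h. Ck_on k S (\<lambda>x. D x h)"
  shows "Ck_on (Suc k) S f"
proof -
  have "Ck_on k S (\<lambda>x. fd S f x h)" for h
    by (subst Ck_on_cong[where g = "\<lambda>x. D x h"]) (simp_all add: fd_eqI[OF S _ assms(1)] assms(2))
  with assms(1) show ?thesis by (auto simp: differentiable_def)
qed

lemma Ck_on_add: "Ck_on k S f \<Longrightarrow> Ck_on k S g \<Longrightarrow> Ck_on k S (\<lambda>x. f x + g x)"
proof (induction k arbitrary: f g)
  case (Suc k)
  show ?case
  proof (rule Ck_on_SucI[where D = "\<lambda>x h. fd S f x h + fd S g x h"])
    show "((\<lambda>x. f x + g x) has_derivative (\<lambda>h. fd S f x h + fd S g x h)) (at x within S)"
      if "x \<in> S" for x
      using Suc.prems that by (intro has_derivative_add Ck_on_has_derivative)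
    show "Ck_on k S (\<lambda>x. fd S f x h + fd S g x h)" for h
      using Suc.prems by (intro Suc.IH) simp_all
  qed
qed (simp add: continuous_on_add)

lemma Ck_on_bounded_linear: "bounded_linear L \<Longrightarrow> Ck_on k S f \<Longrightarrow> Ck_on k S (\<lambda>x. L (f x))"
proof (induction k arbitrary: f)
  case 0
  then show ?case using bounded_linear.continuous_on by auto
next
  case (Suc k)
  show ?case
  proof (rule Ck_on_SucI[where D = "\<lambda>x h. L (fd S f x h)"])
    show "((\<lambda>x. L (f x)) has_derivative (\<lambda>h. L (fd S f x h))) (at x within S)" if "x \<in> S" for x
      using Suc.prems that by (intro bounded_linear.has_derivative[OF Suc.prems(1)] Ck_on_has_derivative)
    show "Ck_on k S (\<lambda>x. L (fd S f x h))" for h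
      using Suc.prems by (intro Suc.IH) simp_all
  qed
qed

lemma Ck_on_scaleR:
  "Ck_on k S (f :: 'a \<Rightarrow> real) \<Longrightarrow> Ck_on k S g \<Longrightarrow> Ck_on k S (\<lambda>x. f x *\<^sub>R g x)"
proof (induction k arbitrary: f g)
  case (Suc k)
  show ?case
  proof (rule Ck_on_SucI[where D = "\<lambda>x h. f x *\<^sub>R fd S g x h + fd S f x h *\<^sub>R g x"])
    show "((\<lambda>x. f x *\<^sub>R g x) has_derivative (\<lambda>h. f x *\<^sub>R fd S g x h + fd S f x h *\<^sub>R g x)) (at x within S)"
      if "x \<in> S" for x
      using Suc.prems that by (intro has_derivative_scaleR Ck_on_has_derivative)
    show "Ck_on k S (\<lambda>x. f x *\<^sub>R fd S g x h + fd S f x h *\<^sub>R g x)" for h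
    proof -
      have "Ck_on k S (\<lambda>x. fd S f x h)" "Ck_on k S (\<lambda>x. fd S g x h)" using Suc.prems by simp_all
      then show ?thesis
        using Ck_on_Suc_D[OF Suc.prems(1)] Ck_on_Suc_D[OF Suc.prems(2)]
        by (intro Ck_on_add Suc.IH)
    qed
  qed
qed (simp add: continuous_on_scaleR)

lemma Ck_on_inverse:
  "Ck_on k S (f :: 'a \<Rightarrow> real) \<Longrightarrow> (\<And>x. x \<in> S \<Longrightarrow> f x \<noteq> 0) \<Longrightarrow> Ck_on k S (\<lambda>x. inverse (f x))"
proof (induction k)
  case (Suc k)
  \<comment> \<open>The derivative - f' / f^2 contains 1/f again, undifferentiated, so regularity of
    order k of 1/f is enough for order k + 1.\<close>
  have IH: "Ck_on k S (\<lambda>x. inverse (f x))"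
    using Suc.prems by (intro Suc.IH Ck_on_Suc_D[OF Suc.prems(1)])
  show ?case
  proof (rule Ck_on_SucI[where D = "\<lambda>x h. - (inverse (f x) * fd S f x h * inverse (f x))"])
    show "((\<lambda>x. inverse (f x)) has_derivative (\<lambda>h. - (inverse (f x) * fd S f x h * inverse (f x)))) (at x within S)"
      if "x \<in> S" for x
      by (rule Deriv.has_derivative_inverse[OF Suc.prems(2) Ck_on_has_derivative[OF Suc.prems(1)]]) fact+
    have "Ck_on k S (\<lambda>x. fd S f x h)" for h using Suc.prems by simp
    then have "Ck_on k S (\<lambda>x. (-1) *\<^sub>R ((inverse (f x) *\<^sub>R fd S f x h) *\<^sub>R inverse (f x)))" for h
      using IH by (intro Ck_on_bounded_linear[OF bounded_linear_scaleR_right] Ck_on_scaleR)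
    then show "Ck_on k S (\<lambda>x. - (inverse (f x) * fd S f x h * inverse (f x)))" for h
      by simp
  qed
qed (simp add: continuous_on_inverse)

lemma smooth_on_add: "smooth_on S f \<Longrightarrow> smooth_on S g \<Longrightarrow> smooth_on S (\<lambda>x. f x + g x)"
  by (simp add: smooth_on_def Ck_on_add)

lemma smooth_on_bounded_linear: "bounded_linear L \<Longrightarrow> smooth_on S f \<Longrightarrow> smooth_on S (\<lambda>x. L (f x))"
  by (simp add: smooth_on_def Ck_on_bounded_linear)

lemma smooth_on_minus: "smooth_on S f \<Longrightarrow> smooth_on S (\<lambda>x. - f x)"
  by (rule smooth_on_bounded_linear) (rule bounded_linear_minus[OF bounded_linear_ident])

lemma smooth_on_diff: "smooth_on S f \<Longrightarrow> smooth_on S g \<Longrightarrow> smooth_on S (\<lambda>x. f x - g x)"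
  using smooth_on_add[OF _ smooth_on_minus, of f g] by simp

lemma smooth_on_mult:
  "smooth_on S (f :: 'a \<Rightarrow> real) \<Longrightarrow> smooth_on S g \<Longrightarrow> smooth_on S (\<lambda>x. f x * g x)"
  using Ck_on_scaleR[of _ f g] by (simp add: smooth_on_def)

lemma smooth_on_divide:
  "smooth_on S (f :: 'a \<Rightarrow> real) \<Longrightarrow> smooth_on S g \<Longrightarrow> (\<And>x. x \<in> S \<Longrightarrow> g x \<noteq> 0) \<Longrightarrow>
    smooth_on S (\<lambda>x. f x / g x)"
  unfolding divide_inverse smooth_on_def
  using Ck_on_scaleR[of _ f "\<lambda>x. inverse (g x)"] Ck_on_inverse[of _ g] by simp

lemma smooth_on_power: "smooth_on S (f :: 'a \<Rightarrow> real) \<Longrightarrow> smooth_on S (\<lambda>x. f x ^ m)"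
  by (induction m) (simp_all add: smooth_on_const[OF S] smooth_on_mult)

lemma smooth_on_sum: "(\<And>i. i \<in> K \<Longrightarrow> smooth_on S (f i)) \<Longrightarrow> smooth_on S (\<lambda>x. \<Sum>i\<in>K. f i x)"
  by (induction K rule: infinite_finite_induct)
    (simp_all add: smooth_on_const[OF S] smooth_on_add)

lemma smooth_on_nth: "smooth_on S (f :: 'a \<Rightarrow> real ^ 'm) \<Longrightarrow> smooth_on S (\<lambda>x. f x $ i)"
  by (rule smooth_on_bounded_linear[OF bounded_linear_vec_nth])

lemma smooth_on_ln:
  assumes "smooth_on S (f :: 'a \<Rightarrow> real)" "\<And>x. x \<in> S \<Longrightarrow> f x > 0"
  shows "smooth_on S (\<lambda>x. ln (f x))"
proof -
  have D: "((\<lambda>x. ln (f x)) has_derivative (\<lambda>h. fd S f x h / f x)) (at x within S)" if "x \<in> S" for x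
    using has_derivative_ln[OF assms(2) smooth_on_has_derivative[OF assms(1)], OF that that]
    by (simp add: divide_inverse mult.commute)
  have "smooth_on S (\<lambda>x. fd S f x h / f x)" for h
    using assms(2) by (intro smooth_on_divide smooth_on_fd assms(1)) fastforce
  then have "Ck_on (Suc k) S (\<lambda>x. ln (f x))" for k
    by (intro Ck_on_SucI[OF D]) (simp_all add: smooth_on_def)
  then show ?thesis unfolding smooth_on_def by (metis Ck_on_Suc_D)
qed

text \<open>Derivatives restrict to subsets, and a relatively open subset is still cornered, so the
  restricted derivative is the only one. This allows derivatives within chart images to be compared
  on overlaps.\<close>

lemma fd_openin:
  assumes T: "openin (top_of_set S) T" and f: "f differentiable (at x within S)" and "x \<in> T"
  shows "fd T f x = fd S f x"
proof (rule fd_eqI[OF cornered_openin[OF S T] \<open>x \<in> T\<close>])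
  show "(f has_derivative fd S f x) (at x within T)"
    using f T frechet_derivative_works has_derivative_subset openin_imp_subset by blast
qed

section \<open>Differentiation rules at a point of a cornered set\<close>

context
  fixes x :: 'a
  assumes x: "x \<in> S"
begin

lemma fd_add:
  "smooth_on S f \<Longrightarrow> smooth_on S g \<Longrightarrow> fd S (\<lambda>y. f y + g y) x h = fd S f x h + fd S g x h"
  using fd_eqI[OF S x has_derivative_add[OF smooth_on_has_derivative smooth_on_has_derivative]] x
  by metis

lemma fd_diff:
  "smooth_on S f \<Longrightarrow> smooth_on S g \<Longrightarrow> fd S (\<lambda>y. f y - g y) x h = fd S f x h - fd S g x h"
  using fd_eqI[OF S x has_derivative_diff[OF smooth_on_has_derivative smooth_on_has_derivative]] x
  by metis

lemma fd_minus: "smooth_on S f \<Longrightarrow> fd S (\<lambda>y. - f y) x h = - fd S f x h"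
  using fd_eqI[OF S x has_derivative_minus[OF smooth_on_has_derivative]] x
  by metis

lemma fd_mult:
  "smooth_on S (f :: 'a \<Rightarrow> real) \<Longrightarrow> smooth_on S g \<Longrightarrow>
    fd S (\<lambda>y. f y * g y) x h = f x * fd S g x h + fd S f x h * g x"
  using fd_eqI[OF S x has_derivative_mult[OF smooth_on_has_derivative smooth_on_has_derivative]] x
  by metis

lemma fd_bounded_linear:
  "bounded_linear L \<Longrightarrow> smooth_on S f \<Longrightarrow> fd S (\<lambda>y. L (f y)) x h = L (fd S f x h)"
  using fd_eqI[OF S x bounded_linear.has_derivative[OF _ smooth_on_has_derivative]] x
  by metis

lemma fd_nth: "smooth_on S (f :: 'a \<Rightarrow> real ^ 'm) \<Longrightarrow> fd S (\<lambda>y. f y $ i) x h = fd S f x h $ i"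
  by (rule fd_bounded_linear[OF bounded_linear_vec_nth])

lemma linear_fd: "smooth_on S f \<Longrightarrow> linear (fd S f x)"
  using smooth_on_has_derivative[OF _ x] has_derivative_linear by blast

end

end

text \<open>Schwarz: the second difference over a square with corner \<open>x\<close> is evaluated by two applications
  of the mean value theorem, in either order.\<close>

lemma second_difference:
  fixes f :: "'a::euclidean_space \<Rightarrow> real"
  assumes S: "cornered S" and f: "smooth_on S f" and e: "e \<ge> 0"
    and sq: "\<And>r s. 0 \<le> r \<Longrightarrow> r \<le> e \<Longrightarrow> 0 \<le> s \<Longrightarrow> s \<le> e \<Longrightarrow> x + r *\<^sub>R i + s *\<^sub>R j \<in> S"
  shows "\<exists>r\<in>{0..e}. \<exists>s\<in>{0..e}.
    f (x + e *\<^sub>R i + e *\<^sub>R j) - f (x + e *\<^sub>R i) - (f (x + e *\<^sub>R j) - f x) =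
      e * e * fd S (\<lambda>y. fd S f y i) (x + r *\<^sub>R i + s *\<^sub>R j) j"
proof -
  \<comment> \<open>Restriction of F to a segment inside S, reduced to a function of one variable so
    that the mean value theorem applies up to both endpoints.\<close>
  have along: "((\<lambda>r. F (p + r *\<^sub>R d)) has_derivative (\<lambda>h. h * fd S F (p + r *\<^sub>R d) d)) (at r within {0..e})"
    if F: "smooth_on S F" and p: "\<And>r. r \<in> {0..e} \<Longrightarrow> p + r *\<^sub>R d \<in> S" and r: "r \<in> {0..e}"
    for F :: "'a \<Rightarrow> real" and p d r
  proof -
    have 1: "(F has_derivative fd S F (p + r *\<^sub>R d)) (at (p + r *\<^sub>R d) within (\<lambda>r. p + r *\<^sub>R d) ` {0..e})"
      by (rule has_derivative_subset[OF smooth_on_has_derivative[OF F p[OF r]]]) (use p in auto)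
    have 2: "((\<lambda>r. p + r *\<^sub>R d) has_derivative (\<lambda>h. h *\<^sub>R d)) (at r within {0..e})"
      by (auto intro!: derivative_eq_intros)
    have "(F \<circ> (\<lambda>r. p + r *\<^sub>R d) has_derivative (fd S F (p + r *\<^sub>R d) \<circ> (\<lambda>h. h *\<^sub>R d))) (at r within {0..e})"
      by (rule diff_chain_within[OF 2 1])
    moreover have "fd S F (p + r *\<^sub>R d) (h *\<^sub>R d) = h * fd S F (p + r *\<^sub>R d) d" for h
      using linear_fd[OF S p[OF r] F] by (simp add: linear_scale)
    ultimately show ?thesis by (simp add: o_def)
  qed
  \<comment> \<open>The increment of f in direction j, viewed as a function of the position along i;
    the second mean value step then varies the position along j.\<close>
  have 1: "((\<lambda>r. f (x + e *\<^sub>R j + r *\<^sub>R i) - f (x + r *\<^sub>R i)) has_derivative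
      (\<lambda>h. h * fd S f (x + e *\<^sub>R j + r *\<^sub>R i) i - h * fd S f (x + r *\<^sub>R i) i)) (at r within {0..e})"
    if "0 \<le> r" "r \<le> e" for r
  proof (intro has_derivative_diff along[OF f])
    show "x + e *\<^sub>R j + r *\<^sub>R i \<in> S" if "r \<in> {0..e}" for r
      using sq[of r e] that e by (simp add: algebra_simps)
    show "x + r *\<^sub>R i \<in> S" if "r \<in> {0..e}" for r
      using sq[of r 0] that e by simp
  qed (use that in auto)
  obtain r where r: "r \<in> {0..e}" and
    A: "f (x + e *\<^sub>R j + e *\<^sub>R i) - f (x + e *\<^sub>R i) - (f (x + e *\<^sub>R j + 0 *\<^sub>R i) - f (x + 0 *\<^sub>R i))
      = (e - 0) * fd S f (x + e *\<^sub>R j + r *\<^sub>R i) i - (e - 0) * fd S f (x + r *\<^sub>R i) i"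
    using mvt_very_simple[OF e 1] by blast
  have 2: "((\<lambda>s. fd S f (x + r *\<^sub>R i + s *\<^sub>R j) i) has_derivative
      (\<lambda>h. h * fd S (\<lambda>y. fd S f y i) (x + r *\<^sub>R i + s *\<^sub>R j) j)) (at s within {0..e})"
    if "0 \<le> s" "s \<le> e" for s
  proof (rule along[OF smooth_on_fd[OF f]])
    show "x + r *\<^sub>R i + s *\<^sub>R j \<in> S" if "s \<in> {0..e}" for s
      using sq[of r s] that r by simp
  qed (use that in auto)
  obtain s where s: "s \<in> {0..e}" and
    B: "fd S f (x + r *\<^sub>R i + e *\<^sub>R j) i - fd S f (x + r *\<^sub>R i + 0 *\<^sub>R j) i
      = (e - 0) * fd S (\<lambda>y. fd S f y i) (x + r *\<^sub>R i + s *\<^sub>R j) j"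
    using mvt_very_simple[OF e 2] by blast
  have "f (x + e *\<^sub>R i + e *\<^sub>R j) - f (x + e *\<^sub>R i) - (f (x + e *\<^sub>R j) - f x)
      = e * (fd S f (x + r *\<^sub>R i + e *\<^sub>R j) i - fd S f (x + r *\<^sub>R i) i)"
    using A by (simp add: algebra_simps)
  also have "\<dots> = e * e * fd S (\<lambda>y. fd S f y i) (x + r *\<^sub>R i + s *\<^sub>R j) j"
    using B by simp
  finally show ?thesis using r s by blast
qed

text \<open>The second difference is symmetric in i and j, so each small square contains points at
  which the two mixed derivatives agree. Both are continuous on S, hence agree at the
  corner.\<close>

lemma fd_swap_Basis:
  fixes f :: "'a::euclidean_space \<Rightarrow> real"
  assumes S: "cornered S" and x: "x \<in> S" and f: "smooth_on S f" and ij: "i \<in> Basis" "j \<in> Basis"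
  shows "fd S (\<lambda>y. fd S f y i) x j = fd S (\<lambda>y. fd S f y j) x i"
proof -
  define P where "P = (\<lambda>y. fd S (\<lambda>z. fd S f z i) y j)"
  define Q where "Q = (\<lambda>y. fd S (\<lambda>z. fd S f z j) y i)"
  have contP: "continuous_on S P" and contQ: "continuous_on S Q"
    unfolding P_def Q_def by (intro smooth_on_continuous_on smooth_on_fd f)+
  obtain d where d: "d > 0"
    "\<And>b b' r s. b \<in> Basis \<Longrightarrow> b' \<in> Basis \<Longrightarrow> 0 \<le> r \<Longrightarrow> r \<le> d \<Longrightarrow> 0 \<le> s \<Longrightarrow> s \<le> d \<Longrightarrow>
      x + r *\<^sub>R b + s *\<^sub>R b' \<in> S"
    using cornered_square S x by metis
  have "\<bar>P x - Q x\<bar> < 2 * \<epsilon>" if \<epsilon>: "\<epsilon> > 0" for \<epsilon>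
  proof -
    obtain \<delta>1 where \<delta>1: "\<delta>1 > 0" "\<And>y. y \<in> S \<Longrightarrow> dist y x < \<delta>1 \<Longrightarrow> dist (P y) (P x) < \<epsilon>"
      using contP x \<epsilon> unfolding continuous_on_iff by metis
    obtain \<delta>2 where \<delta>2: "\<delta>2 > 0" "\<And>y. y \<in> S \<Longrightarrow> dist y x < \<delta>2 \<Longrightarrow> dist (Q y) (Q x) < \<epsilon>"
      using contQ x \<epsilon> unfolding continuous_on_iff by metis
    \<comment> \<open>Points of the square lie within 2e of x; a third of each radius keeps them
      inside both continuity neighbourhoods.\<close>
    define e where "e = min d (min \<delta>1 \<delta>2 / 3)"
    have e: "e > 0" "e \<le> d" "2 * e < \<delta>1" "2 * e < \<delta>2"
      using d(1) \<delta>1(1) \<delta>2(1) by (auto simp: e_def)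
    have near: "dist (x + r *\<^sub>R b + s *\<^sub>R b') x \<le> 2 * e"
      if "b \<in> Basis" "b' \<in> Basis" "r \<in> {0..e}" "s \<in> {0..e}" for r s b b'
      using norm_triangle_ineq[of "r *\<^sub>R b" "s *\<^sub>R b'"] that by (simp add: dist_norm)
    have sq: "\<And>b b' r s. b \<in> Basis \<Longrightarrow> b' \<in> Basis \<Longrightarrow> 0 \<le> r \<Longrightarrow> r \<le> e \<Longrightarrow> 0 \<le> s \<Longrightarrow> s \<le> e \<Longrightarrow>
      x + r *\<^sub>R b + s *\<^sub>R b' \<in> S"
      using d(2) e(2) by (meson order_trans)
    obtain r s where rs: "r \<in> {0..e}" "s \<in> {0..e}" and
      A: "f (x + e *\<^sub>R i + e *\<^sub>R j) - f (x + e *\<^sub>R i) - (f (x + e *\<^sub>R j) - f x) =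
        e * e * P (x + r *\<^sub>R i + s *\<^sub>R j)"
      using second_difference[OF S f less_imp_le[OF e(1)] sq[OF ij]] unfolding P_def by blast
    obtain r' s' where rs': "r' \<in> {0..e}" "s' \<in> {0..e}" and
      B: "f (x + e *\<^sub>R j + e *\<^sub>R i) - f (x + e *\<^sub>R j) - (f (x + e *\<^sub>R i) - f x) =
        e * e * Q (x + r' *\<^sub>R j + s' *\<^sub>R i)"
      using second_difference[OF S f less_imp_le[OF e(1)] sq[OF ij(2,1)]] unfolding Q_def by blast
    have "e * e * P (x + r *\<^sub>R i + s *\<^sub>R j) = e * e * Q (x + r' *\<^sub>R j + s' *\<^sub>R i)"
      using A B by (simp add: algebra_simps)
    then have "P (x + r *\<^sub>R i + s *\<^sub>R j) = Q (x + r' *\<^sub>R j + s' *\<^sub>R i)" using e by simp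
    moreover have "dist (P (x + r *\<^sub>R i + s *\<^sub>R j)) (P x) < \<epsilon>"
      using near[OF ij rs] e rs by (intro \<delta>1 sq ij) auto
    moreover have "dist (Q (x + r' *\<^sub>R j + s' *\<^sub>R i)) (Q x) < \<epsilon>"
      using near[OF ij(2,1) rs'] e rs' by (intro \<delta>2 sq ij) auto
    ultimately show ?thesis by (simp add: dist_real_def)
  qed
  \<comment> \<open>For half the gap as \<epsilon>, the bound would say that the gap is smaller than
    itself.\<close>
  from this[of "\<bar>P x - Q x\<bar> / 2"] have "P x = Q x" by (cases "P x = Q x") auto
  then show ?thesis by (simp add: P_def Q_def)
qed

text \<open>Differentiation in the base point commutes with sums and scalings in the parameter Z.
  This provides the bilinearity needed to pass from basis vectors to arbitrary arguments.\<close>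

lemma linear_fd_family:
  fixes S :: "'a::euclidean_space set"
    and a :: "'a \<Rightarrow> 'c::real_vector \<Rightarrow> 'b::real_normed_vector"
  assumes S: "cornered S" and x: "x \<in> S"
    and lin: "\<And>y. y \<in> S \<Longrightarrow> linear (a y)" and sm: "\<And>Z. smooth_on S (\<lambda>y. a y Z)"
  shows "linear (\<lambda>Z. fd S (\<lambda>y. a y Z) x k)"
proof (rule linearI)
  fix b1 b2
  have "fd S (\<lambda>y. a y (b1 + b2)) x k = fd S (\<lambda>y. a y b1 + a y b2) x k"
    by (rule fun_cong[OF fd_cong[OF x]]) (use lin linear_add in blast)
  then show "fd S (\<lambda>y. a y (b1 + b2)) x k = fd S (\<lambda>y. a y b1) x k + fd S (\<lambda>y. a y b2) x k"
    by (simp add: fd_add[OF S x] sm)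
next
  fix r b
  have "fd S (\<lambda>y. a y (r *\<^sub>R b)) x k = fd S (\<lambda>y. r *\<^sub>R a y b) x k"
    by (rule fun_cong[OF fd_cong[OF x]]) (use lin linear_scale in blast)
  also have "\<dots> = r *\<^sub>R fd S (\<lambda>y. a y b) x k"
    by (intro fd_bounded_linear[OF S x bounded_linear_scaleR_right] sm)
  finally show "fd S (\<lambda>y. a y (r *\<^sub>R b)) x k = r *\<^sub>R fd S (\<lambda>y. a y b) x k" .
qed

text \<open>Both sides are bilinear in h and k, so the case of basis vectors decides.\<close>

lemma fd_swap:
  fixes f :: "'a::euclidean_space \<Rightarrow> real"
  assumes S: "cornered S" and x: "x \<in> S" and f: "smooth_on S f"
  shows "fd S (\<lambda>y. fd S f y h) x k = fd S (\<lambda>y. fd S f y k) x h"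
proof -
  have bil: "bilinear (\<lambda>h k. fd S (\<lambda>y. fd S f y h) x k)"
    unfolding bilinear_def
    using linear_fd_family[OF S x linear_fd[OF S _ f] smooth_on_fd[OF f]]
      linear_fd[OF S x smooth_on_fd[OF f]] by blast
  have bil': "bilinear (\<lambda>h k. fd S (\<lambda>y. fd S f y k) x h)"
    unfolding bilinear_def
    using linear_fd_family[OF S x linear_fd[OF S _ f] smooth_on_fd[OF f]]
      linear_fd[OF S x smooth_on_fd[OF f]] by blast
  have "(\<lambda>h k. fd S (\<lambda>y. fd S f y h) x k) = (\<lambda>h k. fd S (\<lambda>y. fd S f y k) x h)"
    using bilinear_eq_stdbasis[OF bil bil'] fd_swap_Basis[OF S x f] by blast
  then show ?thesis by metis
qed

text \<open>Componentwise. The vector-valued case is required for transition maps and for the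
  velocity as a function of time and position.\<close>

lemma fd_swap_vec:
  fixes f :: "'a::euclidean_space \<Rightarrow> real ^ 'm"
  assumes S: "cornered S" and x: "x \<in> S" and f: "smooth_on S f"
  shows "fd S (\<lambda>y. fd S f y h) x k = fd S (\<lambda>y. fd S f y k) x h"
proof -
  have "fd S (\<lambda>y. fd S f y h) x k $ i = fd S (\<lambda>y. fd S (\<lambda>z. f z $ i) y h) x k" for h k i
  proof -
    have "fd S (\<lambda>y. fd S (\<lambda>z. f z $ i) y h) x = fd S (\<lambda>y. fd S f y h $ i) x"
      by (rule fd_cong[OF x]) (rule fd_nth[OF S _ f])
    then show ?thesis using fd_nth[OF S x smooth_on_fd[OF f]] by metis
  qed
  then show ?thesis
    using fd_swap[OF S x smooth_on_nth[OF S f]] unfolding vec_eq_iff by metis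
qed

lemma linear_eq_sum_axis:
  fixes L :: "real ^ 'n::finite \<Rightarrow> real"
  assumes "linear L" shows "L z = (\<Sum>i\<in>UNIV. z $ i * L (axis i 1))"
proof -
  have "L z = L (\<Sum>i\<in>UNIV. z $ i *s axis i 1)" by (simp only: basis_expansion)
  then show ?thesis
    using assms by (simp add: linear_sum linear_scale scalar_mult_eq_scaleR)
qed

section \<open>Linear functionals depending on a point, evaluated at a moving vector\<close>

context
  fixes S :: "'a::euclidean_space set" and a :: "'a \<Rightarrow> real ^ 'n::finite \<Rightarrow> real"
  assumes S: "cornered S" and lin: "\<And>y. y \<in> S \<Longrightarrow> linear (a y)"
begin

text \<open>Smoothness of tensor fields is stated for fixed arguments only; expanding the moving
  argument in the standard basis turns it into a finite sum of products.\<close>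

lemma smooth_on_family:
  assumes "\<And>Z. smooth_on S (\<lambda>y. a y Z)" "smooth_on S w"
  shows "smooth_on S (\<lambda>y. a y (w y))"
proof -
  have "smooth_on S (\<lambda>y. \<Sum>i\<in>UNIV. w y $ i * a y (axis i 1))"
    using assms by (intro smooth_on_sum smooth_on_mult smooth_on_nth S)
  then show ?thesis
    by (rule iffD1[OF smooth_on_cong, rotated]) (rule linear_eq_sum_axis[OF lin, symmetric])
qed

lemma has_derivative_family:
  assumes x: "x \<in> S"
    and D: "\<And>Z. ((\<lambda>y. a y Z) has_derivative D Z) (at x within S)"
    and w: "(w has_derivative w') (at x within S)"
  shows "((\<lambda>y. a y (w y)) has_derivative (\<lambda>h. D (w x) h + a x (w' h))) (at x within S)"
proof -
  have expand: "((\<lambda>y. a y (w y)) has_derivative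
      (\<lambda>h. \<Sum>i\<in>UNIV. w x $ i * D (axis i 1) h + w' h $ i * a x (axis i 1))) (at x within S)"
    if w: "(w has_derivative w') (at x within S)" for w w'
  proof (rule has_derivative_transform[OF x])
    show "((\<lambda>y. \<Sum>i\<in>UNIV. w y $ i * a y (axis i 1)) has_derivative
      (\<lambda>h. \<Sum>i\<in>UNIV. w x $ i * D (axis i 1) h + w' h $ i * a x (axis i 1))) (at x within S)"
      by (intro has_derivative_sum has_derivative_mult D
          bounded_linear.has_derivative[OF bounded_linear_vec_nth w])
  qed (use linear_eq_sum_axis[OF lin] in blast)
  \<comment> \<open>The assumed derivative at a fixed Z and the one obtained from
    \<open>expand\<close> with the constant curve Z coincide by uniqueness; this shows that D is
    linear in Z.\<close>
  have "D Z h = (\<Sum>i\<in>UNIV. Z $ i * D (axis i 1) h)" for Z h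
    using fun_cong[OF cornered_frechet_unique[OF S x D expand[OF has_derivative_const[of Z]]], of h]
    by simp
  then have "(\<Sum>i\<in>UNIV. w x $ i * D (axis i 1) h + w' h $ i * a x (axis i 1)) = D (w x) h + a x (w' h)" for h
    unfolding sum.distrib linear_eq_sum_axis[OF lin[OF x], of "w' h"] by metis
  then show ?thesis using expand[OF w] by simp
qed

lemma fd_family:
  assumes x: "x \<in> S" and "\<And>Z. smooth_on S (\<lambda>y. a y Z)" "smooth_on S w"
  shows "fd S (\<lambda>y. a y (w y)) x h = fd S (\<lambda>y. a y (w x)) x h + a x (fd S w x h)"
  using fd_eqI[OF S x has_derivative_family[OF x smooth_on_has_derivative[OF _ x]
        smooth_on_has_derivative[OF _ x]]] assms by simp

end

section \<open>Alternating maps of low degree\<close>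

text \<open>Arguments are padded to infinite sequences by repeating the last vector; for alternating
  maps of degree one and two the padding does not affect the value.\<close>

abbreviation ev1 :: "('p, 'n::finite) form \<Rightarrow> ('p, 'n) chart \<Rightarrow> real ^ 'n \<Rightarrow> real ^ 'n \<Rightarrow> real" where
  "ev1 \<omega> c x Z \<equiv> \<omega> c x (\<lambda>_. Z)"

abbreviation ev2 ::
    "('p, 'n::finite) form \<Rightarrow> ('p, 'n) chart \<Rightarrow> real ^ 'n \<Rightarrow> real ^ 'n \<Rightarrow> real ^ 'n \<Rightarrow> real" where
  "ev2 \<omega> c x Y Z \<equiv> \<omega> c x (case_nat Y (\<lambda>_. Z))"

lemma alt_map_cong: "alt_map k \<phi> \<Longrightarrow> (\<And>i. i < k \<Longrightarrow> X i = Y i) \<Longrightarrow> \<phi> X = \<phi> Y"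
  by (simp add: alt_map_def)

lemma alt_map_linear: "alt_map k \<phi> \<Longrightarrow> i < k \<Longrightarrow> linear (\<lambda>z. \<phi> (X(i := z)))"
  by (simp add: alt_map_def)

lemma alt_map_eq_0: "alt_map k \<phi> \<Longrightarrow> i < k \<Longrightarrow> j < k \<Longrightarrow> i \<noteq> j \<Longrightarrow> X i = X j \<Longrightarrow> \<phi> X = 0"
  unfolding alt_map_def by metis

lemma alt_map_1I: "linear L \<Longrightarrow> alt_map 1 (\<lambda>X. L (X 0))"
  by (simp add: alt_map_def)

lemma alt_map_1_eval: "alt_map 1 \<phi> \<Longrightarrow> \<phi> X = \<phi> (\<lambda>_. X 0)"
  by (erule alt_map_cong) simp

lemma alt_map_1_linear:
  assumes "alt_map 1 \<phi>" shows "linear (\<lambda>Z. \<phi> (\<lambda>_. Z))"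
proof -
  have "(\<lambda>Z. \<phi> (\<lambda>_. Z)) = (\<lambda>z. \<phi> ((\<lambda>_. 0)(0 := z)))"
    by (rule ext, rule alt_map_cong[OF assms]) simp
  then show ?thesis using alt_map_linear[OF assms, of 0] by simp
qed

lemma alt_map_2I:
  assumes "bilinear B" "\<And>Y. B Y Y = 0" shows "alt_map 2 (\<lambda>X. B (X 0) (X 1))"
  using assms by (auto simp: alt_map_def bilinear_def less_2_cases_iff)

lemma alt_map_2_eval: "alt_map 2 \<phi> \<Longrightarrow> \<phi> X = \<phi> (case_nat (X 0) (\<lambda>_. X 1))"
  by (erule alt_map_cong) (auto simp: less_2_cases_iff)

lemma alt_map_2_bilinear:
  assumes "alt_map 2 \<phi>" shows "bilinear (\<lambda>Y Z. \<phi> (case_nat Y (\<lambda>_. Z)))"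
proof -
  have "(\<lambda>Z. \<phi> (case_nat Y (\<lambda>_. Z))) = (\<lambda>z. \<phi> ((\<lambda>_. Y)(1 := z)))" for Y
    by (rule ext, rule alt_map_cong[OF assms]) (auto simp: less_2_cases_iff)
  moreover have "(\<lambda>Y. \<phi> (case_nat Y (\<lambda>_. Z))) = (\<lambda>z. \<phi> ((\<lambda>_. Z)(0 := z)))" for Z
    by (rule ext, rule alt_map_cong[OF assms]) (auto simp: less_2_cases_iff)
  ultimately show ?thesis
    unfolding bilinear_def using alt_map_linear[OF assms, of 0] alt_map_linear[OF assms, of 1] by simp
qed

lemma alt_map_2_self: "alt_map 2 \<phi> \<Longrightarrow> \<phi> (case_nat Y (\<lambda>_. Y)) = 0"
  by (erule alt_map_eq_0[where i = 0 and j = 1]) auto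

lemma bilinear_alt_swap:
  fixes B :: "'a::real_vector \<Rightarrow> 'a \<Rightarrow> real"
  assumes "bilinear B" "\<And>Y. B Y Y = 0" shows "B Y Z = - B Z Y"
proof -
  have "B (Y + Z) (Y + Z) = B Y Y + B Y Z + (B Z Y + B Z Z)"
    by (simp only: bilinear_ladd[OF assms(1)] bilinear_radd[OF assms(1)] ac_simps)
  then show ?thesis by (simp add: assms(2))
qed

lemma alt_map_2_swap:
  "alt_map 2 \<phi> \<Longrightarrow> \<phi> (case_nat Y (\<lambda>_. Z)) = - \<phi> (case_nat Z (\<lambda>_. Y))"
  using bilinear_alt_swap[OF alt_map_2_bilinear alt_map_2_self] .

text \<open>The expression is a \<and> B, written out over the three shuffles of one and two
  arguments.\<close>

lemma alt_map_3I:
  fixes a :: "real ^ 'n::finite \<Rightarrow> real" and B :: "real ^ 'n \<Rightarrow> real ^ 'n \<Rightarrow> real"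
  assumes "linear a" "bilinear B" "\<And>Y. B Y Y = 0"
  shows "alt_map 3 (\<lambda>X. a (X 0) * B (X 1) (X 2) - a (X 1) * B (X 0) (X 2) + a (X 2) * B (X 0) (X 1))"
proof -
  note B = bilinear_alt_swap[OF assms(2,3)]
  have lin: "linear (\<lambda>z. B z Y)" "linear (\<lambda>z. B Y z)" for Y
    using assms(2) by (simp_all add: bilinear_def)
  have comb: "linear (\<lambda>z. p * f z)" "linear (\<lambda>z. f z * p)"
    if "linear f" for f :: "real ^ 'n \<Rightarrow> real" and p
    using linear_compose_scale_right[OF that, of p] by (simp_all add: mult.commute)
  have i3: "i < 3 \<longleftrightarrow> i = 0 \<or> i = 1 \<or> i = 2" for i :: nat by auto
  show ?thesis
    unfolding alt_map_def i3
  proof (intro conjI allI impI)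
    fix X :: "nat \<Rightarrow> real ^ 'n" and i :: nat
    assume "i = 0 \<or> i = 1 \<or> i = 2"
    then show "linear (\<lambda>z. a ((X(i := z)) 0) * B ((X(i := z)) 1) ((X(i := z)) 2) -
        a ((X(i := z)) 1) * B ((X(i := z)) 0) ((X(i := z)) 2) +
        a ((X(i := z)) 2) * B ((X(i := z)) 0) ((X(i := z)) 1))"
      by (elim disjE) (simp_all add: comb lin assms(1) linear_compose_add linear_compose_sub)
  next
    fix X :: "nat \<Rightarrow> real ^ 'n" and i j :: nat
    assume "i = 0 \<or> i = 1 \<or> i = 2" "j = 0 \<or> j = 1 \<or> j = 2" "i \<noteq> j \<and> X i = X j"
    then show "a (X 0) * B (X 1) (X 2) - a (X 1) * B (X 0) (X 2) + a (X 2) * B (X 0) (X 1) = 0"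
      using B[of "X 0" "X 1"] B[of "X 0" "X 2"] B[of "X 1" "X 2"]
      by (elim disjE) (simp_all add: assms(3))
  qed simp
qed

lemma alt_map_diff: "alt_map k \<phi> \<Longrightarrow> alt_map k \<psi> \<Longrightarrow> alt_map k (\<lambda>X. \<phi> X - \<psi> X)"
  unfolding alt_map_def by (simp add: linear_compose_sub) metis

lemma alt_map_scale:
  assumes "alt_map k \<phi>" shows "alt_map k (\<lambda>X. r * \<phi> X)"
  unfolding alt_map_def
proof (intro conjI allI impI)
  show "linear (\<lambda>z. r * \<phi> (X(i := z)))" if "i < k" for X i
    using linear_compose_scale_right[OF alt_map_linear[OF assms that], of r] by simp
  show "r * \<phi> X = r * \<phi> Y" if "\<forall>i<k. X i = Y i" for X Y
    using alt_map_cong[OF assms, of X Y] that by simp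
  show "r * \<phi> X = 0" if "i < k" "j < k" "i \<noteq> j \<and> X i = X j" for X i j
    using alt_map_eq_0[OF assms that(1,2)] that(3) by simp
qed

section \<open>Wedge products as explicit sums\<close>

lemma wedge_1_1:
  assumes "alt_map 1 (\<sigma> c x)" "alt_map 1 (\<beta> c x)"
  shows "wedge 1 1 \<sigma> \<beta> c x X = ev1 \<sigma> c x (X 0) * ev1 \<beta> c x (X 1) - ev1 \<sigma> c x (X 1) * ev1 \<beta> c x (X 0)"
proof -
  have set: "{..<1 + 1} = insert 0 {1::nat}" by auto
  have f: "finite {1::nat}" "0 \<notin> {1::nat}" by auto
  have 1: "\<sigma> c x (\<lambda>i. X (\<pi> i)) = ev1 \<sigma> c x (X (\<pi> 0))" for \<pi>
    by (rule alt_map_1_eval[OF assms(1)])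
  have 2: "\<beta> c x (\<lambda>i. X (\<pi> (1 + i))) = ev1 \<beta> c x (X (\<pi> 1))" for \<pi>
    using alt_map_1_eval[OF assms(2), of "\<lambda>i. X (\<pi> (1 + i))"] by simp
  have "wedge 1 1 \<sigma> \<beta> c x X = (\<Sum>\<pi> | \<pi> permutes {..<1 + 1}.
      of_int (sign \<pi>) * ev1 \<sigma> c x (X (\<pi> 0)) * ev1 \<beta> c x (X (\<pi> 1))) / (fact 1 * fact 1)"
    unfolding wedge_def
    by (intro arg_cong2[where f = "(/)"] sum.cong refl arg_cong2[where f = "(*)"] 1 2)
  then show ?thesis
    unfolding set sum_over_permutations_insert[OF f] permutes_sing by (simp add: sign_swap_id)
qed

text \<open>The six permutations fall into pairs that differ by exchanging the two arguments of
  \<beta>; antisymmetry makes the members of a pair equal, which cancels the factor 2! in the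
  normalisation.\<close>

lemma wedge_1_2:
  assumes "alt_map 1 (\<sigma> c x)" "alt_map 2 (\<beta> c x)"
  shows "wedge 1 2 \<sigma> \<beta> c x X =
    ev1 \<sigma> c x (X 0) * ev2 \<beta> c x (X 1) (X 2) - ev1 \<sigma> c x (X 1) * ev2 \<beta> c x (X 0) (X 2)
      + ev1 \<sigma> c x (X 2) * ev2 \<beta> c x (X 0) (X 1)"
proof -
  have set: "{..<1 + 2} = insert 0 (insert 1 {2::nat})" by auto
  have f: "finite (insert 1 {2::nat})" "0 \<notin> insert 1 {2::nat}" "finite {2::nat}" "1 \<notin> {2::nat}" by auto
  have 1: "\<sigma> c x (\<lambda>i. X (\<pi> i)) = ev1 \<sigma> c x (X (\<pi> 0))" for \<pi>
    by (rule alt_map_1_eval[OF assms(1)])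
  have 2: "\<beta> c x (\<lambda>i. X (\<pi> (1 + i))) = ev2 \<beta> c x (X (\<pi> 1)) (X (\<pi> 2))" for \<pi>
    using alt_map_2_eval[OF assms(2), of "\<lambda>i. X (\<pi> (1 + i))"] by (simp add: numeral_2_eq_2)
  note sw = alt_map_2_swap[OF assms(2)]
  have "wedge 1 2 \<sigma> \<beta> c x X = (\<Sum>\<pi> | \<pi> permutes {..<1 + 2}.
      of_int (sign \<pi>) * ev1 \<sigma> c x (X (\<pi> 0)) * ev2 \<beta> c x (X (\<pi> 1)) (X (\<pi> 2))) / (fact 1 * fact 2)"
    unfolding wedge_def
    by (intro arg_cong2[where f = "(/)"] sum.cong refl arg_cong2[where f = "(*)"] 1 2)
  then show ?thesis
    unfolding set sum_over_permutations_insert[OF f(1,2)]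
      sum_over_permutations_insert[OF f(3,4)] permutes_sing
    using sw[of "X 2" "X 1"] sw[of "X 2" "X 0"] sw[of "X 1" "X 0"]
    by (simp add: sign_swap_id sign_id sign_compose permutation_swap_id permutation_compose
        transpose_def field_simps)
qed

section \<open>Charts and fields\<close>

lemma cornered_img: "is_chart c \<Longrightarrow> cornered (img c)"
  unfolding is_chart_def using cornered_open cornered_openin[OF cornered_half_space] by blast

lemma openin_overlap:
  assumes "is_chart c" "is_chart c'"
  shows "openin (top_of_set (img c)) (overlap c c')"
proof -
  obtain \<psi> where "homeomorphism (fst c) (img c) (snd c) \<psi>"
    using assms(1) by (auto simp: is_chart_def)
  moreover have "openin (top_of_set (fst c)) (fst c \<inter> fst c')"
    using assms by (simp add: is_chart_def openin_open_Int)
  ultimately show ?thesis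
    unfolding overlap_def by (rule homeomorphism_imp_open_map)
qed

lemma trans_map_in_img:
  assumes "is_chart c" "x \<in> overlap c c'"
  shows "trans_map c c' x \<in> img c'"
proof -
  obtain \<psi> where h: "homeomorphism (fst c) (img c) (snd c) \<psi>"
    using assms(1) by (auto simp: is_chart_def)
  have "inj_on (snd c) (fst c)"
    using h by (metis homeomorphism_apply1 inj_on_inverseI)
  with assms(2) show ?thesis
    by (auto simp: overlap_def trans_map_def img_def)
qed

lemma overlap_subset_img: "overlap c c' \<subseteq> img c"
  by (auto simp: overlap_def img_def)

locale oriented_manifold =
  fixes A :: "('p::topological_space, 'n::finite) chart set"
  assumes atlas: "oriented_atlas A"
begin

lemma chart: "c \<in> A \<Longrightarrow> is_chart c"
  using atlas by (simp add: oriented_atlas_def)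

lemma cornered_chart: "c \<in> A \<Longrightarrow> cornered (img c)"
  by (intro cornered_img chart)

context
  fixes c c' x
  assumes c: "c \<in> A" "c' \<in> A" and x: "x \<in> overlap c c'"
begin

lemma overlap_in_img: "x \<in> img c"
  using x overlap_subset_img by blast

lemma trans_in_img: "trans_map c c' x \<in> img c'"
  by (rule trans_map_in_img[OF chart[OF c(1)] x])

lemma cornered_overlap: "cornered (overlap c c')"
  using cornered_openin[OF cornered_chart openin_overlap] chart c by blast

lemma smooth_on_trans_map: "smooth_on (overlap c c') (trans_map c c')"
  using atlas c by (simp add: oriented_atlas_def)

lemma trans_map_has_derivative:
  "(trans_map c c' has_derivative jac c c' x) (at x within overlap c c')"
  unfolding jac_def by (rule smooth_on_has_derivative[OF smooth_on_trans_map x])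

lemma pullback_has_derivative:
  assumes "smooth_on (img c') F"
  shows "((\<lambda>y. F (trans_map c c' y)) has_derivative
    (\<lambda>h. fd (img c') F (trans_map c c' x) (jac c c' x h))) (at x within overlap c c')"
proof -
  have "trans_map c c' ` overlap c c' \<subseteq> img c'"
    using trans_map_in_img[OF chart[OF c(1)]] by blast
  then have "(F has_derivative fd (img c') F (trans_map c c' x))
      (at (trans_map c c' x) within trans_map c c' ` overlap c c')"
    by (rule has_derivative_subset[OF smooth_on_has_derivative[OF assms trans_in_img]])
  from diff_chain_within[OF trans_map_has_derivative this] show ?thesis
    by (simp add: o_def)
qed

lemma fd_img_overlap:
  assumes "smooth_on (img c) F"
  shows "fd (img c) F x = fd (overlap c c') F x"
  by (rule fd_openin[OF cornered_chart[OF c(1)] openin_overlap _ x, symmetric])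
    (use chart c overlap_in_img assms in \<open>auto simp: differentiable_def intro!: smooth_on_has_derivative\<close>)

end

lemma form_fieldD:
  assumes "form_field A k \<omega>" "c \<in> A"
  shows "x \<in> img c \<Longrightarrow> alt_map k (\<omega> c x)"
    and "smooth_on (img c) (\<lambda>x. \<omega> c x X)"
    and "c' \<in> A \<Longrightarrow> x \<in> overlap c c' \<Longrightarrow>
      \<omega> c' (trans_map c c' x) (\<lambda>i. jac c c' x (X i)) = \<omega> c x X"
  using assms unfolding form_field_def smooth_field_def by blast+

lemma scalar_fieldD:
  assumes "scalar_field A f" "c \<in> A"
  shows "smooth_on (img c) (f c)"
    and "c' \<in> A \<Longrightarrow> x \<in> overlap c c' \<Longrightarrow> f c' (trans_map c c' x) = f c x"
  using assms unfolding scalar_field_def smooth_field_def by blast+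

lemma vector_fieldD:
  assumes "vector_field A V" "c \<in> A"
  shows "smooth_on (img c) (V c)"
    and "c' \<in> A \<Longrightarrow> x \<in> overlap c c' \<Longrightarrow> V c' (trans_map c c' x) = jac c c' x (V c x)"
  using assms unfolding vector_field_def smooth_field_def by blast+

text \<open>Transition maps send overlaps into chart images, so even the transformation law sees
  nothing but values on chart images.\<close>

lemma form_field_cong:
  assumes "field_eq A \<omega> \<eta>"
  shows "form_field A k \<omega> \<longleftrightarrow> form_field A k \<eta>"
proof -
  have "form_field A k \<eta>" if f: "form_field A k \<omega>" and e: "field_eq A \<omega> \<eta>" for \<omega> \<eta> :: "('p, 'n) form"
    unfolding form_field_def smooth_field_def
  proof (intro conjI ballI allI)
    fix c X assume c: "c \<in> A"
    show "smooth_on (img c) (\<lambda>x. \<eta> c x X)"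
      by (rule iffD1[OF smooth_on_cong form_fieldD(2)[OF f c]]) (use e c in \<open>simp add: field_eq_def\<close>)
    show "alt_map k (\<eta> c x)" if "x \<in> img c" for x
      using form_fieldD(1)[OF f c that] e c that by (simp add: field_eq_def)
    show "\<eta> c' (trans_map c c' x) (\<lambda>i. jac c c' x (X i)) = \<eta> c x X"
      if c': "c' \<in> A" and x: "x \<in> overlap c c'" for c' x
      using form_fieldD(3)[OF f c c' x] e c c' trans_in_img[OF c c' x] overlap_in_img[OF c c' x]
      by (simp add: field_eq_def)
  qed
  moreover have "field_eq A \<eta> \<omega>" using assms by (simp add: field_eq_def)
  ultimately show ?thesis using assms by blast
qed

lemma form_field_diff:
  assumes "form_field A k \<omega>" "form_field A k \<eta>"
  shows "form_field A k (\<lambda>c x X. \<omega> c x X - \<eta> c x X)"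
  using assms unfolding form_field_def smooth_field_def
  by (simp add: alt_map_diff smooth_on_diff[OF cornered_chart])

lemma form_field_scale:
  assumes "scalar_field A f" "form_field A k \<omega>"
  shows "form_field A k (scale_form f \<omega>)"
  using assms unfolding form_field_def scalar_field_def smooth_field_def scale_form_def
  by (simp add: alt_map_scale smooth_on_mult[OF cornered_chart])

lemma ext_d_cong:
  assumes "field_eq A \<omega> \<eta>" shows "field_eq A (ext_d k \<omega>) (ext_d k \<eta>)"
  unfolding field_eq_def ext_d_def chart_deriv_def
proof (intro ballI ext sum.cong refl)
  fix c x X i assume c: "c \<in> A" and x: "x \<in> img c"
  have "fd (img c) (\<lambda>y. \<omega> c y (omit i X)) x = fd (img c) (\<lambda>y. \<eta> c y (omit i X)) x"
    by (rule fd_cong[OF x]) (use assms c in \<open>simp add: field_eq_def\<close>)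
  then show "(- 1) ^ i * fd (img c) (\<lambda>y. \<omega> c y (omit i X)) x (X i) =
      (- 1) ^ i * fd (img c) (\<lambda>y. \<eta> c y (omit i X)) x (X i)" by simp
qed

section \<open>Exterior derivatives evaluated on arguments\<close>

lemma omit_apply: "omit i X j = (if j < i then X j else X (Suc j))"
  by (simp add: omit_def)

lemma ext_d_0: "ext_d 0 (zero_form f) c x X = fd (img c) (f c) x (X 0)"
  by (simp add: ext_d_def zero_form_def chart_deriv_def)

text \<open>The arguments are constant in the coordinates of the chart, so the bracket term of the
  invariant formula is absent.\<close>

lemma ext_d_1:
  assumes "form_field A 1 \<omega>" "c \<in> A" "x \<in> img c"
  shows "ext_d 1 \<omega> c x X =
    fd (img c) (\<lambda>y. ev1 \<omega> c y (X 1)) x (X 0) - fd (img c) (\<lambda>y. ev1 \<omega> c y (X 0)) x (X 1)"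
proof -
  have "fd (img c) (\<lambda>y. \<omega> c y (omit i X)) x = fd (img c) (\<lambda>y. ev1 \<omega> c y (omit i X 0)) x" for i
    by (rule fd_cong[OF assms(3)]) (rule alt_map_1_eval[OF form_fieldD(1)[OF assms(1,2)]])
  then show ?thesis by (simp add: ext_d_def chart_deriv_def omit_apply)
qed

lemma ext_d_2:
  assumes "form_field A 2 \<omega>" "c \<in> A" "x \<in> img c"
  shows "ext_d 2 \<omega> c x X =
    fd (img c) (\<lambda>y. ev2 \<omega> c y (X 1) (X 2)) x (X 0) - fd (img c) (\<lambda>y. ev2 \<omega> c y (X 0) (X 2)) x (X 1)
      + fd (img c) (\<lambda>y. ev2 \<omega> c y (X 0) (X 1)) x (X 2)"
proof -
  have "fd (img c) (\<lambda>y. \<omega> c y (omit i X)) x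
      = fd (img c) (\<lambda>y. ev2 \<omega> c y (omit i X 0) (omit i X 1)) x" for i
    by (rule fd_cong[OF assms(3)]) (rule alt_map_2_eval[OF form_fieldD(1)[OF assms(1,2)]])
  then show ?thesis by (simp add: ext_d_def chart_deriv_def omit_apply numeral_2_eq_2)
qed

lemma ext_d_diff:
  assumes "form_field A k \<omega>" "form_field A k \<eta>"
  shows "field_eq A (ext_d k (\<lambda>c x X. \<omega> c x X - \<eta> c x X)) (\<lambda>c x X. ext_d k \<omega> c x X - ext_d k \<eta> c x X)"
  unfolding field_eq_def ext_d_def chart_deriv_def
  by (auto simp: fd_diff[OF cornered_chart _ form_fieldD(2)[OF assms(1)] form_fieldD(2)[OF assms(2)]]
      algebra_simps sum_subtractf)

section \<open>Tensoriality of the operations on forms\<close>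

lemma form_field_1I:
  assumes "\<And>c x X. c \<in> A \<Longrightarrow> x \<in> img c \<Longrightarrow> \<omega> c x X = L c x (X 0)"
    and lin: "\<And>c x. c \<in> A \<Longrightarrow> x \<in> img c \<Longrightarrow> linear (L c x)"
    and sm: "\<And>c Z. c \<in> A \<Longrightarrow> smooth_on (img c) (\<lambda>x. L c x Z)"
    and tr: "\<And>c c' x Z. c \<in> A \<Longrightarrow> c' \<in> A \<Longrightarrow> x \<in> overlap c c' \<Longrightarrow>
      L c' (trans_map c c' x) (jac c c' x Z) = L c x Z"
  shows "form_field A 1 \<omega>"
proof -
  have "field_eq A (\<lambda>c x X. L c x (X 0)) \<omega>" using assms(1) by (auto simp: field_eq_def)
  moreover have "form_field A 1 (\<lambda>c x X. L c x (X 0))"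
    unfolding form_field_def smooth_field_def using lin sm tr alt_map_1I by blast
  ultimately show ?thesis using form_field_cong by blast
qed

lemma form_field_2I:
  assumes "\<And>c x X. c \<in> A \<Longrightarrow> x \<in> img c \<Longrightarrow> \<omega> c x X = B c x (X 0) (X 1)"
    and lin: "\<And>c x. c \<in> A \<Longrightarrow> x \<in> img c \<Longrightarrow> bilinear (B c x)"
    and alt: "\<And>c x Y. c \<in> A \<Longrightarrow> x \<in> img c \<Longrightarrow> B c x Y Y = 0"
    and sm: "\<And>c Y Z. c \<in> A \<Longrightarrow> smooth_on (img c) (\<lambda>x. B c x Y Z)"
    and tr: "\<And>c c' x Y Z. c \<in> A \<Longrightarrow> c' \<in> A \<Longrightarrow> x \<in> overlap c c' \<Longrightarrow>
      B c' (trans_map c c' x) (jac c c' x Y) (jac c c' x Z) = B c x Y Z"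
  shows "form_field A 2 \<omega>"
proof -
  have "field_eq A (\<lambda>c x X. B c x (X 0) (X 1)) \<omega>" using assms(1) by (auto simp: field_eq_def)
  moreover have "form_field A 2 (\<lambda>c x X. B c x (X 0) (X 1))"
    unfolding form_field_def smooth_field_def
    by (intro conjI ballI allI alt_map_2I lin sm tr alt)
  ultimately show ?thesis using form_field_cong by blast
qed

lemma ev1_linear: "form_field A 1 \<omega> \<Longrightarrow> c \<in> A \<Longrightarrow> x \<in> img c \<Longrightarrow> linear (ev1 \<omega> c x)"
  using alt_map_1_linear[OF form_fieldD(1)] by blast

lemma ev1_eval: "form_field A 1 \<omega> \<Longrightarrow> c \<in> A \<Longrightarrow> x \<in> img c \<Longrightarrow> \<omega> c x X = ev1 \<omega> c x (X 0)"
  using alt_map_1_eval[OF form_fieldD(1)] by blast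

lemma ev2_bilinear: "form_field A 2 \<omega> \<Longrightarrow> c \<in> A \<Longrightarrow> x \<in> img c \<Longrightarrow> bilinear (ev2 \<omega> c x)"
  using alt_map_2_bilinear[OF form_fieldD(1)] by blast

lemma ev2_trans:
  assumes "form_field A 2 \<omega>" "c \<in> A" "c' \<in> A" "x \<in> overlap c c'"
  shows "ev2 \<omega> c' (trans_map c c' x) (jac c c' x Y) (jac c c' x Z) = ev2 \<omega> c x Y Z"
proof -
  have "(\<lambda>i. jac c c' x (case_nat Y (\<lambda>_. Z) i)) = case_nat (jac c c' x Y) (\<lambda>_. jac c c' x Z)"
    by (auto split: nat.splits)
  then show ?thesis
    using form_fieldD(3)[OF assms(1-4), of "case_nat Y (\<lambda>_. Z)"] by simp
qed

lemma ev2_ext_d_1: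
  assumes "form_field A 1 \<omega>" "c \<in> A" "x \<in> img c"
  shows "ev2 (ext_d 1 \<omega>) c x Y Z = fd (img c) (\<lambda>y. ev1 \<omega> c y Z) x Y - fd (img c) (\<lambda>y. ev1 \<omega> c y Y) x Z"
  unfolding ext_d_1[OF assms] by simp

lemma form_field_ext_d_0:
  assumes "scalar_field A f" shows "form_field A 1 (ext_d 0 (zero_form f))"
proof (rule form_field_1I[OF ext_d_0])
  note sm = scalar_fieldD(1)[OF assms]
  show "linear (fd (img c) (f c) x)" if "c \<in> A" "x \<in> img c" for c x
    using linear_fd[OF cornered_chart _ sm] that by blast
  show "smooth_on (img c) (\<lambda>x. fd (img c) (f c) x Z)" if "c \<in> A" for c Z
    by (intro smooth_on_fd sm that)
  show "fd (img c') (f c') (trans_map c c' x) (jac c c' x Z) = fd (img c) (f c) x Z"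
    if c: "c \<in> A" "c' \<in> A" and x: "x \<in> overlap c c'" for c c' x Z
  proof -
    have "fd (img c) (f c) x = fd (overlap c c') (f c) x"
      by (rule fd_img_overlap[OF c x sm[OF c(1)]])
    also have "\<dots> = fd (overlap c c') (\<lambda>y. f c' (trans_map c c' y)) x"
      by (rule fd_cong[OF x]) (use scalar_fieldD(2)[OF assms c] in simp)
    also have "\<dots> = (\<lambda>h. fd (img c') (f c') (trans_map c c' x) (jac c c' x h))"
      by (rule fd_eqI[OF cornered_overlap[OF c x] x pullback_has_derivative[OF c x sm[OF c(2)]]])
    finally show ?thesis by simp
  qed
qed

text \<open>Differentiating the transformation law of \<omega> produces a second derivative of the
  transition map. It is symmetric in the two arguments, so it disappears from the antisymmetrised
  expression.\<close>

lemma form_field_ext_d_1: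
  assumes "form_field A 1 \<omega>" shows "form_field A 2 (ext_d 1 \<omega>)"
proof (rule form_field_2I[where B = "\<lambda>c x Y Z. fd (img c) (\<lambda>y. ev1 \<omega> c y Z) x Y
      - fd (img c) (\<lambda>y. ev1 \<omega> c y Y) x Z", OF ext_d_1[OF assms]])
  note sm = form_fieldD(2)[OF assms]
  note S = cornered_chart
  show "bilinear (\<lambda>Y Z. fd (img c) (\<lambda>y. ev1 \<omega> c y Z) x Y - fd (img c) (\<lambda>y. ev1 \<omega> c y Y) x Z)"
    if "c \<in> A" "x \<in> img c" for c x
    unfolding bilinear_def
    using linear_fd[OF S that(2) sm] linear_fd_family[OF S that(2) ev1_linear[OF assms] sm] that
    by (auto intro!: linear_compose_sub)
  show "smooth_on (img c) (\<lambda>x. fd (img c) (\<lambda>y. ev1 \<omega> c y Z) x Y - fd (img c) (\<lambda>y. ev1 \<omega> c y Y) x Z)"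
    if "c \<in> A" for c Y Z
    by (intro smooth_on_diff smooth_on_fd sm S that)
  show "fd (img c') (\<lambda>y. ev1 \<omega> c' y (jac c c' x Z)) (trans_map c c' x) (jac c c' x Y) -
       fd (img c') (\<lambda>y. ev1 \<omega> c' y (jac c c' x Y)) (trans_map c c' x) (jac c c' x Z) =
       fd (img c) (\<lambda>y. ev1 \<omega> c y Z) x Y - fd (img c) (\<lambda>y. ev1 \<omega> c y Y) x Z"
    if c: "c \<in> A" "c' \<in> A" and x: "x \<in> overlap c c'" for c c' x Y Z
  proof -
    let ?O = "overlap c c'" and ?\<phi> = "trans_map c c'"
    note O = cornered_overlap[OF c x] and smt = smooth_on_trans_map[OF c x]
    \<comment> \<open>Product rule for \<omega> pulled back along the transition map: the last
      summand holds its second derivative.\<close>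
    have "fd (img c) (\<lambda>y. ev1 \<omega> c y Z) x W =
        fd (img c') (\<lambda>y. ev1 \<omega> c' y (jac c c' x Z)) (?\<phi> x) (jac c c' x W)
          + ev1 \<omega> c' (?\<phi> x) (fd ?O (\<lambda>y. fd ?O ?\<phi> y Z) x W)" for Z W
    proof -
      have "fd (img c) (\<lambda>y. ev1 \<omega> c y Z) x = fd ?O (\<lambda>y. ev1 \<omega> c y Z) x"
        by (rule fd_img_overlap[OF c x sm[OF c(1)]])
      also have "\<dots> = fd ?O (\<lambda>y. ev1 \<omega> c' (?\<phi> y) (fd ?O ?\<phi> y Z)) x"
        by (rule fd_cong[OF x])
          (use form_fieldD(3)[OF assms c, of _ "\<lambda>_. Z"] in \<open>simp add: jac_def\<close>)
      also have "\<dots> = (\<lambda>h. fd (img c') (\<lambda>y. ev1 \<omega> c' y (fd ?O ?\<phi> x Z)) (?\<phi> x) (jac c c' x h)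
          + ev1 \<omega> c' (?\<phi> x) (fd ?O (\<lambda>y. fd ?O ?\<phi> y Z) x h))"
      proof (rule fd_eqI[OF O x has_derivative_family[OF O _ x]])
        show "linear (ev1 \<omega> c' (?\<phi> y))" if "y \<in> ?O" for y
          by (rule ev1_linear[OF assms c(2) trans_in_img[OF c that]])
        show "((\<lambda>y. ev1 \<omega> c' (?\<phi> y) Z) has_derivative
            (\<lambda>h. fd (img c') (\<lambda>y. ev1 \<omega> c' y Z) (?\<phi> x) (jac c c' x h))) (at x within ?O)" for Z
          by (rule pullback_has_derivative[OF c x sm[OF c(2)]])
        show "((\<lambda>y. fd ?O ?\<phi> y Z) has_derivative fd ?O (\<lambda>y. fd ?O ?\<phi> y Z) x) (at x within ?O)"
          by (rule smooth_on_has_derivative[OF smooth_on_fd[OF smt] x])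
      qed
      finally show ?thesis by (simp add: jac_def)
    qed
    then show ?thesis using fd_swap_vec[OF O x smt, of Y Z] by simp
  qed
qed simp_all

lemma form_field_int_prod:
  assumes V: "vector_field A V" and \<omega>: "form_field A 2 \<omega>"
  shows "form_field A 1 (int_prod V \<omega>)"
proof (rule form_field_1I[where L = "\<lambda>c x. ev2 \<omega> c x (V c x)"])
  note bil = ev2_bilinear[OF \<omega>, unfolded bilinear_def]
  show "int_prod V \<omega> c x X = ev2 \<omega> c x (V c x) (X 0)" if "c \<in> A" "x \<in> img c" for c x X
    using alt_map_2_eval[OF form_fieldD(1)[OF \<omega> that], of "case_nat (V c x) X"]
    by (simp add: int_prod_def)
  show "linear (ev2 \<omega> c x (V c x))" if "c \<in> A" "x \<in> img c" for c x
    using bil[OF that] by blast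
  show "smooth_on (img c) (\<lambda>x. ev2 \<omega> c x (V c x) Z)" if "c \<in> A" for c Z
  proof (rule smooth_on_family[OF cornered_chart[OF that], where a = "\<lambda>x Y. ev2 \<omega> c x Y Z"])
    show "linear (\<lambda>Y. ev2 \<omega> c y Y Z)" if "y \<in> img c" for y
      using bil[OF \<open>c \<in> A\<close> that] by blast
  qed (rule form_fieldD(2)[OF \<omega> that] vector_fieldD(1)[OF V that])+
  show "ev2 \<omega> c' (trans_map c c' x) (V c' (trans_map c c' x)) (jac c c' x Z) = ev2 \<omega> c x (V c x) Z"
    if c: "c \<in> A" "c' \<in> A" and x: "x \<in> overlap c c'" for c c' x Z
    by (simp add: vector_fieldD(2)[OF V c x] ev2_trans[OF \<omega> c x])
qed

lemma form_field_wedge_1_2: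
  assumes \<sigma>: "form_field A 1 \<sigma>" and \<beta>: "form_field A 2 \<beta>"
  shows "form_field A 3 (wedge 1 2 \<sigma> \<beta>)"
proof -
  let ?W = "\<lambda>c x X. ev1 \<sigma> c x (X 0) * ev2 \<beta> c x (X 1) (X 2) - ev1 \<sigma> c x (X 1) * ev2 \<beta> c x (X 0) (X 2)
      + ev1 \<sigma> c x (X 2) * ev2 \<beta> c x (X 0) (X 1)"
  have "field_eq A (wedge 1 2 \<sigma> \<beta>) ?W"
    unfolding field_eq_def
    by (intro ballI ext wedge_1_2 form_fieldD(1)[OF \<sigma>] form_fieldD(1)[OF \<beta>])
  moreover have "form_field A 3 ?W"
    unfolding form_field_def smooth_field_def
  proof (intro conjI ballI allI)
    fix c X assume c: "c \<in> A"
    show "alt_map 3 (?W c x)" if "x \<in> img c" for x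
      using ev1_linear[OF \<sigma> c that] ev2_bilinear[OF \<beta> c that]
        alt_map_2_self[OF form_fieldD(1)[OF \<beta> c that]] by (rule alt_map_3I)
    show "smooth_on (img c) (\<lambda>x. ?W c x X)"
      by (intro smooth_on_add smooth_on_diff smooth_on_mult cornered_chart c
          form_fieldD(2)[OF \<sigma> c] form_fieldD(2)[OF \<beta> c])
    show "?W c' (trans_map c c' x) (\<lambda>i. jac c c' x (X i)) = ?W c x X"
      if "c' \<in> A" "x \<in> overlap c c'" for c' x
      by (simp add: ev2_trans[OF \<beta> c that] form_fieldD(3)[OF \<sigma> c that])
  qed
  ultimately show ?thesis using form_field_cong by blast
qed

lemma scalar_field_ev1:
  assumes V: "vector_field A V" and \<sigma>: "form_field A 1 \<sigma>"
  shows "scalar_field A (\<lambda>c x. ev1 \<sigma> c x (V c x))"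
  unfolding scalar_field_def smooth_field_def
proof (intro conjI ballI)
  show "smooth_on (img c) (\<lambda>x. ev1 \<sigma> c x (V c x))" if "c \<in> A" for c
    by (rule smooth_on_family[OF cornered_chart[OF that] ev1_linear[OF \<sigma> that]
          form_fieldD(2)[OF \<sigma> that] vector_fieldD(1)[OF V that]])
  show "ev1 \<sigma> c' (trans_map c c' x) (V c' (trans_map c c' x)) = ev1 \<sigma> c x (V c x)"
    if "c \<in> A" "c' \<in> A" "x \<in> overlap c c'" for c c' x
    by (simp add: vector_fieldD(2)[OF V that] form_fieldD(3)[OF \<sigma> that])
qed

lemma scalar_field_divide:
  assumes "scalar_field A f" "scalar_field A s" "\<And>c x. c \<in> A \<Longrightarrow> x \<in> img c \<Longrightarrow> s c x \<noteq> 0"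
  shows "scalar_field A (\<lambda>c x. f c x / s c x)"
  using assms smooth_on_divide[OF cornered_chart]
  unfolding scalar_field_def smooth_field_def by simp

lemma scalar_field_power:
  assumes "scalar_field A f" shows "scalar_field A (\<lambda>c x. f c x ^ m)"
  using assms smooth_on_power[OF cornered_chart]
  unfolding scalar_field_def smooth_field_def by simp

lemma scalar_field_ln:
  assumes "scalar_field A s" "\<And>c x. c \<in> A \<Longrightarrow> x \<in> img c \<Longrightarrow> s c x > 0"
  shows "scalar_field A (\<lambda>c x. ln (s c x))"
  using assms smooth_on_ln[OF cornered_chart]
  unfolding scalar_field_def smooth_field_def by simp

section \<open>Exterior calculus\<close>

lemma wedge_1_1_eq:
  assumes "form_field A 1 \<sigma>" "form_field A 1 \<beta>" "c \<in> A" "x \<in> img c"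
  shows "wedge 1 1 \<sigma> \<beta> c x X = ev1 \<sigma> c x (X 0) * ev1 \<beta> c x (X 1) - ev1 \<sigma> c x (X 1) * ev1 \<beta> c x (X 0)"
  by (rule wedge_1_1) (intro form_fieldD(1) assms)+

lemma wedge_1_2_eq:
  assumes "form_field A 1 \<sigma>" "form_field A 2 \<beta>" "c \<in> A" "x \<in> img c"
  shows "wedge 1 2 \<sigma> \<beta> c x X =
    ev1 \<sigma> c x (X 0) * ev2 \<beta> c x (X 1) (X 2) - ev1 \<sigma> c x (X 1) * ev2 \<beta> c x (X 0) (X 2)
      + ev1 \<sigma> c x (X 2) * ev2 \<beta> c x (X 0) (X 1)"
  by (rule wedge_1_2) (intro form_fieldD(1) assms)+

lemma ev2_wedge_1_1:
  assumes "form_field A 1 \<sigma>" "form_field A 1 \<beta>" "c \<in> A" "x \<in> img c"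
  shows "ev2 (wedge 1 1 \<sigma> \<beta>) c x Y Z = ev1 \<sigma> c x Y * ev1 \<beta> c x Z - ev1 \<sigma> c x Z * ev1 \<beta> c x Y"
  unfolding wedge_1_1_eq[OF assms] by simp

lemma form_field_wedge_1_1:
  assumes \<sigma>: "form_field A 1 \<sigma>" and \<beta>: "form_field A 1 \<beta>"
  shows "form_field A 2 (wedge 1 1 \<sigma> \<beta>)"
proof (rule form_field_2I[where B = "\<lambda>c x Y Z. ev1 \<sigma> c x Y * ev1 \<beta> c x Z - ev1 \<sigma> c x Z * ev1 \<beta> c x Y",
      OF wedge_1_1_eq[OF assms]])
  show "bilinear (\<lambda>Y Z. ev1 \<sigma> c x Y * ev1 \<beta> c x Z - ev1 \<sigma> c x Z * ev1 \<beta> c x Y)"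
    if "c \<in> A" "x \<in> img c" for c x
    using ev1_linear[OF \<sigma> that] ev1_linear[OF \<beta> that]
    by (auto simp: bilinear_def linear_iff algebra_simps)
  show "smooth_on (img c) (\<lambda>x. ev1 \<sigma> c x Y * ev1 \<beta> c x Z - ev1 \<sigma> c x Z * ev1 \<beta> c x Y)"
    if "c \<in> A" for c Y Z
    by (intro smooth_on_diff smooth_on_mult cornered_chart that
        form_fieldD(2)[OF \<sigma> that] form_fieldD(2)[OF \<beta> that])
  show "ev1 \<sigma> c' (trans_map c c' x) (jac c c' x Y) * ev1 \<beta> c' (trans_map c c' x) (jac c c' x Z) -
        ev1 \<sigma> c' (trans_map c c' x) (jac c c' x Z) * ev1 \<beta> c' (trans_map c c' x) (jac c c' x Y) =
        ev1 \<sigma> c x Y * ev1 \<beta> c x Z - ev1 \<sigma> c x Z * ev1 \<beta> c x Y"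
    if "c \<in> A" "c' \<in> A" "x \<in> overlap c c'" for c c' x Y Z
    by (simp add: form_fieldD(3)[OF \<sigma> that] form_fieldD(3)[OF \<beta> that])
qed simp_all

lemma ext_d_1_scale:
  assumes f: "scalar_field A f" and \<sigma>: "form_field A 1 \<sigma>" and x: "c \<in> A" "x \<in> img c"
  shows "ev2 (ext_d 1 (scale_form f \<sigma>)) c x Y Z =
    ev1 (ext_d 0 (zero_form f)) c x Y * ev1 \<sigma> c x Z - ev1 (ext_d 0 (zero_form f)) c x Z * ev1 \<sigma> c x Y
      + f c x * ev2 (ext_d 1 \<sigma>) c x Y Z"
  unfolding ev2_ext_d_1[OF form_field_scale[OF f \<sigma>] x] ev2_ext_d_1[OF \<sigma> x] ext_d_0
  by (simp add: scale_form_def algebra_simps fd_mult[OF cornered_chart[OF x(1)] x(2)]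
      form_fieldD(2)[OF \<sigma> x(1)] scalar_fieldD(1)[OF f x(1)])

lemma ext_d_2_scale:
  assumes f: "scalar_field A f" and \<omega>: "form_field A 2 \<omega>" and x: "c \<in> A" "x \<in> img c"
  shows "ext_d 2 (scale_form f \<omega>) c x X =
    wedge 1 2 (ext_d 0 (zero_form f)) \<omega> c x X + f c x * ext_d 2 \<omega> c x X"
  unfolding ext_d_2[OF form_field_scale[OF f \<omega>] x] ext_d_2[OF \<omega> x] ext_d_0
    wedge_1_2_eq[OF form_field_ext_d_0[OF f] \<omega> x]
  by (simp add: scale_form_def algebra_simps fd_mult[OF cornered_chart[OF x(1)] x(2)]
      form_fieldD(2)[OF \<omega> x(1)] scalar_fieldD(1)[OF f x(1)])

text \<open>The Leibniz rule d\<sigma> \<and> \<beta> - \<sigma> \<and> d\<beta>, with the two-form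
  moved to the second place; a one-form and a two-form commute.\<close>

lemma ext_d_2_wedge_1_1:
  assumes \<sigma>: "form_field A 1 \<sigma>" and \<beta>: "form_field A 1 \<beta>" and x: "c \<in> A" "x \<in> img c"
  shows "ext_d 2 (wedge 1 1 \<sigma> \<beta>) c x X =
    wedge 1 2 \<beta> (ext_d 1 \<sigma>) c x X - wedge 1 2 \<sigma> (ext_d 1 \<beta>) c x X"
proof -
  note S = cornered_chart[OF x(1)]
  note sm = form_fieldD(2)[OF \<sigma> x(1)] form_fieldD(2)[OF \<beta> x(1)]
  have D: "fd (img c) (\<lambda>y. ev2 (wedge 1 1 \<sigma> \<beta>) c y Y Z) x h =
      fd (img c) (\<lambda>y. ev1 \<sigma> c y Y) x h * ev1 \<beta> c x Z + ev1 \<sigma> c x Y * fd (img c) (\<lambda>y. ev1 \<beta> c y Z) x h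
      - (fd (img c) (\<lambda>y. ev1 \<sigma> c y Z) x h * ev1 \<beta> c x Y + ev1 \<sigma> c x Z * fd (img c) (\<lambda>y. ev1 \<beta> c y Y) x h)"
    for Y Z h
  proof -
    have "fd (img c) (\<lambda>y. ev2 (wedge 1 1 \<sigma> \<beta>) c y Y Z) x =
        fd (img c) (\<lambda>y. ev1 \<sigma> c y Y * ev1 \<beta> c y Z - ev1 \<sigma> c y Z * ev1 \<beta> c y Y) x"
      by (rule fd_cong[OF x(2)]) (rule ev2_wedge_1_1[OF \<sigma> \<beta> x(1)])
    then show ?thesis
      by (simp add: fd_diff[OF S x(2)] fd_mult[OF S x(2)] smooth_on_mult[OF S] sm)
  qed
  show ?thesis
    unfolding ext_d_2[OF form_field_wedge_1_1[OF \<sigma> \<beta>] x] D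
      wedge_1_2_eq[OF \<beta> form_field_ext_d_1[OF \<sigma>] x] wedge_1_2_eq[OF \<sigma> form_field_ext_d_1[OF \<beta>] x]
      ev2_ext_d_1[OF \<sigma> x] ev2_ext_d_1[OF \<beta> x]
    by (simp add: algebra_simps)
qed

lemma ext_d_1_ext_d_0:
  assumes f: "scalar_field A f" and x: "c \<in> A" "x \<in> img c"
  shows "ext_d 1 (ext_d 0 (zero_form f)) c x X = 0"
  unfolding ext_d_1[OF form_field_ext_d_0[OF f] x] ext_d_0
  using fd_swap[OF cornered_chart[OF x(1)] x(2) scalar_fieldD(1)[OF f x(1)]] by simp

lemma ext_d_2_ext_d_1:
  assumes \<sigma>: "form_field A 1 \<sigma>" and x: "c \<in> A" "x \<in> img c"
  shows "ext_d 2 (ext_d 1 \<sigma>) c x X = 0"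
proof -
  note S = cornered_chart[OF x(1)] and sm = form_fieldD(2)[OF \<sigma> x(1)]
  have D: "fd (img c) (\<lambda>y. ev2 (ext_d 1 \<sigma>) c y Y Z) x h =
      fd (img c) (\<lambda>y. fd (img c) (\<lambda>y. ev1 \<sigma> c y Z) y Y) x h
      - fd (img c) (\<lambda>y. fd (img c) (\<lambda>y. ev1 \<sigma> c y Y) y Z) x h" for Y Z h
  proof -
    have "fd (img c) (\<lambda>y. ev2 (ext_d 1 \<sigma>) c y Y Z) x = fd (img c) (\<lambda>y.
        fd (img c) (\<lambda>y. ev1 \<sigma> c y Z) y Y - fd (img c) (\<lambda>y. ev1 \<sigma> c y Y) y Z) x"
      by (rule fd_cong[OF x(2)]) (rule ev2_ext_d_1[OF \<sigma> x(1)])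
    then show ?thesis by (simp add: fd_diff[OF S x(2)] smooth_on_fd sm)
  qed
  note sw = fd_swap[OF S x(2) sm]
  show ?thesis
    unfolding ext_d_2[OF form_field_ext_d_1[OF \<sigma>] x] D
    using sw[of "\<lambda>_. X 0" "X 1" "X 2"] sw[of "\<lambda>_. X 1" "X 0" "X 2"] sw[of "\<lambda>_. X 2" "X 0" "X 1"]
    by simp
qed

lemma ext_d_3:
  "ext_d 3 \<omega> c x X =
    fd (img c) (\<lambda>y. \<omega> c y (omit 0 X)) x (X 0) - fd (img c) (\<lambda>y. \<omega> c y (omit 1 X)) x (X 1)
      + fd (img c) (\<lambda>y. \<omega> c y (omit 2 X)) x (X 2) - fd (img c) (\<lambda>y. \<omega> c y (omit 3 X)) x (X 3)"
  by (simp add: ext_d_def chart_deriv_def numeral_3_eq_3 numeral_2_eq_2)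

text \<open>The right-hand side is d\<sigma> \<and> d\<beta> over the six shuffles of two and two
  arguments; the remaining Leibniz term \<sigma> \<and> d d\<beta> vanishes.\<close>

lemma ext_d_3_wedge_1_2:
  assumes \<sigma>: "form_field A 1 \<sigma>" and \<beta>: "form_field A 1 \<beta>" and x: "c \<in> A" "x \<in> img c"
  shows "ext_d 3 (wedge 1 2 \<sigma> (ext_d 1 \<beta>)) c x X =
    ev2 (ext_d 1 \<sigma>) c x (X 0) (X 1) * ev2 (ext_d 1 \<beta>) c x (X 2) (X 3)
    - ev2 (ext_d 1 \<sigma>) c x (X 0) (X 2) * ev2 (ext_d 1 \<beta>) c x (X 1) (X 3)
    + ev2 (ext_d 1 \<sigma>) c x (X 0) (X 3) * ev2 (ext_d 1 \<beta>) c x (X 1) (X 2)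
    + ev2 (ext_d 1 \<sigma>) c x (X 1) (X 2) * ev2 (ext_d 1 \<beta>) c x (X 0) (X 3)
    - ev2 (ext_d 1 \<sigma>) c x (X 1) (X 3) * ev2 (ext_d 1 \<beta>) c x (X 0) (X 2)
    + ev2 (ext_d 1 \<sigma>) c x (X 2) (X 3) * ev2 (ext_d 1 \<beta>) c x (X 0) (X 1)"
proof -
  note S = cornered_chart[OF x(1)]
  note d\<beta> = form_field_ext_d_1[OF \<beta>]
  note sm = form_fieldD(2)[OF \<sigma> x(1)] form_fieldD(2)[OF d\<beta> x(1)]
  have D: "fd (img c) (\<lambda>y. wedge 1 2 \<sigma> (ext_d 1 \<beta>) c y Y) x h =
      fd (img c) (\<lambda>y. ev1 \<sigma> c y (Y 0)) x h * ev2 (ext_d 1 \<beta>) c x (Y 1) (Y 2)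
      + ev1 \<sigma> c x (Y 0) * fd (img c) (\<lambda>y. ev2 (ext_d 1 \<beta>) c y (Y 1) (Y 2)) x h
      - (fd (img c) (\<lambda>y. ev1 \<sigma> c y (Y 1)) x h * ev2 (ext_d 1 \<beta>) c x (Y 0) (Y 2)
      + ev1 \<sigma> c x (Y 1) * fd (img c) (\<lambda>y. ev2 (ext_d 1 \<beta>) c y (Y 0) (Y 2)) x h)
      + (fd (img c) (\<lambda>y. ev1 \<sigma> c y (Y 2)) x h * ev2 (ext_d 1 \<beta>) c x (Y 0) (Y 1)
      + ev1 \<sigma> c x (Y 2) * fd (img c) (\<lambda>y. ev2 (ext_d 1 \<beta>) c y (Y 0) (Y 1)) x h)" for Y h
  proof -
    have "fd (img c) (\<lambda>y. wedge 1 2 \<sigma> (ext_d 1 \<beta>) c y Y) x = fd (img c) (\<lambda>y.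
        ev1 \<sigma> c y (Y 0) * ev2 (ext_d 1 \<beta>) c y (Y 1) (Y 2) - ev1 \<sigma> c y (Y 1) * ev2 (ext_d 1 \<beta>) c y (Y 0) (Y 2)
        + ev1 \<sigma> c y (Y 2) * ev2 (ext_d 1 \<beta>) c y (Y 0) (Y 1)) x"
      by (rule fd_cong[OF x(2)]) (rule wedge_1_2_eq[OF \<sigma> d\<beta> x(1)])
    then show ?thesis
      by (simp add: fd_add[OF S x(2)] fd_diff[OF S x(2)] fd_mult[OF S x(2)]
          smooth_on_mult[OF S] smooth_on_diff[OF S] sm del: One_nat_def)
  qed
  have closed: "fd (img c) (\<lambda>y. ev2 (ext_d 1 \<beta>) c y Z W) x Y - fd (img c) (\<lambda>y. ev2 (ext_d 1 \<beta>) c y Y W) x Z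
      + fd (img c) (\<lambda>y. ev2 (ext_d 1 \<beta>) c y Y Z) x W = 0" for Y Z W
    using ext_d_2_ext_d_1[OF \<beta> x, of "case_nat Y (case_nat Z (\<lambda>_. W))"]
    unfolding ext_d_2[OF d\<beta> x] by (simp add: numeral_2_eq_2)
  \<comment> \<open>Closedness of d\<beta>, solved for one derivative. It is used for the four
    triples among X 0, ..., X 3, each being the cofactor of \<sigma> at the omitted
    argument.\<close>
  have Q: "fd (img c) (\<lambda>y. ev2 (ext_d 1 \<beta>) c y Y Z) x W =
      fd (img c) (\<lambda>y. ev2 (ext_d 1 \<beta>) c y Y W) x Z - fd (img c) (\<lambda>y. ev2 (ext_d 1 \<beta>) c y Z W) x Y"
    for Y Z W
    using closed[where Y = Y and Z = Z and W = W] by simp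
  have om: "omit 0 X 0 = X 1" "omit 0 X 1 = X 2" "omit 0 X 2 = X 3"
    "omit 1 X 0 = X 0" "omit 1 X 1 = X 2" "omit 1 X 2 = X 3"
    "omit 2 X 0 = X 0" "omit 2 X 1 = X 1" "omit 2 X 2 = X 3"
    "omit 3 X 0 = X 0" "omit 3 X 1 = X 1" "omit 3 X 2 = X 2"
    by (simp_all add: omit_apply numeral_2_eq_2 numeral_3_eq_3)
  show ?thesis
    unfolding ext_d_3 D om ev2_ext_d_1[OF \<sigma> x]
    using Q[where Y = "X 0" and Z = "X 1" and W = "X 2"] Q[where Y = "X 0" and Z = "X 1" and W = "X 3"]
      Q[where Y = "X 0" and Z = "X 2" and W = "X 3"] Q[where Y = "X 1" and Z = "X 2" and W = "X 3"]
    by algebra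
qed

section \<open>The Godbillon-Vey class\<close>

lemma exact_form_diff:
  assumes "exact_form A (Suc m) \<omega>" "exact_form A (Suc m) \<eta>"
  shows "exact_form A (Suc m) (\<lambda>c x X. \<omega> c x X - \<eta> c x X)"
proof -
  obtain \<theta> \<theta>' where t: "form_field A m \<theta>" "field_eq A \<omega> (ext_d m \<theta>)"
    "form_field A m \<theta>'" "field_eq A \<eta> (ext_d m \<theta>')"
    using assms by (auto simp: exact_form_def)
  have "field_eq A (\<lambda>c x X. \<omega> c x X - \<eta> c x X) (ext_d m (\<lambda>c x X. \<theta> c x X - \<theta>' c x X))"
    using ext_d_diff[OF t(1,3)] t(2,4) by (simp add: field_eq_def)
  with form_field_diff[OF t(1,3)] show ?thesis by (auto simp: exact_form_def)
qed

lemma exact_form_minus: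
  assumes "exact_form A (Suc m) (\<lambda>c x X. \<omega> c x X - \<eta> c x X)"
  shows "exact_form A (Suc m) (\<lambda>c x X. \<eta> c x X - \<omega> c x X)"
  \<comment> \<open>The negative is obtained as (a - a) - a.\<close>
  using exact_form_diff[OF exact_form_diff[OF assms assms] assms] by simp

lemma deRham_class_eqI:
  assumes "exact_form A (Suc m) (\<lambda>c x X. \<omega> c x X - \<omega>' c x X)"
  shows "deRham_class A (Suc m) \<omega> = deRham_class A (Suc m) \<omega>'"
proof -
  have "deRham_class A (Suc m) \<omega> \<subseteq> deRham_class A (Suc m) \<omega>'"
    if e: "exact_form A (Suc m) (\<lambda>c x X. \<omega> c x X - \<omega>' c x X)" for \<omega> \<omega>'
  proof -
    have "exact_form A (Suc m) (\<lambda>c x X. \<eta> c x X - \<omega>' c x X)"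
      if "exact_form A (Suc m) (\<lambda>c x X. \<eta> c x X - \<omega> c x X)" for \<eta>
      using exact_form_diff[OF that exact_form_minus[OF e]] by simp
    then show ?thesis by (auto simp: deRham_class_def)
  qed
  from subset_antisym[OF this[OF assms] this[OF exact_form_minus[OF assms]]] show ?thesis .
qed

lemma deRham_class_cong:
  assumes "field_eq A \<omega> \<omega>'" shows "deRham_class A (Suc m) \<omega> = deRham_class A (Suc m) \<omega>'"
proof -
  have "exact_form A (Suc m) (\<lambda>c x X. \<eta> c x X - \<omega> c x X) \<longleftrightarrow>
      exact_form A (Suc m) (\<lambda>c x X. \<eta> c x X - \<omega>' c x X)" for \<eta>
    using assms by (simp add: exact_form_def field_eq_def)
  then show ?thesis by (simp add: deRham_class_def)
qed

section \<open>Foliations with a transverse vector field\<close>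

context
  fixes \<sigma> \<beta> :: "('p, 'n) form" and V :: "('p, 'n) vfield"
  assumes \<sigma>: "form_field A 1 \<sigma>" and \<beta>: "form_field A 1 \<beta>"
    and d\<sigma>: "field_eq A (ext_d 1 \<sigma>) (wedge 1 1 \<sigma> \<beta>)"
    and V: "vector_field A V"
    and nz: "\<And>c x. c \<in> A \<Longrightarrow> x \<in> img c \<Longrightarrow> ev1 \<sigma> c x (V c x) \<noteq> 0"
begin

lemma ev2_ext_d_foliation:
  assumes "c \<in> A" "x \<in> img c"
  shows "ev2 (ext_d 1 \<sigma>) c x Y Z = ev1 \<sigma> c x Y * ev1 \<beta> c x Z - ev1 \<sigma> c x Z * ev1 \<beta> c x Y"
  using d\<sigma> assms ev2_wedge_1_1[OF \<sigma> \<beta> assms] by (simp add: field_eq_def)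

text \<open>Apply d to d\<sigma> = \<sigma> \<and> \<beta>. The left side vanishes, and so does the
  Leibniz term \<beta> \<and> d\<sigma>, in which \<beta> is repeated.\<close>

lemma wedge_d_eq_0:
  assumes x: "c \<in> A" "x \<in> img c"
  shows "wedge 1 2 \<sigma> (ext_d 1 \<beta>) c x X = 0"
proof -
  have "0 = ext_d 2 (wedge 1 1 \<sigma> \<beta>) c x X"
    using ext_d_cong[OF d\<sigma>, of 2] ext_d_2_ext_d_1[OF \<sigma> x] x by (simp add: field_eq_def)
  also have "\<dots> = wedge 1 2 \<beta> (ext_d 1 \<sigma>) c x X - wedge 1 2 \<sigma> (ext_d 1 \<beta>) c x X"
    by (rule ext_d_2_wedge_1_1[OF \<sigma> \<beta> x])
  also have "wedge 1 2 \<beta> (ext_d 1 \<sigma>) c x X = 0"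
    unfolding wedge_1_2_eq[OF \<beta> form_field_ext_d_1[OF \<sigma>] x] ev2_ext_d_foliation[OF x] by (simp add: algebra_simps)
  finally show ?thesis by simp
qed

lemma wedge_d_eq_0_eval:
  assumes x: "c \<in> A" "x \<in> img c"
  shows "ev1 \<sigma> c x Y * ev2 (ext_d 1 \<beta>) c x Z W - ev1 \<sigma> c x Z * ev2 (ext_d 1 \<beta>) c x Y W
    + ev1 \<sigma> c x W * ev2 (ext_d 1 \<beta>) c x Y Z = 0"
  using wedge_d_eq_0[OF x, of "case_nat Y (case_nat Z (\<lambda>_. W))"]
  unfolding wedge_1_2_eq[OF \<sigma> form_field_ext_d_1[OF \<beta>] x] by (simp add: numeral_2_eq_2)

lemma GV_form_closed: "closed_form A 3 (wedge 1 2 \<beta> (ext_d 1 \<beta>))"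
  unfolding closed_form_def field_eq_def
proof (intro conjI ballI ext)
  show "form_field A 3 (wedge 1 2 \<beta> (ext_d 1 \<beta>))"
    by (rule form_field_wedge_1_2[OF \<beta> form_field_ext_d_1[OF \<beta>]])
  fix c x and X :: "nat \<Rightarrow> real ^ 'n" assume x: "c \<in> A" "x \<in> img c"
  define b where "b = ev2 (ext_d 1 \<beta>) c x"
  define s where "s = ev1 \<sigma> c x"
  define v where "v = V c x"
  \<comment> \<open>The identity \<sigma> \<and> d\<beta> = 0 with v in its first slot.\<close>
  have b: "s v * b Y Z = s Y * b v Z - s Z * b v Y" for Y Z
    using wedge_d_eq_0_eval[OF x, of v Y Z] by (simp add: b_def s_def algebra_simps)
  \<comment> \<open>the two-form \<open>d\<beta> = \<sigma> \<and> \<iota>\<^sub>v d\<beta> / \<sigma>(v)\<close> is decomposable\<close>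
  have "s v * s v * (b (X 0) (X 1) * b (X 2) (X 3) - b (X 0) (X 2) * b (X 1) (X 3)
      + b (X 0) (X 3) * b (X 1) (X 2)) =
      (s v * b (X 0) (X 1)) * (s v * b (X 2) (X 3)) - (s v * b (X 0) (X 2)) * (s v * b (X 1) (X 3))
      + (s v * b (X 0) (X 3)) * (s v * b (X 1) (X 2))" by (simp add: algebra_simps)
  also have "\<dots> = 0" unfolding b by (simp add: algebra_simps)
  finally have "b (X 0) (X 1) * b (X 2) (X 3) - b (X 0) (X 2) * b (X 1) (X 3)
      + b (X 0) (X 3) * b (X 1) (X 2) = 0"
    using nz[OF x] by (simp add: s_def v_def)
  then show "ext_d 3 (wedge 1 2 \<beta> (ext_d 1 \<beta>)) c x X = 0"
    unfolding ext_d_3_wedge_1_2[OF \<beta> \<beta> x] b_def by algebra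
qed

lemma GV_form_unique:
  assumes \<beta>': "form_field A 1 \<beta>'" and d\<sigma>': "field_eq A (ext_d 1 \<sigma>) (wedge 1 1 \<sigma> \<beta>')"
  shows "deRham_class A 3 (wedge 1 2 \<beta>' (ext_d 1 \<beta>')) = deRham_class A 3 (wedge 1 2 \<beta> (ext_d 1 \<beta>))"
proof -
  let ?\<delta> = "\<lambda>c x X. \<beta>' c x X - \<beta> c x X"
  have \<delta>: "form_field A 1 ?\<delta>" by (rule form_field_diff[OF \<beta>' \<beta>])
  define f where "f = (\<lambda>c x. ev1 ?\<delta> c x (V c x) / ev1 \<sigma> c x (V c x))"
  have f: "scalar_field A f"
    unfolding f_def by (rule scalar_field_divide[OF scalar_field_ev1[OF V \<delta>] scalar_field_ev1[OF V \<sigma>] nz])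
  have \<delta>_eq: "field_eq A ?\<delta> (scale_form f \<sigma>)"
    unfolding field_eq_def
  proof (intro ballI ext)
    fix c x and X :: "nat \<Rightarrow> real ^ 'n" assume x: "c \<in> A" "x \<in> img c"
    \<comment> \<open>The two expressions for d\<sigma> differ by \<sigma> \<and> (\<beta>' -
      \<beta>) = 0, here evaluated with V in one slot.\<close>
    have "ev1 \<sigma> c x (V c x) * ev1 ?\<delta> c x (X 0) = ev1 \<sigma> c x (X 0) * ev1 ?\<delta> c x (V c x)"
      using ev2_ext_d_foliation[OF x, of "V c x" "X 0"] d\<sigma>' x ev2_wedge_1_1[OF \<sigma> \<beta>' x, of "V c x" "X 0"]
      by (simp add: field_eq_def algebra_simps)
    then show "?\<delta> c x X = scale_form f \<sigma> c x X"
      unfolding scale_form_def f_def ev1_eval[OF \<sigma> x, of X] ev1_eval[OF \<beta> x, of X]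
        ev1_eval[OF \<beta>' x, of X]
      using nz[OF x] by (simp add: field_simps)
  qed
  have "wedge 1 2 \<beta>' (ext_d 1 \<beta>') c x X - wedge 1 2 \<beta> (ext_d 1 \<beta>) c x X =
      ext_d 2 (scale_form f (ext_d 1 \<sigma>)) c x X" if x: "c \<in> A" "x \<in> img c" for c x X
  proof -
    have 1: "ev1 \<beta>' c x Y = ev1 \<beta> c x Y + f c x * ev1 \<sigma> c x Y" for Y
      using \<delta>_eq x by (simp add: field_eq_def scale_form_def fun_eq_iff algebra_simps)
    have "ext_d 1 ?\<delta> c x = ext_d 1 (scale_form f \<sigma>) c x"
      using ext_d_cong[OF \<delta>_eq, of 1] x by (simp add: field_eq_def)
    moreover have "ev2 (ext_d 1 ?\<delta>) c x Y Z = ev2 (ext_d 1 \<beta>') c x Y Z - ev2 (ext_d 1 \<beta>) c x Y Z" for Y Z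
      using ext_d_diff[OF \<beta>' \<beta>] x by (simp add: field_eq_def)
    ultimately have 2: "ev2 (ext_d 1 \<beta>') c x Y Z = ev2 (ext_d 1 \<beta>) c x Y Z +
        (ev1 (ext_d 0 (zero_form f)) c x Y * ev1 \<sigma> c x Z - ev1 (ext_d 0 (zero_form f)) c x Z * ev1 \<sigma> c x Y
          + f c x * ev2 (ext_d 1 \<sigma>) c x Y Z)" for Y Z
      using ext_d_1_scale[OF f \<sigma> x, of Y Z] by simp
    \<comment> \<open>This removes the term f \<sigma> \<and> d\<beta>. The term \<beta> \<and> df
      \<and> \<sigma> is df \<and> d\<sigma>, and all others repeat a one-form.\<close>
    note 3 = wedge_d_eq_0_eval[OF x, of "X 0" "X 1" "X 2"]
    show ?thesis
      unfolding ext_d_2_scale[OF f form_field_ext_d_1[OF \<sigma>] x] ext_d_2_ext_d_1[OF \<sigma> x]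
        wedge_1_2_eq[OF \<beta>' form_field_ext_d_1[OF \<beta>'] x] wedge_1_2_eq[OF \<beta> form_field_ext_d_1[OF \<beta>] x]
        wedge_1_2_eq[OF form_field_ext_d_0[OF f] form_field_ext_d_1[OF \<sigma>] x] 1 2 ev2_ext_d_foliation[OF x]
      using 3 by algebra
  qed
  then have "exact_form A (Suc 2) (\<lambda>c x X. wedge 1 2 \<beta>' (ext_d 1 \<beta>') c x X - wedge 1 2 \<beta> (ext_d 1 \<beta>) c x X)"
    unfolding exact_form_def using form_field_scale[OF f form_field_ext_d_1[OF \<sigma>]]
    by (auto simp: field_eq_def intro!: exI[of _ "scale_form f (ext_d 1 \<sigma>)"])
  from deRham_class_eqI[OF this] show ?thesis by (simp add: numeral_3_eq_3 numeral_2_eq_2)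
qed

text \<open>\<open>GV\<close> is a definite description; the given \<beta> is a witness, and
  independence of the witness makes the description proper.\<close>

lemma GV_eq: "GV A \<sigma> = deRham_class A 3 (wedge 1 2 \<beta> (ext_d 1 \<beta>))"
  unfolding GV_def
proof (rule the_equality)
  show "\<exists>\<beta>'. form_field A 1 \<beta>' \<and> field_eq A (ext_d 1 \<sigma>) (wedge 1 1 \<sigma> \<beta>') \<and>
      deRham_class A 3 (wedge 1 2 \<beta> (ext_d 1 \<beta>)) = deRham_class A 3 (wedge 1 2 \<beta>' (ext_d 1 \<beta>'))"
    using \<beta> d\<sigma> by blast
  show "C = deRham_class A 3 (wedge 1 2 \<beta> (ext_d 1 \<beta>))"
    if "\<exists>\<beta>'. form_field A 1 \<beta>' \<and> field_eq A (ext_d 1 \<sigma>) (wedge 1 1 \<sigma> \<beta>') \<and>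
      C = deRham_class A 3 (wedge 1 2 \<beta>' (ext_d 1 \<beta>'))" for C
    using that GV_form_unique by blast
qed

end

text \<open>Since d df = 0, both forms have the same differential, and the difference df \<and>
  d\<beta> equals d(f d\<beta>).\<close>

lemma GV_form_gauge:
  assumes \<beta>: "form_field A 1 \<beta>" and f: "scalar_field A f"
  defines "\<beta>' \<equiv> \<lambda>c x X. \<beta> c x X - ext_d 0 (zero_form f) c x X"
  shows "deRham_class A 3 (wedge 1 2 \<beta> (ext_d 1 \<beta>)) = deRham_class A 3 (wedge 1 2 \<beta>' (ext_d 1 \<beta>'))"
proof -
  note df = form_field_ext_d_0[OF f]
  have \<beta>': "form_field A 1 \<beta>'" unfolding \<beta>'_def by (rule form_field_diff[OF \<beta> df])
  have "wedge 1 2 \<beta> (ext_d 1 \<beta>) c x X - wedge 1 2 \<beta>' (ext_d 1 \<beta>') c x X =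
      ext_d 2 (scale_form f (ext_d 1 \<beta>)) c x X" if x: "c \<in> A" "x \<in> img c" for c x X
  proof -
    have "ev2 (ext_d 1 \<beta>') c x Y Z = ev2 (ext_d 1 \<beta>) c x Y Z" for Y Z
      using ext_d_diff[OF \<beta> df] x ext_d_1_ext_d_0[OF f x] by (simp add: field_eq_def \<beta>'_def)
    then show ?thesis
      unfolding ext_d_2_scale[OF f form_field_ext_d_1[OF \<beta>] x] ext_d_2_ext_d_1[OF \<beta> x]
        wedge_1_2_eq[OF \<beta>' form_field_ext_d_1[OF \<beta>'] x] wedge_1_2_eq[OF \<beta> form_field_ext_d_1[OF \<beta>] x]
        wedge_1_2_eq[OF df form_field_ext_d_1[OF \<beta>] x]
      by (simp add: \<beta>'_def algebra_simps)
  qed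
  then have "exact_form A (Suc 2) (\<lambda>c x X. wedge 1 2 \<beta> (ext_d 1 \<beta>) c x X - wedge 1 2 \<beta>' (ext_d 1 \<beta>') c x X)"
    unfolding exact_form_def using form_field_scale[OF f form_field_ext_d_1[OF \<beta>]]
    by (auto simp: field_eq_def intro!: exI[of _ "scale_form f (ext_d 1 \<beta>)"])
  from deRham_class_eqI[OF this] show ?thesis by (simp add: numeral_3_eq_3 numeral_2_eq_2)
qed

end

section \<open>Functions of time and position\<close>

lemma fd_slice:
  fixes F :: "real \<times> 'a::euclidean_space \<Rightarrow> 'b::real_normed_vector"
  assumes S: "cornered S" and F: "smooth_on (T \<times> S) F" and tx: "t \<in> T" "x \<in> S"
  shows "((\<lambda>y. F (t, y)) has_derivative (\<lambda>h. fd (T \<times> S) F (t, x) (0, h))) (at x within S)"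
    and "fd S (\<lambda>y. F (t, y)) x h = fd (T \<times> S) F (t, x) (0, h)"
proof -
  have 1: "((\<lambda>y. (t, y)) has_derivative (\<lambda>h. (0, h))) (at x within S)"
    by (auto intro!: derivative_eq_intros)
  have 2: "(F has_derivative fd (T \<times> S) F (t, x)) (at (t, x) within (\<lambda>y. (t, y)) ` S)"
    by (rule has_derivative_subset[OF smooth_on_has_derivative[OF F]]) (use tx in auto)
  show D: "((\<lambda>y. F (t, y)) has_derivative (\<lambda>h. fd (T \<times> S) F (t, x) (0, h))) (at x within S)"
    using diff_chain_within[OF 1 2] by (simp add: o_def)
  show "fd S (\<lambda>y. F (t, y)) x h = fd (T \<times> S) F (t, x) (0, h)"
    by (simp add: fd_eqI[OF S tx(2) D])
qed

text \<open>Spatial derivatives of a slice are slices of joint derivatives in the directions (0, h),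
  so the induction runs over all jointly smooth F.\<close>

lemma smooth_on_slice:
  fixes F :: "real \<times> 'a::euclidean_space \<Rightarrow> 'b::real_normed_vector"
  assumes T: "open T" and S: "cornered S" and F: "smooth_on (T \<times> S) F" and t: "t \<in> T"
  shows "smooth_on S (\<lambda>y. F (t, y))"
proof -
  have "Ck_on k S (\<lambda>y. F (t, y))" for k
    using F
  proof (induction k arbitrary: F)
    case 0
    have "continuous_on ((\<lambda>y. (t, y)) ` S) F"
      by (rule continuous_on_subset[OF smooth_on_continuous_on[OF 0]]) (use t in auto)
    then have "continuous_on S (F \<circ> (\<lambda>y. (t, y)))"
      by (intro continuous_on_compose continuous_intros)
    then show ?case by (simp add: o_def)
  next
    case (Suc k)
    show ?case
      by (rule Ck_on_SucI[OF S fd_slice(1)[OF S Suc.prems t]], assumption)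
        (rule Suc.IH[OF smooth_on_fd[OF Suc.prems]])
  qed
  then show ?thesis by (simp add: smooth_on_def)
qed

lemma has_vector_derivative_time:
  fixes F :: "real \<times> 'a::euclidean_space \<Rightarrow> 'b::real_normed_vector"
  assumes T: "open T" and F: "smooth_on (T \<times> S) F" and tx: "t \<in> T" "x \<in> S"
  shows "((\<lambda>r. F (r, x)) has_vector_derivative fd (T \<times> S) F (t, x) (1, 0)) (at t)"
proof -
  have 1: "((\<lambda>r. (r, x)) has_derivative (\<lambda>h. (h, 0))) (at t within T)"
    by (auto intro!: derivative_eq_intros)
  have 2: "(F has_derivative fd (T \<times> S) F (t, x)) (at (t, x) within (\<lambda>r. (r, x)) ` T)"
    by (rule has_derivative_subset[OF smooth_on_has_derivative[OF F]]) (use tx in auto)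
  have D: "((\<lambda>r. F (r, x)) has_derivative (\<lambda>h. fd (T \<times> S) F (t, x) (h, 0))) (at t)"
    using diff_chain_within[OF 1 2] at_within_open[OF tx(1) T] by (simp add: o_def)
  have "linear (fd (T \<times> S) F (t, x))"
    using smooth_on_has_derivative[OF F, of "(t, x)"] tx has_derivative_linear by blast
  then have "fd (T \<times> S) F (t, x) (h, 0) = h *\<^sub>R fd (T \<times> S) F (t, x) (1, 0)" for h
    using linear_scale[of "fd (T \<times> S) F (t, x)" h "(1, 0)"] by simp
  then have "(\<lambda>h. fd (T \<times> S) F (t, x) (h, 0)) = (\<lambda>h. h *\<^sub>R fd (T \<times> S) F (t, x) (1, 0))" by blast
  with D show ?thesis unfolding has_vector_derivative_def by metis
qed

text \<open>Symmetry of second derivatives on the product of the time interval and the chart image,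
  in the directions (1, 0) and (0, h). The product is cornered, so boundary points of the chart are
  covered.\<close>

lemma time_fd_swap:
  fixes F :: "real \<times> 'a::euclidean_space \<Rightarrow> real ^ 'm"
  assumes T: "open T" and S: "cornered S" and F: "smooth_on (T \<times> S) F" and tx: "t \<in> T" "x \<in> S"
  shows "((\<lambda>r. fd S (\<lambda>y. F (r, y)) x h) has_vector_derivative
    fd S (\<lambda>y. vector_derivative (\<lambda>r. F (r, y)) (at t)) x h) (at t)"
proof -
  let ?D = "fd (T \<times> S)"
  have TS: "cornered (T \<times> S)" by (intro cornered_Times cornered_open T S)
  have "((\<lambda>r. ?D F (r, x) (0, h)) has_vector_derivative ?D (\<lambda>z. ?D F z (0, h)) (t, x) (1, 0)) (at t)"
    by (rule has_vector_derivative_time[OF T smooth_on_fd[OF F] tx])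
  moreover have "?D (\<lambda>z. ?D F z (0, h)) (t, x) (1, 0) = ?D (\<lambda>z. ?D F z (1, 0)) (t, x) (0, h)"
    by (rule fd_swap_vec[OF TS _ F]) (use tx in simp)
  moreover have "\<dots> = fd S (\<lambda>y. ?D F (t, y) (1, 0)) x h"
    by (rule fd_slice(2)[OF S smooth_on_fd[OF F] tx, symmetric])
  moreover have "\<dots> = fd S (\<lambda>y. vector_derivative (\<lambda>r. F (r, y)) (at t)) x h"
    by (rule fun_cong[OF fd_cong[OF tx(2)]])
      (rule vector_derivative_at[OF has_vector_derivative_time[OF T F tx(1)], symmetric])
  ultimately have "((\<lambda>r. ?D F (r, x) (0, h)) has_vector_derivative
      fd S (\<lambda>y. vector_derivative (\<lambda>r. F (r, y)) (at t)) x h) (at t)" by simp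
  then show ?thesis
    by (rule has_vector_derivative_transform_within_open[OF _ T tx(1)])
      (rule fd_slice(2)[OF S F _ tx(2), symmetric])
qed

section \<open>Metric and velocity\<close>

text \<open>Properness of the description in \<open>sharp\<close>: lowering an index is injective by
  positivity, hence surjective by dimension.\<close>

lemma sharp_eq:
  assumes B: "sym_bilin (g c x)" and pos: "\<And>X. X \<noteq> 0 \<Longrightarrow> 0 < g c x X X"
  shows "g c x (sharp g \<theta> c x) Y = \<theta> c x \<bullet> Y"
proof -
  have bil: "bilinear (g c x)" using B by (simp add: sym_bilin_def)
  note lin = bil[unfolded bilinear_def]
  define L where "L = (\<lambda>W. \<chi> i. g c x W (axis i 1))"
  have L: "L W \<bullet> Y = g c x W Y" for W Y
    using linear_eq_sum_axis[of "g c x W" Y] lin by (simp add: L_def inner_vec_def mult.commute)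
  have linL: "linear L"
    by (auto simp: linear_iff L_def vec_eq_iff bilinear_ladd[OF bil] bilinear_lmul[OF bil])
  have "inj L"
    unfolding linear_injective_0[OF linL]
  proof (intro allI impI)
    fix W assume "L W = 0"
    then have "g c x W W = 0" using L[of W W] by simp
    then show "W = 0" using pos[of W] by force
  qed
  then have "surj L" using linL linear_injective_imp_surjective by blast
  then obtain W where W: "L W = \<theta> c x" by (metis surjD)
  have "sharp g \<theta> c x = W"
    unfolding sharp_def
  proof (rule the_equality)
    show "\<forall>Y. g c x W Y = \<theta> c x \<bullet> Y" using L[of W] W by simp
    fix W' assume "\<forall>Y. g c x W' Y = \<theta> c x \<bullet> Y"
    then have "L W' \<bullet> Y = L W \<bullet> Y" for Y using L W by simp
    then have "L W' = L W" by (metis vector_eq_rdot)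
    then show "W' = W" using \<open>inj L\<close> by (simp add: inj_eq)
  qed
  then show ?thesis using L[of W Y] W by simp
qed

context oriented_manifold
begin

context
  fixes g :: "('p, 'n) bilin" and V :: "('p, 'n) vfield"
  assumes g: "riemannian_metric A g"
begin

lemma metric_bilinear: "c \<in> A \<Longrightarrow> x \<in> img c \<Longrightarrow> bilinear (g c x)"
  using g by (simp add: riemannian_metric_def sym_cov_field_def sym_bilin_def)

lemma metric_sym: "c \<in> A \<Longrightarrow> x \<in> img c \<Longrightarrow> g c x X Y = g c x Y X"
  using g by (simp add: riemannian_metric_def sym_cov_field_def sym_bilin_def)

lemma metric_pos: "c \<in> A \<Longrightarrow> x \<in> img c \<Longrightarrow> X \<noteq> 0 \<Longrightarrow> 0 < g c x X X"
  using g by (simp add: riemannian_metric_def)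

lemma metric_smooth: "c \<in> A \<Longrightarrow> smooth_on (img c) (\<lambda>x. g c x X Y)"
  using g by (simp add: riemannian_metric_def sym_cov_field_def smooth_field_def)

lemma metric_trans: "c \<in> A \<Longrightarrow> c' \<in> A \<Longrightarrow> x \<in> overlap c c' \<Longrightarrow>
    g c' (trans_map c c' x) (jac c c' x X) (jac c c' x Y) = g c x X Y"
  using g by (simp add: riemannian_metric_def sym_cov_field_def)

lemma metric_linear:
  assumes "c \<in> A" "x \<in> img c"
  shows "linear (g c x X)" "linear (\<lambda>X. g c x X Y)"
  using metric_bilinear[OF assms] by (simp_all add: bilinear_def)

lemma metric_smooth_left:
  assumes "c \<in> A" "smooth_on (img c) w"
  shows "smooth_on (img c) (\<lambda>x. g c x (w x) Y)"
  by (rule smooth_on_family[OF cornered_chart[OF assms(1)] metric_linear(2)[OF assms(1)]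
        metric_smooth[OF assms(1)] assms(2)])

lemma fd_metric_left:
  assumes "c \<in> A" "x \<in> img c" "smooth_on (img c) w"
  shows "fd (img c) (\<lambda>y. g c y (w y) Y) x h = fd (img c) (\<lambda>y. g c y (w x) Y) x h + g c x (fd (img c) w x h) Y"
  by (rule fd_family[OF cornered_chart[OF assms(1)] metric_linear(2)[OF assms(1)] assms(2)
        metric_smooth[OF assms(1)] assms(3)])

context
  assumes V: "vector_field A V"
begin

lemma form_field_flat: "form_field A 1 (flat g V)"
proof (rule form_field_1I[where L = "\<lambda>c x. g c x (V c x)"])
  show "flat g V c x X = g c x (V c x) (X 0)" for c x X by (simp add: flat_def)
  show "linear (g c x (V c x))" if "c \<in> A" "x \<in> img c" for c x by (rule metric_linear[OF that])
  show "smooth_on (img c) (\<lambda>x. g c x (V c x) Z)" if "c \<in> A" for c Z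
    by (rule metric_smooth_left[OF that vector_fieldD(1)[OF V that]])
  show "g c' (trans_map c c' x) (V c' (trans_map c c' x)) (jac c c' x Z) = g c x (V c x) Z"
    if "c \<in> A" "c' \<in> A" "x \<in> overlap c c'" for c c' x Z
    using vector_fieldD(2)[OF V that] metric_trans[OF that] by simp
qed

lemma speed_sq_eq: "speed_sq g V = (\<lambda>c x. ev1 (flat g V) c x (V c x))"
  by (simp add: speed_sq_def flat_def)

lemma scalar_field_speed_sq: "scalar_field A (speed_sq g V)"
  unfolding speed_sq_eq by (rule scalar_field_ev1[OF V form_field_flat])

lemma fd_speed_sq:
  assumes x: "c \<in> A" "x \<in> img c"
  shows "fd (img c) (speed_sq g V c) x h =
    fd (img c) (\<lambda>y. g c y (V c x) (V c x)) x h + 2 * g c x (fd (img c) (V c) x h) (V c x)"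
proof -
  note sm = vector_fieldD(1)[OF V x(1)]
  have "fd (img c) (speed_sq g V c) x h = fd (img c) (\<lambda>y. g c y (V c y) (V c x)) x h
      + g c x (V c x) (fd (img c) (V c) x h)"
    unfolding speed_sq_def
    by (rule fd_family[OF cornered_chart[OF x(1)] metric_linear(1)[OF x(1)] x(2)
          metric_smooth_left[OF x(1) sm] sm])
  then show ?thesis
    using fd_metric_left[OF x sm, of "V c x" h] metric_sym[OF x] by simp
qed

text \<open>In the form \<open>(\<nabla>\<^sub>v v)\<^sup>\<flat> = \<iota>\<^sub>v dv\<^sup>\<flat> + d(s\<^sub>v / 2)\<close>, this turns Euler's equation into one for \<open>v\<^sup>\<flat>\<close>.\<close>

lemma flat_cov_deriv:
  assumes \<Gamma>: "levi_civita A g \<Gamma>" and x: "c \<in> A" "x \<in> img c"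
  shows "g c x (cov_deriv \<Gamma> V V c x) Z =
    ev1 (int_prod V (ext_d 1 (flat g V))) c x Z + fd (img c) (speed_sq g V c) x Z / 2"
proof -
  note sm = vector_fieldD(1)[OF V x(1)]
  have lc: "fd (img c) (\<lambda>y. g c y X Y) x W = g c x (\<Gamma> c x W X) Y + g c x X (\<Gamma> c x W Y)"
    "\<Gamma> c x X Y = \<Gamma> c x Y X" for X Y W
    using \<Gamma> x by (auto simp: levi_civita_def chart_deriv_def)
  have "ev1 (int_prod V (ext_d 1 (flat g V))) c x Z = ev2 (ext_d 1 (flat g V)) c x (V c x) Z"
    by (simp add: int_prod_def)
  also have "\<dots> = fd (img c) (\<lambda>y. g c y (V c y) Z) x (V c x) - fd (img c) (\<lambda>y. g c y (V c y) (V c x)) x Z"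
    unfolding ev2_ext_d_1[OF form_field_flat x] by (simp add: flat_def)
  \<comment> \<open>The derivatives of V cancel against those in d(s/2) except for the one along V.
    What remains is g(\<Gamma>(v,v), Z) = (D_v g)(v,Z) - (D_Z g)(v,v)/2, which is compatibility with
    g plus symmetry of \<Gamma>.\<close>
  finally show ?thesis
    unfolding fd_speed_sq[OF x] fd_metric_left[OF x sm] lc(1) cov_deriv_def chart_deriv_def
      bilinear_ladd[OF metric_bilinear[OF x]]
    using metric_sym[OF x] lc(2)[of Z "V c x"] by (simp add: field_simps)
qed

end

end

lemma inner_covec:
  assumes f: "smooth_on (img c) (f c)" and x: "c \<in> A" "x \<in> img c"
  shows "covec (ext_d 0 (zero_form f)) c x \<bullet> Y = fd (img c) (f c) x Y"
  using linear_eq_sum_axis[OF linear_fd[OF cornered_chart[OF x(1)] x(2) f], of Y]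
  by (simp add: covec_def inner_vec_def ext_d_0 mult.commute)

end

lemma fd_ln:
  assumes "cornered S" "x \<in> S" "smooth_on S f" "f x > 0"
  shows "fd S (\<lambda>y. ln (f y)) x h = fd S f x h / (f x :: real)"
  using fd_eqI[OF assms(1,2) has_derivative_ln[OF assms(4) smooth_on_has_derivative[OF assms(3,2)]]]
  by (simp add: divide_inverse mult.commute)

lemma wedge_cong:
  "\<sigma> c x = \<sigma>' c x \<Longrightarrow> \<beta> c x = \<beta>' c x \<Longrightarrow> wedge k l \<sigma> \<beta> c x = wedge k l \<sigma>' \<beta>' c x"
  by (simp add: wedge_def)

lemma wedge_minus_right: "wedge k l \<sigma> (\<lambda>c x X. - \<beta> c x X) c x X = - wedge k l \<sigma> \<beta> c x X"
  by (simp add: wedge_def sum_negf)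

section \<open>The foliation of an Aristotelian fluid\<close>

context oriented_manifold
begin

context
  fixes g :: "('p, 'n) bilin" and V :: "('p, 'n) vfield" and \<tau> :: "('p, 'n) form"
  assumes g: "riemannian_metric A g" and V: "vector_field A V" and \<tau>: "form_field A 1 \<tau>"
    and \<tau>V: "\<And>c x. c \<in> A \<Longrightarrow> x \<in> img c \<Longrightarrow> ev1 \<tau> c x (V c x) = 1"
    and integrable: "field_eq A (wedge 1 2 \<tau> (ext_d 1 \<tau>)) (\<lambda>c x X. 0)"
    and orth: "\<And>c x X. c \<in> A \<Longrightarrow> x \<in> img c \<Longrightarrow> ev1 \<tau> c x X = 0 \<Longrightarrow> g c x X (V c x) = 0"
begin

private abbreviation "u \<equiv> flat g V"
private abbreviation "s \<equiv> speed_sq g V"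
private abbreviation "\<alpha> \<equiv> alpha_form g V \<tau>"

lemmas form_field_u = form_field_flat[OF g V]
  and scalar_field_s = scalar_field_speed_sq[OF g V]

lemma speed_pos:
  assumes "c \<in> A" "x \<in> img c" shows "s c x > 0"
proof -
  have "V c x \<noteq> 0" using \<tau>V[OF assms] linear_0[OF ev1_linear[OF \<tau> assms]] by auto
  then show ?thesis by (simp add: speed_sq_def metric_pos[OF g assms])
qed

lemma ev1_flat:
  assumes x: "c \<in> A" "x \<in> img c" shows "ev1 u c x Z = s c x * ev1 \<tau> c x Z"
proof -
  note lin = ev1_linear[OF \<tau> x] and bil = metric_bilinear[OF g x]
  have "ev1 \<tau> c x (Z - ev1 \<tau> c x Z *\<^sub>R V c x) = 0"
    by (simp add: linear_diff[OF lin] linear_scale[OF lin] \<tau>V[OF x])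
  from orth[OF x this] show ?thesis
    by (simp add: flat_def speed_sq_def bilinear_lsub[OF bil] bilinear_lmul[OF bil]
        metric_sym[OF g x, of "V c x" Z])
qed

text \<open>Cartan's formula; the term d(\<tau>(v)) vanishes because \<tau>(v) = 1.\<close>

lemma lie_clock_form:
  assumes x: "c \<in> A" "x \<in> img c"
  shows "lie_form 1 V \<tau> c x = int_prod V (ext_d 1 \<tau>) c x"
proof
  fix X :: "nat \<Rightarrow> real ^ 'n"
  note sm = vector_fieldD(1)[OF V x(1)] and S = cornered_chart[OF x(1)]
  have "0 = fd (img c) (\<lambda>y. ev1 \<tau> c y (V c y)) x (X 0)"
    using fd_cong[OF x(2), of "\<lambda>y. ev1 \<tau> c y (V c y)" "\<lambda>_. 1"] \<tau>V[OF x(1)] fd_const[OF S x(2)] by simp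
  also have "\<dots> = fd (img c) (\<lambda>y. ev1 \<tau> c y (V c x)) x (X 0) + ev1 \<tau> c x (fd (img c) (V c) x (X 0))"
    by (rule fd_family[OF S ev1_linear[OF \<tau> x(1)] x(2) form_fieldD(2)[OF \<tau> x(1)] sm])
  finally have "ev1 \<tau> c x (fd (img c) (V c) x (X 0)) = - fd (img c) (\<lambda>y. ev1 \<tau> c y (V c x)) x (X 0)"
    by simp
  moreover have "fd (img c) (\<lambda>y. \<tau> c y X) x = fd (img c) (\<lambda>y. ev1 \<tau> c y (X 0)) x"
    by (rule fd_cong[OF x(2)]) (rule ev1_eval[OF \<tau> x(1)])
  moreover have "\<tau> c x (X(0 := z)) = ev1 \<tau> c x z" for z
    using ev1_eval[OF \<tau> x, of "X(0 := z)"] by simp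
  moreover have "int_prod V (ext_d 1 \<tau>) c x X =
      fd (img c) (\<lambda>y. ev1 \<tau> c y (X 0)) x (V c x) - fd (img c) (\<lambda>y. ev1 \<tau> c y (V c x)) x (X 0)"
    unfolding int_prod_def ext_d_1[OF \<tau> x] by simp
  ultimately show "lie_form 1 V \<tau> c x X = int_prod V (ext_d 1 \<tau>) c x X"
    by (simp add: lie_form_def chart_deriv_def)
qed

text \<open>The transformation law is inherited from the contraction \<iota>_v d\<tau>, so that of
  the coordinate expression \<open>lie_form\<close> need not be computed.\<close>

lemma form_field_lie: "form_field A 1 (lie_form 1 V \<tau>)"
  using form_field_cong[of "lie_form 1 V \<tau>" "int_prod V (ext_d 1 \<tau>)"] lie_clock_form
    form_field_int_prod[OF V form_field_ext_d_1[OF \<tau>]] by (simp add: field_eq_def)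

lemma ev1_lie:
  assumes x: "c \<in> A" "x \<in> img c"
  shows "ev1 (lie_form 1 V \<tau>) c x Z = ev2 (ext_d 1 \<tau>) c x (V c x) Z"
  by (simp only: lie_clock_form[OF x]) (simp add: int_prod_def)

lemma d_clock_form: "field_eq A (ext_d 1 \<tau>) (wedge 1 1 \<tau> (lie_form 1 V \<tau>))"
  unfolding field_eq_def
proof (intro ballI ext)
  fix c x and X :: "nat \<Rightarrow> real ^ 'n" assume x: "c \<in> A" "x \<in> img c"
  note d\<tau> = form_field_ext_d_1[OF \<tau>]
  have "wedge 1 2 \<tau> (ext_d 1 \<tau>) c x (case_nat (V c x) X) = 0"
    using integrable x by (simp add: field_eq_def)
  then show "ext_d 1 \<tau> c x X = wedge 1 1 \<tau> (lie_form 1 V \<tau>) c x X"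
    unfolding wedge_1_2_eq[OF \<tau> d\<tau> x] wedge_1_1_eq[OF \<tau> form_field_lie x] ev1_lie[OF x]
      alt_map_2_eval[OF form_fieldD(1)[OF d\<tau> x], of X]
    using \<tau>V[OF x] by (simp add: numeral_2_eq_2 algebra_simps)
qed

lemma alpha_form_eq:
  "\<alpha> = (\<lambda>c x X. lie_form 1 V \<tau> c x X - ext_d 0 (zero_form (\<lambda>c x. ln (s c x))) c x X)"
  by (simp add: alpha_form_def fun_eq_iff)

lemma scalar_field_ln_s: "scalar_field A (\<lambda>c x. ln (s c x))"
  by (rule scalar_field_ln[OF scalar_field_s speed_pos])

lemma form_field_alpha: "form_field A 1 \<alpha>"
  unfolding alpha_form_eq by (rule form_field_diff[OF form_field_lie form_field_ext_d_0[OF scalar_field_ln_s]])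

lemma ev1_alpha:
  assumes x: "c \<in> A" "x \<in> img c"
  shows "ev1 \<alpha> c x Z = ev1 (lie_form 1 V \<tau>) c x Z - fd (img c) (s c) x Z / s c x"
  unfolding alpha_form_eq ext_d_0
  by (simp add: fd_ln[OF cornered_chart[OF x(1)] x(2) scalar_fieldD(1)[OF scalar_field_s x(1)] speed_pos[OF x]])

lemma ev2_ext_d_clock:
  assumes x: "c \<in> A" "x \<in> img c"
  shows "ev2 (ext_d 1 \<tau>) c x Y Z =
    ev1 \<tau> c x Y * ev1 (lie_form 1 V \<tau>) c x Z - ev1 \<tau> c x Z * ev1 (lie_form 1 V \<tau>) c x Y"
  using d_clock_form x ev2_wedge_1_1[OF \<tau> form_field_lie x] by (simp add: field_eq_def)

text \<open>From u = s \<tau> follows du = ds \<and> \<tau> + s \<tau> \<and> L_v \<tau> = u \<and>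
  (L_v \<tau> - ds/s): the logarithmic term of \<alpha> absorbs the change of the defining
  form.\<close>

lemma d_flat: "field_eq A (ext_d 1 u) (wedge 1 1 u \<alpha>)"
  unfolding field_eq_def
proof (intro ballI ext)
  fix c x and X :: "nat \<Rightarrow> real ^ 'n" assume x: "c \<in> A" "x \<in> img c"
  have "field_eq A u (scale_form s \<tau>)"
    unfolding field_eq_def
  proof (intro ballI ext)
    fix c x and X :: "nat \<Rightarrow> real ^ 'n" assume x: "c \<in> A" "x \<in> img c"
    show "u c x X = scale_form s \<tau> c x X"
      unfolding scale_form_def ev1_eval[OF form_field_u x, of X] ev1_eval[OF \<tau> x, of X]
      by (rule ev1_flat[OF x])
  qed
  then have "ext_d 1 u c x = ext_d 1 (scale_form s \<tau>) c x"
    using ext_d_cong[of u "scale_form s \<tau>" 1] x by (simp add: field_eq_def)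
  then have "ext_d 1 u c x X = ev2 (ext_d 1 (scale_form s \<tau>)) c x (X 0) (X 1)"
    using alt_map_2_eval[OF form_fieldD(1)[OF form_field_ext_d_1[OF form_field_u] x]] by simp
  also have "\<dots> = fd (img c) (s c) x (X 0) * ev1 \<tau> c x (X 1) - fd (img c) (s c) x (X 1) * ev1 \<tau> c x (X 0)
      + s c x * ev2 (ext_d 1 \<tau>) c x (X 0) (X 1)"
    unfolding ext_d_1_scale[OF scalar_field_s \<tau> x] ext_d_0 ..
  finally have 1: "ext_d 1 u c x X = fd (img c) (s c) x (X 0) * ev1 \<tau> c x (X 1)
      - fd (img c) (s c) x (X 1) * ev1 \<tau> c x (X 0) + s c x * ev2 (ext_d 1 \<tau>) c x (X 0) (X 1)" .
  show "ext_d 1 u c x X = wedge 1 1 u \<alpha> c x X"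
    unfolding 1 wedge_1_1_eq[OF form_field_u form_field_alpha x] ev1_flat[OF x] ev1_alpha[OF x] ev2_ext_d_clock[OF x]
    using speed_pos[OF x] by (simp add: field_simps)
qed

lemma ev1_flat_nonzero: "c \<in> A \<Longrightarrow> x \<in> img c \<Longrightarrow> ev1 u c x (V c x) \<noteq> 0"
  using ev1_flat \<tau>V speed_pos by (metis less_irrefl mult.right_neutral)

lemmas GV_flat = GV_eq[OF form_field_u form_field_alpha d_flat V ev1_flat_nonzero]
  and alpha_d_alpha_closed = GV_form_closed[OF form_field_u form_field_alpha d_flat V ev1_flat_nonzero]

lemma GV_clock_form: "GV A \<tau> = deRham_class A 3 (wedge 1 2 \<alpha> (ext_d 1 \<alpha>))"
proof -
  have "ev1 \<tau> c x (V c x) \<noteq> 0" if "c \<in> A" "x \<in> img c" for c x using \<tau>V[OF that] by simp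
  from GV_eq[OF \<tau> form_field_lie d_clock_form V this] show ?thesis
    unfolding alpha_form_eq using GV_form_gauge[OF form_field_lie scalar_field_ln_s] by simp
qed

lemma scalar_field_lie: "scalar_field A f \<Longrightarrow> scalar_field A (lie_scalar V f)"
  using scalar_field_ev1[OF V form_field_ext_d_0[of f]]
  by (simp add: ext_d_0 lie_scalar_def chart_deriv_def)

text \<open>With \<open>\<eta> = \<iota>\<^sub>v \<omega> = s \<alpha> - \<alpha>(v) u\<close>, the three-form \<open>\<eta> \<and> d\<eta>\<close> is expanded using \<open>\<omega> = u \<and> \<alpha>\<close>
  and \<open>u \<and> d\<alpha> = 0\<close>; here \<open>\<alpha>(v) = - s f\<close> for \<open>f = \<pounds>\<^sub>v s / s\<^sup>2\<close>.\<close>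

lemma alpha_wedge_d_alpha:
  assumes x: "c \<in> A" "x \<in> img c"
  defines "\<eta> \<equiv> int_prod V (ext_d 1 u)"
  defines "f \<equiv> \<lambda>c x. lie_scalar V s c x / (s c x)\<^sup>2"
  shows "wedge 1 2 \<alpha> (ext_d 1 \<alpha>) c x X =
    - ext_d 2 (scale_form f (ext_d 1 u)) c x X + 1 / (s c x)\<^sup>2 * wedge 1 2 \<eta> (ext_d 1 \<eta>) c x X"
proof -
  note u = form_field_u and \<alpha> = form_field_alpha and s = scalar_field_s
  note du = form_field_ext_d_1[OF u] and d\<alpha> = form_field_ext_d_1[OF \<alpha>]
  have \<eta>: "form_field A 1 \<eta>" unfolding \<eta>_def by (rule form_field_int_prod[OF V du])
  have f: "scalar_field A f"
    unfolding f_def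
    by (rule scalar_field_divide[OF scalar_field_lie[OF s] scalar_field_power[OF s]])
      (use speed_pos in fastforce)
  define k where "k = (\<lambda>c x. ev1 \<alpha> c x (V c x))"
  have k: "scalar_field A k" unfolding k_def by (rule scalar_field_ev1[OF V \<alpha>])
  \<comment> \<open>(L_v \<tau>)(v) = d\<tau>(v, v) = 0, so only the logarithmic term of \<alpha>
    contributes.\<close>
  have k_eq: "k c x = - (s c x * f c x)" if x: "c \<in> A" "x \<in> img c" for c x
    unfolding k_def f_def ev1_alpha[OF x] ev1_lie[OF x]
    using alt_map_2_self[OF form_fieldD(1)[OF form_field_ext_d_1[OF \<tau>] x]] speed_pos[OF x]
    by (simp add: lie_scalar_def chart_deriv_def power2_eq_square)
  have du_eq: "ev2 (ext_d 1 u) c x Y Z = ev1 u c x Y * ev1 \<alpha> c x Z - ev1 u c x Z * ev1 \<alpha> c x Y"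
    if x: "c \<in> A" "x \<in> img c" for c x Y Z
    using d_flat x ev2_wedge_1_1[OF u \<alpha> x] by (simp add: field_eq_def)
  have \<eta>_eq: "field_eq A \<eta> (\<lambda>c x X. scale_form s \<alpha> c x X - scale_form k u c x X)"
    unfolding field_eq_def
  proof (intro ballI ext)
    fix c x and X :: "nat \<Rightarrow> real ^ 'n" assume x: "c \<in> A" "x \<in> img c"
    have "\<eta> c x X = ev2 (ext_d 1 u) c x (V c x) (X 0)"
      using ev1_eval[OF \<eta> x, of X] by (simp add: \<eta>_def int_prod_def)
    then show "\<eta> c x X = scale_form s \<alpha> c x X - scale_form k u c x X"
      using ev1_eval[OF \<alpha> x, of X] ev1_eval[OF u x, of X] \<tau>V[OF x]
      by (simp add: scale_form_def k_def du_eq[OF x] ev1_flat[OF x] del: One_nat_def)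
  qed
  let ?ds = "fd (img c) (s c) x" and ?df = "fd (img c) (f c) x"
  have dk: "fd (img c) (k c) x Z = - (s c x * ?df Z + ?ds Z * f c x)" for Z
  proof -
    note S = cornered_chart[OF x(1)]
    have "fd (img c) (k c) x = fd (img c) (\<lambda>y. - (s c y * f c y)) x"
      by (rule fd_cong[OF x(2)]) (rule k_eq[OF x(1)])
    then show ?thesis
      using scalar_fieldD(1)[OF s x(1)] scalar_fieldD(1)[OF f x(1)]
      by (simp add: fd_minus[OF S x(2)] fd_mult[OF S x(2)] smooth_on_mult[OF S])
  qed
  have 1: "ev1 \<eta> c x Z = s c x * ev1 \<alpha> c x Z + s c x * f c x * ev1 u c x Z" for Z
    using \<eta>_eq x k_eq[OF x] by (simp add: field_eq_def scale_form_def)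
  have "ev2 (ext_d 1 \<eta>) c x Y Z = ev2 (ext_d 1 (scale_form s \<alpha>)) c x Y Z - ev2 (ext_d 1 (scale_form k u)) c x Y Z"
    for Y Z
    using ext_d_cong[OF \<eta>_eq, of 1] ext_d_diff[OF form_field_scale[OF s \<alpha>] form_field_scale[OF k u]] x
    by (simp add: field_eq_def)
  then have 2: "ev2 (ext_d 1 \<eta>) c x Y Z =
      ?ds Y * ev1 \<alpha> c x Z - ?ds Z * ev1 \<alpha> c x Y + s c x * ev2 (ext_d 1 \<alpha>) c x Y Z
      - ((- (s c x * ?df Y + ?ds Y * f c x)) * ev1 u c x Z - (- (s c x * ?df Z + ?ds Z * f c x)) * ev1 u c x Y
        + (- (s c x * f c x)) * ev2 (ext_d 1 u) c x Y Z)" for Y Z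
    unfolding ext_d_1_scale[OF s \<alpha> x] ext_d_1_scale[OF k u x] ext_d_0 dk k_eq[OF x] by simp
  have 3: "ev1 u c x (X 0) * ev2 (ext_d 1 \<alpha>) c x (X 1) (X 2) - ev1 u c x (X 1) * ev2 (ext_d 1 \<alpha>) c x (X 0) (X 2)
      + ev1 u c x (X 2) * ev2 (ext_d 1 \<alpha>) c x (X 0) (X 1) = 0"
    by (rule wedge_d_eq_0_eval[OF u \<alpha> d_flat V ev1_flat_nonzero x])
  \<comment> \<open>The two terms s f u \<and> ds \<and> \<alpha> and s f \<alpha> \<and> ds \<and>
    u cancel, and s^2 \<alpha> \<and> df \<and> u is s^2 df \<and> du.\<close>
  have "wedge 1 2 \<eta> (ext_d 1 \<eta>) c x X =
      (s c x)\<^sup>2 * (wedge 1 2 \<alpha> (ext_d 1 \<alpha>) c x X + wedge 1 2 (ext_d 0 (zero_form f)) (ext_d 1 u) c x X)"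
    unfolding wedge_1_2_eq[OF \<eta> form_field_ext_d_1[OF \<eta>] x] wedge_1_2_eq[OF \<alpha> d\<alpha> x]
      wedge_1_2_eq[OF form_field_ext_d_0[OF f] du x] ext_d_0 1 2 du_eq[OF x]
    using 3 by algebra
  \<comment> \<open>As d du = 0, the form df \<and> du is the differential of f du.\<close>
  then show ?thesis
    unfolding ext_d_2_scale[OF f du x] ext_d_2_ext_d_1[OF u x]
    using speed_pos[OF x] by simp
qed

end

section \<open>The vorticity equation\<close>

text \<open>The metric is independent of time, so the time derivative falls on v alone and only has
  to be exchanged with its spatial derivative.\<close>

lemma time_deriv_d_flat:
  assumes g: "riemannian_metric A g" and I: "open I" and v: "smooth_family A I v"
    and vt: "\<And>t. t \<in> I \<Longrightarrow> vector_field A (v t)" and t: "t \<in> I" and x: "c \<in> A" "x \<in> img c"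
  shows "((\<lambda>r. ext_d 1 (flat g (v r)) c x X) has_vector_derivative
    ext_d 1 (flat g (\<lambda>c x. vector_derivative (\<lambda>r. v r c x) (at t))) c x X) (at t)"
proof -
  define w where "w = (\<lambda>c x. vector_derivative (\<lambda>r. v r c x) (at t))"
  define F where "F = (\<lambda>(r, y). v r c y)"
  note S = cornered_chart[OF x(1)]
  have F: "smooth_on (I \<times> img c) F" using v x(1) by (simp add: smooth_family_def F_def)
  have w_eq: "w c y = fd (I \<times> img c) F (t, y) (1, 0)" if "y \<in> img c" for y
    using vector_derivative_at[OF has_vector_derivative_time[OF I F t that]] by (simp add: w_def F_def)
  have "smooth_on (img c) (\<lambda>y. fd (I \<times> img c) F (t, y) (1, 0))"
    by (rule smooth_on_slice[OF I S smooth_on_fd[OF F] t])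
  then have w: "smooth_on (img c) (w c)" by (rule iffD1[OF smooth_on_cong, rotated]) (rule w_eq[symmetric])
  have dv: "((\<lambda>r. v r c x) has_vector_derivative w c x) (at t)"
    using has_vector_derivative_time[OF I F t x(2)] w_eq[OF x(2)] by (simp add: F_def)
  have ddv: "((\<lambda>r. fd (img c) (v r c) x h) has_vector_derivative fd (img c) (w c) x h) (at t)" for h
    using time_fd_swap[OF I S F t x(2), of h] by (simp add: F_def w_def)
  \<comment> \<open>After the product rule, v enters only through its value and its spatial
    derivative at x, each under a fixed linear map; these maps are bounded in finite
    dimension.\<close>
  have bl: "bounded_linear (\<lambda>W. fd (img c) (\<lambda>y. g c y W Z) x h)" "bounded_linear (\<lambda>W. g c x W Z)" for Z h
    using linear_fd_family[OF S x(2) metric_linear(2)[OF g x(1)] metric_smooth[OF g x(1)]]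
      metric_linear(2)[OF g x] by (simp_all add: linear_conv_bounded_linear)
  have D: "((\<lambda>r. fd (img c) (\<lambda>y. g c y (v r c y) Z) x h) has_vector_derivative
      fd (img c) (\<lambda>y. g c y (w c y) Z) x h) (at t)" for Z h
  proof (rule has_vector_derivative_transform_within_open[OF _ I t])
    show "((\<lambda>r. fd (img c) (\<lambda>y. g c y (v r c x) Z) x h + g c x (fd (img c) (v r c) x h) Z)
        has_vector_derivative fd (img c) (\<lambda>y. g c y (w c y) Z) x h) (at t)"
      unfolding fd_metric_left[OF g x w]
      by (intro has_vector_derivative_add bounded_linear.has_vector_derivative[OF bl(1) dv]
          bounded_linear.has_vector_derivative[OF bl(2) ddv])
    show "fd (img c) (\<lambda>y. g c y (v r c x) Z) x h + g c x (fd (img c) (v r c) x h) Z =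
        fd (img c) (\<lambda>y. g c y (v r c y) Z) x h" if "r \<in> I" for r
      by (rule fd_metric_left[OF g x vector_fieldD(1)[OF vt[OF that] x(1)], symmetric])
  qed
  show ?thesis
    unfolding w_def[symmetric] ext_d_def chart_deriv_def flat_def
    by (simp, intro has_vector_derivative_diff D)
qed

text \<open>The contraction is a finite sum, linear in \<xi>, with coefficients from the
  time-independent \<mu>.\<close>

lemma time_deriv_contract:
  assumes I: "open I" and \<xi>: "\<And>\<Theta>. smooth_family A I (\<lambda>t c x. \<xi> t c x \<Theta>)"
    and t: "t \<in> I" and x: "c \<in> A" "x \<in> img c"
  shows "((\<lambda>r. contract k (\<xi> r) \<mu> c x X) has_vector_derivative
    contract k (time_deriv_multivec \<xi> t) \<mu> c x X) (at t)"
proof -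
  have D: "((\<lambda>r. \<xi> r c x \<Theta>) has_vector_derivative time_deriv_multivec \<xi> t c x \<Theta>) (at t)" for \<Theta>
  proof -
    have "smooth_on (I \<times> img c) (\<lambda>(r, y). \<xi> r c y \<Theta>)"
      using \<xi>[of \<Theta>] x(1) by (simp add: smooth_family_def)
    from has_vector_derivative_time[OF I this t x(2)] show ?thesis
      unfolding time_deriv_multivec_def by (simp add: vector_derivative_at)
  qed
  show ?thesis
    unfolding contract_def
    by (intro has_vector_derivative_divide has_vector_derivative_sum has_vector_derivative_mult_left D)
qed

text \<open>Euler's equation reads \<open>\<partial>\<^sub>t v\<^sup>\<flat> = - \<iota>\<^sub>v dv\<^sup>\<flat> - d(p + s\<^sub>v / 2)\<close>, whose exterior derivative is taken.\<close>

lemma vorticity_equation: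
  assumes fluid: "ideal_fluid A I g \<Gamma> \<mu> v p" and \<xi>: "is_vorticity A I g \<mu> v \<xi>"
    and t: "t \<in> I" and x: "c \<in> A" "x \<in> img c"
  shows "contract (CARD('n) - 2) (time_deriv_multivec \<xi> t) \<mu> c x X =
    - ext_d 1 (int_prod (v t) (ext_d 1 (flat g (v t)))) c x X"
proof -
  let ?k = "CARD('n) - 2" and ?u = "flat g (v t)"
  define w where "w = (\<lambda>c x. vector_derivative (\<lambda>r. v r c x) (at t))"
  have I: "open I" and g: "riemannian_metric A g" and \<Gamma>: "levi_civita A g \<Gamma>"
    and v: "smooth_family A I v" and vt: "\<And>t. t \<in> I \<Longrightarrow> vector_field A (v t)" and p: "scalar_field A (p t)"
    and euler: "\<And>c x. c \<in> A \<Longrightarrow> x \<in> img c \<Longrightarrow> w c x + cov_deriv \<Gamma> (v t) (v t) c x =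
      - sharp g (covec (ext_d 0 (zero_form (p t)))) c x"
    using fluid t by (auto simp: ideal_fluid_def field_eq_def w_def)
  have u: "form_field A 1 ?u" by (rule form_field_flat[OF g vt[OF t]])
  define \<eta> where "\<eta> = int_prod (v t) (ext_d 1 ?u)"
  have \<eta>: "form_field A 1 \<eta>" unfolding \<eta>_def by (rule form_field_int_prod[OF vt[OF t] form_field_ext_d_1[OF u]])
  define q where "q = (\<lambda>c x. - p t c x - speed_sq g (v t) c x / 2)"
  have s: "scalar_field A (speed_sq g (v t))" by (rule scalar_field_speed_sq[OF g vt[OF t]])
  have half: "smooth_on (img c) (\<lambda>x. speed_sq g (v t) c x / 2)" if "c \<in> A" for c
    using smooth_on_bounded_linear[OF cornered_chart[OF that] bounded_linear_divide scalar_fieldD(1)[OF s that]] .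
  have q: "scalar_field A q"
    using scalar_fieldD[OF p] scalar_fieldD[OF s] half
    by (auto simp: scalar_field_def smooth_field_def q_def
        intro!: smooth_on_diff smooth_on_minus cornered_chart)
  have dq: "fd (img c) (q c) x Z = - fd (img c) (p t c) x Z - fd (img c) (speed_sq g (v t) c) x Z / 2"
    if x: "c \<in> A" "x \<in> img c" for c x Z
  proof -
    note S = cornered_chart[OF x(1)]
    show ?thesis
      unfolding q_def
      by (simp add: fd_diff[OF S x(2)] fd_minus[OF S x(2)] smooth_on_minus[OF S]
          scalar_fieldD(1)[OF p x(1)] half[OF x(1)]
          fd_bounded_linear[OF S x(2) bounded_linear_divide scalar_fieldD(1)[OF s x(1)]])
  qed
  \<comment> \<open>Besides lowering the index in Euler's equation, this identifies
    \<open>flat g w\<close> on chart images with a difference of two one-forms, to which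
    \<open>ext_d_diff\<close> applies.\<close>
  have w_eq: "field_eq A (flat g w) (\<lambda>c x X. ext_d 0 (zero_form q) c x X - \<eta> c x X)"
    unfolding field_eq_def
  proof (intro ballI ext)
    fix c x and X :: "nat \<Rightarrow> real ^ 'n" assume x: "c \<in> A" "x \<in> img c"
    note bil = metric_bilinear[OF g x]
    have "sym_bilin (g c x)" using g x by (simp add: riemannian_metric_def sym_cov_field_def)
    then have "g c x (w c x + cov_deriv \<Gamma> (v t) (v t) c x) (X 0) = - fd (img c) (p t c) x (X 0)"
      using sharp_eq[of g c x "covec (ext_d 0 (zero_form (p t)))" "X 0"] metric_pos[OF g x]
        inner_covec[where f = "p t", OF scalar_fieldD(1)[OF p x(1)] x]
      by (simp add: euler[OF x] bilinear_lneg[OF bil])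
    then show "flat g w c x X = ext_d 0 (zero_form q) c x X - \<eta> c x X"
      using flat_cov_deriv[OF g vt[OF t] \<Gamma> x, of "X 0"] ev1_eval[OF \<eta> x, of X]
      by (simp add: flat_def ext_d_0 dq[OF x] bilinear_ladd[OF bil] \<eta>_def)
  qed
  have "ext_d 1 (flat g w) c x X = - ext_d 1 \<eta> c x X"
    using ext_d_cong[OF w_eq, of 1] ext_d_diff[OF form_field_ext_d_0[OF q] \<eta>] x ext_d_1_ext_d_0[OF q x]
    by (simp add: field_eq_def)
  moreover have "((\<lambda>r. ext_d 1 (flat g (v r)) c x X) has_vector_derivative
      contract ?k (time_deriv_multivec \<xi> t) \<mu> c x X) (at t)"
  \<comment> \<open>The defining equation of the vorticity holds at all times in the open interval,
    so both sides are the same function of time near t and have the same derivative.\<close>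
  proof (rule has_vector_derivative_transform_within_open[OF _ I t])
    show "((\<lambda>r. contract ?k (\<xi> r) \<mu> c x X) has_vector_derivative
        contract ?k (time_deriv_multivec \<xi> t) \<mu> c x X) (at t)"
      by (rule time_deriv_contract[OF I _ t x]) (use \<xi> in \<open>simp add: is_vorticity_def\<close>)
    show "contract ?k (\<xi> r) \<mu> c x X = ext_d 1 (flat g (v r)) c x X" if "r \<in> I" for r
      using \<xi> that x by (simp add: is_vorticity_def field_eq_def)
  qed
  moreover have "((\<lambda>r. ext_d 1 (flat g (v r)) c x X) has_vector_derivative ext_d 1 (flat g w) c x X) (at t)"
    unfolding w_def by (rule time_deriv_d_flat[OF g I v vt t x])
  ultimately show ?thesis using vector_derivative_unique_at by (simp add: \<eta>_def)
qed

end

text \<open>The shape of the formula comes from \<eta> \<and> d\<eta> = s^2 (\<alpha> \<and>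
  d\<alpha> + d(f \<omega>)) with f = L_v s / s^2. The weight 1/s^2 is thus inside the differential;
  taking it out would leave a term in (L_v s) ds \<and> \<omega>. The minus sign before the last
  term comes from d_t \<omega> = - d\<eta>. The obstruction is expressed by the last clause: for
  speed constant along fluid lines, steady vorticity forces the zero class.\<close>

theorem proposition4p61:
  fixes A :: "('p::{t2_space, second_countable_topology}, 'n::finite) chart set"
    and I :: "real set"
    and g :: "('p, 'n) bilin"
    and \<Gamma> :: "('p, 'n, real ^ 'n \<Rightarrow> real ^ 'n \<Rightarrow> real ^ 'n) field"
    and \<mu> :: "('p, 'n) form"
    and v :: "real \<Rightarrow> ('p, 'n) vfield"
    and p :: "real \<Rightarrow> ('p, 'n) scalar"
    and \<tau> :: "real \<Rightarrow> ('p, 'n) form"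
    and h \<gamma> :: "real \<Rightarrow> ('p, 'n) bilin"
    and \<xi> :: "real \<Rightarrow> ('p, 'n) multivec"
    and t :: real
  assumes "CARD('n) \<ge> 3"
    and "aristotelian_fluid A I g \<Gamma> \<mu> v p \<tau> h \<gamma>"
    and "is_vorticity A I g \<mu> v \<xi>"
    and "t \<in> I"
  shows "let s = speed_sq g (v t);
             \<omega> = contract (CARD('n) - 2) (\<xi> t) \<mu>;
             \<omega>t = contract (CARD('n) - 2) (time_deriv_multivec \<xi> t) \<mu>;
             \<alpha> = alpha_form g (v t) (\<tau> t);
             u = flat g (v t);
             Ls = lie_scalar (v t) s
         in field_eq A (ext_d 1 u) (wedge 1 1 u \<alpha>) \<and>
            GV A (\<tau> t) = GV A u \<and>
            GV A u = deRham_class A 3 (wedge 1 2 \<alpha> (ext_d 1 \<alpha>)) \<and>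
            GV A (\<tau> t) \<in> deRham_cohomology A 3 \<and>
            closed_form A 3 (wedge 1 2 \<alpha> (ext_d 1 \<alpha>)) \<and>
            field_eq A (wedge 1 2 \<alpha> (ext_d 1 \<alpha>))
              (\<lambda>c x X. - ext_d 2 (scale_form (\<lambda>c x. Ls c x / (s c x)\<^sup>2) \<omega>) c x X
                 - 1 / (s c x)\<^sup>2 * wedge 1 2 (int_prod (v t) \<omega>) \<omega>t c x X) \<and>
            (field_eq A Ls (\<lambda>c x. 0) \<longrightarrow>
               field_eq A (wedge 1 2 \<alpha> (ext_d 1 \<alpha>))
                 (\<lambda>c x X. - 1 / (s c x)\<^sup>2 * wedge 1 2 (int_prod (v t) \<omega>) \<omega>t c x X) \<and>
               (field_eq A (time_deriv_multivec \<xi> t) (\<lambda>c x \<Theta>. 0) \<longrightarrow>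
                  GV A (\<tau> t) = deRham_class A 3 (\<lambda>c x X. 0)))"
proof -
  define s where "s = speed_sq g (v t)"
  define \<omega> where "\<omega> = contract (CARD('n) - 2) (\<xi> t) \<mu>"
  define \<omega>t where "\<omega>t = contract (CARD('n) - 2) (time_deriv_multivec \<xi> t) \<mu>"
  define \<alpha> where "\<alpha> = alpha_form g (v t) (\<tau> t)"
  define u where "u = flat g (v t)"
  define Ls where "Ls = lie_scalar (v t) s"
  note t = \<open>t \<in> I\<close>
  have fluid: "ideal_fluid A I g \<Gamma> \<mu> v p" using assms(2) by (simp add: aristotelian_fluid_def)
  interpret oriented_manifold A
    using fluid by unfold_locales (simp add: ideal_fluid_def)
  have g: "riemannian_metric A g" and V: "vector_field A (v t)"
    using fluid t by (auto simp: ideal_fluid_def)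
  have \<tau>: "form_field A 1 (\<tau> t)"
    and integrable: "field_eq A (wedge 1 2 (\<tau> t) (ext_d 1 (\<tau> t))) (\<lambda>c x X. 0)"
    and pointwise: "\<And>c x. c \<in> A \<Longrightarrow> x \<in> img c \<Longrightarrow> (\<forall>X. int_prod (v t) (\<tau> t) c x X = 1) \<and>
      (\<forall>X. \<tau> t c x (\<lambda>_. X) = 0 \<longrightarrow> (\<forall>W\<in>span {v t c x}. g c x X W = 0))"
    using assms(2) t by (auto simp: aristotelian_fluid_def)
  have \<tau>V: "ev1 (\<tau> t) c x (v t c x) = 1" if x: "c \<in> A" "x \<in> img c" for c x
    using pointwise[OF x] ev1_eval[OF \<tau> x, of "case_nat (v t c x) (\<lambda>_. 0)"] by (simp add: int_prod_def)
  have orth: "g c x X (v t c x) = 0" if "c \<in> A" "x \<in> img c" "ev1 (\<tau> t) c x X = 0" for c x X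
    using pointwise[OF that(1,2)] that(3) by (simp add: span_base)
  note hyps = g V \<tau> \<tau>V integrable orth
  have \<omega>_eq: "\<omega> c x = ext_d 1 u c x" if "c \<in> A" "x \<in> img c" for c x
    using assms(3) t that by (simp add: is_vorticity_def field_eq_def \<omega>_def u_def)
  have du: "field_eq A (ext_d 1 u) (wedge 1 1 u \<alpha>)"
    unfolding u_def \<alpha>_def by (rule d_flat[OF hyps])
  have GVu: "GV A u = deRham_class A 3 (wedge 1 2 \<alpha> (ext_d 1 \<alpha>))"
    unfolding u_def \<alpha>_def by (rule GV_flat[OF hyps])
  have GV\<tau>: "GV A (\<tau> t) = deRham_class A 3 (wedge 1 2 \<alpha> (ext_d 1 \<alpha>))"
    unfolding \<alpha>_def by (rule GV_clock_form[OF hyps])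
  have closed: "closed_form A 3 (wedge 1 2 \<alpha> (ext_d 1 \<alpha>))"
    unfolding \<alpha>_def by (rule alpha_d_alpha_closed[OF hyps])
  have main: "field_eq A (wedge 1 2 \<alpha> (ext_d 1 \<alpha>))
    (\<lambda>c x X. - ext_d 2 (scale_form (\<lambda>c x. Ls c x / (s c x)\<^sup>2) \<omega>) c x X
      - 1 / (s c x)\<^sup>2 * wedge 1 2 (int_prod (v t) \<omega>) \<omega>t c x X)"
    unfolding field_eq_def
  proof (intro ballI ext)
    fix c x and X :: "nat \<Rightarrow> real ^ 'n" assume x: "c \<in> A" "x \<in> img c"
    let ?\<eta> = "int_prod (v t) (ext_d 1 u)"
    have "field_eq A (scale_form (\<lambda>c x. Ls c x / (s c x)\<^sup>2) \<omega>) (scale_form (\<lambda>c x. Ls c x / (s c x)\<^sup>2) (ext_d 1 u))"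
      by (simp add: field_eq_def scale_form_def \<omega>_eq)
    from ext_d_cong[OF this, of 2] x
    have 1: "ext_d 2 (scale_form (\<lambda>c x. Ls c x / (s c x)\<^sup>2) \<omega>) c x =
        ext_d 2 (scale_form (\<lambda>c x. Ls c x / (s c x)\<^sup>2) (ext_d 1 u)) c x" by (simp add: field_eq_def)
    \<comment> \<open>The wedge is pointwise, so it suffices to replace the values of both factors
      at x.\<close>
    have "wedge 1 2 (int_prod (v t) \<omega>) \<omega>t c x = wedge 1 2 ?\<eta> (\<lambda>c x X. - ext_d 1 ?\<eta> c x X) c x"
      using vorticity_equation[OF fluid assms(3) t x]
      by (intro wedge_cong) (auto simp: int_prod_def \<omega>_eq[OF x] \<omega>t_def u_def fun_eq_iff)
    then have 2: "wedge 1 2 (int_prod (v t) \<omega>) \<omega>t c x X = - wedge 1 2 ?\<eta> (ext_d 1 ?\<eta>) c x X"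
      by (simp add: wedge_minus_right)
    have 3: "wedge 1 2 \<alpha> (ext_d 1 \<alpha>) c x X =
        - ext_d 2 (scale_form (\<lambda>c x. Ls c x / (s c x)\<^sup>2) (ext_d 1 u)) c x X
        + 1 / (s c x)\<^sup>2 * wedge 1 2 ?\<eta> (ext_d 1 ?\<eta>) c x X"
      unfolding \<alpha>_def u_def s_def Ls_def by (rule alpha_wedge_d_alpha[OF hyps x])
    show "wedge 1 2 \<alpha> (ext_d 1 \<alpha>) c x X =
        - ext_d 2 (scale_form (\<lambda>c x. Ls c x / (s c x)\<^sup>2) \<omega>) c x X
        - 1 / (s c x)\<^sup>2 * wedge 1 2 (int_prod (v t) \<omega>) \<omega>t c x X"
      unfolding 1 2 3 by simp
  qed
  have main0: "field_eq A (wedge 1 2 \<alpha> (ext_d 1 \<alpha>))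
      (\<lambda>c x X. - 1 / (s c x)\<^sup>2 * wedge 1 2 (int_prod (v t) \<omega>) \<omega>t c x X)"
    if "field_eq A Ls (\<lambda>c x. 0)"
  proof -
    \<comment> \<open>With L_v s = 0 the form under the differential vanishes on whole chart images,
      hence so does its differential within them.\<close>
    have "field_eq A (scale_form (\<lambda>c x. Ls c x / (s c x)\<^sup>2) \<omega>) (\<lambda>c x X. 0)"
      using that by (simp add: field_eq_def scale_form_def)
    from ext_d_cong[OF this, of 2]
    have "field_eq A (ext_d 2 (scale_form (\<lambda>c x. Ls c x / (s c x)\<^sup>2) \<omega>)) (\<lambda>c x X. 0)"
      by (simp add: field_eq_def ext_d_def chart_deriv_def fd_const[OF cornered_chart])
    with main show ?thesis by (simp add: field_eq_def)
  qed
  have steady: "GV A (\<tau> t) = deRham_class A 3 (\<lambda>c x X. 0)"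
    if "field_eq A Ls (\<lambda>c x. 0)" "field_eq A (time_deriv_multivec \<xi> t) (\<lambda>c x \<Theta>. 0)"
  proof -
    have "\<omega>t c x X = 0" if "c \<in> A" "x \<in> img c" for c x X
      using \<open>field_eq A (time_deriv_multivec \<xi> t) (\<lambda>c x \<Theta>. 0)\<close> that
      by (simp add: field_eq_def \<omega>t_def contract_def)
    then have "field_eq A (wedge 1 2 \<alpha> (ext_d 1 \<alpha>)) (\<lambda>c x X. 0)"
      using main0[OF that(1)] by (simp add: field_eq_def wedge_def)
    from deRham_class_cong[OF this, of 2] show ?thesis
      unfolding GV\<tau> by (simp add: numeral_3_eq_3 numeral_2_eq_2)
  qed
  have "GV A (\<tau> t) \<in> deRham_cohomology A 3"
    unfolding GV\<tau> deRham_cohomology_def using closed by blast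
  then show ?thesis
    unfolding Let_def s_def[symmetric] \<omega>_def[symmetric] \<omega>t_def[symmetric] \<alpha>_def[symmetric] u_def[symmetric]
      Ls_def[symmetric]
    using du GVu GV\<tau> closed main main0 steady by simp
qed

end
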